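(* For every unsatisfiable formula $\Gamma$ let $m(\Gamma)=\lceil\log(\mathrm{size}_{\mathsf{SBC}^-}(\Gamma))\rceil$ and $\mathcal{K}(\Gamma)=\mathcal{I}_{m(\Gamma)}(\Gamma)$. Then the formulas $\mathcal{K}(\mathrm{BPHP}_n)$ admit $\mathsf{GER}^-$ proofs of size $n^{O(1)}$, but every $\mathsf{SBC}^-$ proof of $\mathcal{K}(\mathrm{BPHP}_n)$ has size $2^{\Omega(n)}$.
   Context: A literal is a variable $v$ or its negation $\bar v$. A clause is a nontautological set of literals; $\bot$ is the empty clause; a formula is a finite set of clauses; $\mathrm{var}(\Gamma)$ is its set of variables. For a set $L$ of literals, $\bar L=\{\bar\ell:\ell\in L\}$. $D$ is a weakening of $C$ if $C\subseteq D$. If $C\cup\{x\}$, $D\cup\{\bar x\}$ are clauses with $x,\bar x\notin C\cup D$ and $C\cup D$ nontautological, $C\cup D$ is their resolvent. For a clause $C$ and formula $\Delta$, $C\vee\Delta=\{C\cup D: D\in\Delta,\ C\cup D \text{ nontautological}\}$. Resolution proof of $\Gamma$: sequence of formulas $(\Gamma_1,\dots,\Gamma_N)$, $\Gamma_1=\Gamma$, $\bot\in\Gamma_N$, each $\Gamma_{i+1}=\Gamma_i\cup\{C\}$ with $C$ a resolvent of two clauses of $\Gamma_i$ or a weakening of a clause of $\Gamma_i$; size $N$. $C$ is a set-blocked clause (SBC) for nonempty $L\subseteq C$ w.r.t. $\Gamma$ if for every $D\in\Gamma$ with $D\cap\bar L\ne\varnothing$, $D\cap L=\varnothing$, the set $(C\setminus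 L)\cup(D\setminus\bar L)$ is tautological. An $\mathsf{SBC}$ proof is like a resolution proof but additionally allows adding a clause that is an SBC w.r.t. the current $\Gamma_i$; an $\mathsf{SBC}^-$ proof of $\Gamma$ uses only variables from $\mathrm{var}(\Gamma)$. $\mathrm{size}_{P}(\Gamma)$ is the minimum size of a $P$-proof of $\Gamma$. Blocked clause: $C=\{p\}\cup C'$ ($p\notin C'$) is blocked for $p$ w.r.t. $\Gamma$ if for every $\{\bar p\}\cup D'\in\Gamma$ ($\bar p\notin D'$), $C'\cup D'$ is tautological; $C$ is blocked w.r.t. $\Gamma$ if blocked for some $p\in C$. $\Lambda$ is a blocked extension for $\Gamma$ if there is $\Gamma'\subseteq\Gamma$ and an ordering $(C_1,\dots,C_r)$ of all clauses of $\Lambda\cup(\Gamma\setminus\Gamma')$ with each $C_i$ blocked w.r.t. $\Gamma'\cup\{C_1,\dots,C_{i-1}\}$. A $\mathsf{GER}$ proof of $\Gamma$ is a pair $(\Lambda,\Pi)$, $\Lambda$ a blocked extension for $\Gamma$, $\Pi$ a resolution proof of $\Gamma\cup\Lambda$; size $|\Lambda|+|\Pi|$; $\mathsf{GER}^-$ requires all variables of $\Lambda$ and $\Pi$ to lie in $\mathrm{var}(\Gamma)$. Extended resolution: for a formula $\Delta$, literals $p,q$ and a variable $x$ not occurring in $\Delta,p,q$, $\{\bar x\vee p,\ \bar x\vee q,\ x\vee\bar p\vee\bar q\}$ is a set of extension clauses for $\Delta$. $\Lambda$ is an extension for $\Gamma$ if $\Lambda=\bigcup_{i=1}^t\lambda_i$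 with each $\lambda_i$ a set of extension clauses for $\Gamma\cup\lambda_1\cup\dots\cup\lambda_{i-1}$. An $\mathsf{ER}$ proof of $\Gamma$ is a pair $(\Lambda,\Pi)$ with $\Lambda$ an extension for $\Gamma$ and $\Pi$ a resolution proof of $\Gamma\cup\Lambda$; size $|\Lambda|+|\Pi|$. Construction: for unsatisfiable $\Gamma$, fix a minimum-size $\mathsf{ER}$ proof $(\Lambda,\Pi)$ of $\Gamma$, $\Lambda$ being the union of $t(\Gamma)=|\Lambda|/3$ sets $\lambda_i=\{\bar x_i\vee p_i,\ \bar x_i\vee q_i,\ x_i\vee\bar p_i\vee\bar q_i\}$ with extension variables $x_1,\dots,x_{t(\Gamma)}$. For $m\in\mathbb{N}^+$ let $y_1,\dots,y_m,z_1,\dots,z_m$ be $2m$ distinct variables not in $\mathrm{var}(\Gamma\cup\Lambda)$, and define $V_m(\Gamma)=\bigcup_{i=1}^{t(\Gamma)}\bigcup_{j=1}^m\{x_i\vee y_j\vee\bar z_j,\ \bar x_i\vee y_j\vee\bar z_j\}$, $W_m(\Gamma)=\bigcup_{j=1}^m\big[\{\bar y_j\vee z_j\}\cup(y_j\vee\Gamma)\cup(\bar z_j\vee\Gamma)\big]$, $\mathcal{I}_m(\Gamma)=\Gamma\cup V_m(\Gamma)\cup W_m(\Gamma)$. Bit pigeonhole principle: for $n=2^k$, $k\ge1$, variables $p^x_\ell$ ($x\in[n+1]$, $\ell\in[k]$); writing "$v\neq0$" for $v$ and "$v\neq1$" for $\bar v$, $\mathrm{BPHP}_n$ is the set of clauses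 $\bigvee_{\ell=1}^k (p^x_\ell\neq h_\ell)\vee\bigvee_{\ell=1}^k(p^y_\ell\neq h_\ell)$ over all $x\ne y$ in $[n+1]$ and $h\in\{0,1\}^k$. For other $n\ge2$, $\mathrm{BPHP}_n:=\mathrm{BPHP}_m$ with $m$ the largest power of two $\le n$. $\log$ is base 2. *)

theory Defs
  imports Complex_Main "HOL-Library.Nat_Bijection"
begin

section \<open>Literals, clauses, formulas\<close>

datatype 'v literal = Pos 'v | Neg 'v

fun lit_var :: "'v literal \<Rightarrow> 'v" where
  "lit_var (Pos v) = v"
| "lit_var (Neg v) = v"

fun negate :: "'v literal \<Rightarrow> 'v literal" where
  "negate (Pos v) = Neg v"
| "negate (Neg v) = Pos v"

definition tautological :: "'v literal set \<Rightarrow> bool" where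
  "tautological C \<longleftrightarrow> (\<exists>l\<in>C. negate l \<in> C)"

definition is_clause :: "'v literal set \<Rightarrow> bool" where
  "is_clause C \<longleftrightarrow> finite C \<and> \<not> tautological C"

definition is_formula :: "'v literal set set \<Rightarrow> bool" where
  "is_formula \<Gamma> \<longleftrightarrow> finite \<Gamma> \<and> (\<forall>C\<in>\<Gamma>. is_clause C)"

definition vars :: "'v literal set set \<Rightarrow> 'v set" where
  "vars \<Gamma> = (\<Union>C\<in>\<Gamma>. lit_var ` C)"

fun holds :: "('v \<Rightarrow> bool) \<Rightarrow> 'v literal \<Rightarrow> bool" where
  "holds \<tau> (Pos v) = \<tau> v"
| "holds \<tau> (Neg v) = (\<not> \<tau> v)"

definition unsatisfiable :: "'v literal set set \<Rightarrow> bool" where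
  "unsatisfiable \<Gamma> \<longleftrightarrow> \<not> (\<exists>\<tau>. \<forall>C\<in>\<Gamma>. \<exists>l\<in>C. holds \<tau> l)"

definition clause_or :: "'v literal set \<Rightarrow> 'v literal set set \<Rightarrow> 'v literal set set" where
  "clause_or C \<Delta> = {C \<union> D | D. D \<in> \<Delta> \<and> \<not> tautological (C \<union> D)}"

section \<open>Resolution and set-blocked clauses\<close>

definition resolvent :: "'v literal set \<Rightarrow> 'v literal set \<Rightarrow> 'v literal set \<Rightarrow> bool" where
  "resolvent A B R \<longleftrightarrow> (\<exists>x C D. A = C \<union> {Pos x} \<and> B = D \<union> {Neg x} \<and>
     Pos x \<notin> C \<union> D \<and> Neg x \<notin> C \<union> D \<and> \<not> tautological (C \<union> D) \<and> R = C \<union> D)"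

definition res_derivable :: "'v literal set set \<Rightarrow> 'v literal set \<Rightarrow> bool" where
  "res_derivable \<Gamma> C \<longleftrightarrow>
     (\<exists>A\<in>\<Gamma>. \<exists>B\<in>\<Gamma>. resolvent A B C) \<or> (is_clause C \<and> (\<exists>A\<in>\<Gamma>. A \<subseteq> C))"

definition set_blocked_for ::
    "'v literal set \<Rightarrow> 'v literal set \<Rightarrow> 'v literal set set \<Rightarrow> bool" where
  "set_blocked_for L C \<Gamma> \<longleftrightarrow> L \<noteq> {} \<and> L \<subseteq> C \<and>
     (\<forall>D\<in>\<Gamma>. D \<inter> negate ` L \<noteq> {} \<and> D \<inter> L = {} \<longrightarrow> tautological ((C - L) \<union> (D - negate ` L)))"

definition sbc_derivable :: "'v literal set set \<Rightarrow> 'v literal set \<Rightarrow> bool" where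
  "sbc_derivable \<Gamma> C \<longleftrightarrow>
     res_derivable \<Gamma> C \<or> (is_clause C \<and> (\<exists>L. set_blocked_for L C \<Gamma>))"

definition is_proof_by ::
    "('v literal set set \<Rightarrow> 'v literal set \<Rightarrow> bool) \<Rightarrow> 'v literal set set \<Rightarrow> 'v literal set set list \<Rightarrow> bool" where
  "is_proof_by derivable \<Gamma> \<Pi> \<longleftrightarrow> \<Pi> \<noteq> [] \<and> \<Pi> ! 0 = \<Gamma> \<and> {} \<in> last \<Pi> \<and>
     (\<forall>i. Suc i < length \<Pi> \<longrightarrow> (\<exists>C. derivable (\<Pi> ! i) C \<and> \<Pi> ! Suc i = \<Pi> ! i \<union> {C}))"

abbreviation res_proof :: "'v literal set set \<Rightarrow> 'v literal set set list \<Rightarrow> bool" where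
  "res_proof \<equiv> is_proof_by res_derivable"

abbreviation sbc_proof :: "'v literal set set \<Rightarrow> 'v literal set set list \<Rightarrow> bool" where
  "sbc_proof \<equiv> is_proof_by sbc_derivable"

definition proof_vars :: "'v literal set set list \<Rightarrow> 'v set" where
  "proof_vars \<Pi> = (\<Union>\<Delta>\<in>set \<Pi>. vars \<Delta>)"

definition sbc_minus_proof :: "'v literal set set \<Rightarrow> 'v literal set set list \<Rightarrow> bool" where
  "sbc_minus_proof \<Gamma> \<Pi> \<longleftrightarrow> sbc_proof \<Gamma> \<Pi> \<and> proof_vars \<Pi> \<subseteq> vars \<Gamma>"

definition sbc_minus_size :: "'v literal set set \<Rightarrow> nat" where
  "sbc_minus_size \<Gamma> = (LEAST N. \<exists>\<Pi>. sbc_minus_proof \<Gamma> \<Pi> \<and> length \<Pi> = N)"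

section \<open>Blocked extensions\<close>

definition blocked_for :: "'v literal \<Rightarrow> 'v literal set \<Rightarrow> 'v literal set set \<Rightarrow> bool" where
  "blocked_for p C \<Gamma> \<longleftrightarrow> p \<in> C \<and>
     (\<forall>D\<in>\<Gamma>. negate p \<in> D \<longrightarrow> tautological ((C - {p}) \<union> (D - {negate p})))"

definition blocked :: "'v literal set \<Rightarrow> 'v literal set set \<Rightarrow> bool" where
  "blocked C \<Gamma> \<longleftrightarrow> (\<exists>p\<in>C. blocked_for p C \<Gamma>)"

definition blocked_extension :: "'v literal set set \<Rightarrow> 'v literal set set \<Rightarrow> bool" where
  "blocked_extension \<Gamma> \<Lambda> \<longleftrightarrow> is_formula \<Lambda> \<and>
     (\<exists>\<Gamma>' Cs. \<Gamma>' \<subseteq> \<Gamma> \<and> distinct Cs \<and> set Cs = \<Lambda> \<union> (\<Gamma> - \<Gamma>') \<and>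
        (\<forall>i < length Cs. blocked (Cs ! i) (\<Gamma>' \<union> set (take i Cs))))"

definition ger_minus_proof ::
    "'v literal set set \<Rightarrow> 'v literal set set \<Rightarrow> 'v literal set set list \<Rightarrow> bool" where
  "ger_minus_proof \<Gamma> \<Lambda> \<Pi> \<longleftrightarrow> blocked_extension \<Gamma> \<Lambda> \<and> res_proof (\<Gamma> \<union> \<Lambda>) \<Pi> \<and>
     vars \<Lambda> \<subseteq> vars \<Gamma> \<and> proof_vars \<Pi> \<subseteq> vars \<Gamma>"

section \<open>Extended resolution\<close>

text \<open>A triple \<open>(x, p, q)\<close> stands for the extension clauses introducing \<open>x\<close> as the conjunction of
  \<open>p\<close> and \<open>q\<close>.\<close>

type_synonym 'v ext = "'v \<times> 'v literal \<times> 'v literal"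

fun ext_clauses :: "'v ext \<Rightarrow> 'v literal set set" where
  "ext_clauses (x, p, q) = {{Neg x, p}, {Neg x, q}, {Pos x, negate p, negate q}}"

text \<open>The condition \<open>is_formula\<close> only excludes \<open>q = negate p\<close>, for which the third set of literals
  is not a clause.\<close>

fun is_ext_for :: "'v literal set set \<Rightarrow> 'v ext \<Rightarrow> bool" where
  "is_ext_for \<Delta> (x, p, q) \<longleftrightarrow>
     x \<notin> vars \<Delta> \<and> x \<noteq> lit_var p \<and> x \<noteq> lit_var q \<and> is_formula (ext_clauses (x, p, q))"

definition ext_union :: "'v ext list \<Rightarrow> 'v literal set set" where
  "ext_union es = (\<Union>e\<in>set es. ext_clauses e)"

definition ext_sequence :: "'v literal set set \<Rightarrow> 'v ext list \<Rightarrow> bool" where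
  "ext_sequence \<Gamma> es \<longleftrightarrow>
     (\<forall>i < length es. is_ext_for (\<Gamma> \<union> ext_union (take i es)) (es ! i))"

definition er_proof ::
    "'v literal set set \<Rightarrow> 'v literal set set \<Rightarrow> 'v literal set set list \<Rightarrow> bool" where
  "er_proof \<Gamma> \<Lambda> \<Pi> \<longleftrightarrow>
     (\<exists>es. ext_sequence \<Gamma> es \<and> \<Lambda> = ext_union es) \<and> res_proof (\<Gamma> \<union> \<Lambda>) \<Pi>"

definition min_er_proof ::
    "'v literal set set \<Rightarrow> 'v literal set set \<Rightarrow> 'v literal set set list \<Rightarrow> bool" where
  "min_er_proof \<Gamma> \<Lambda> \<Pi> \<longleftrightarrow> er_proof \<Gamma> \<Lambda> \<Pi> \<and>
     (\<forall>\<Lambda>' \<Pi>'. er_proof \<Gamma> \<Lambda>' \<Pi>' \<longrightarrow> card \<Lambda> + length \<Pi> \<le> card \<Lambda>' + length \<Pi>')"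

section \<open>The construction\<close>

definition V_part :: "nat \<Rightarrow> 'v ext list \<Rightarrow> (nat \<Rightarrow> 'v) \<Rightarrow> (nat \<Rightarrow> 'v) \<Rightarrow> 'v literal set set" where
  "V_part m es y z = (\<Union>(x, p, q)\<in>set es. \<Union>j\<in>{1..m}.
     {{Pos x, Pos (y j), Neg (z j)}, {Neg x, Pos (y j), Neg (z j)}})"

definition W_part ::
    "nat \<Rightarrow> 'v literal set set \<Rightarrow> (nat \<Rightarrow> 'v) \<Rightarrow> (nat \<Rightarrow> 'v) \<Rightarrow> 'v literal set set" where
  "W_part m \<Gamma> y z = (\<Union>j\<in>{1..m}.
     {{Neg (y j), Pos (z j)}} \<union> clause_or {Pos (y j)} \<Gamma> \<union> clause_or {Neg (z j)} \<Gamma>)"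

text \<open>The construction depends on the choice of a minimum-size ER proof \<open>(\<Lambda>, \<Pi>)\<close>, of its
  presentation \<open>es\<close>, and of the fresh variables; \<open>is_I m \<Gamma> F\<close> says that \<open>F\<close> is the result for some
  such choice. The number of sets of extension clauses is \<open>length es\<close>. It equals \<open>card \<Lambda> / 3\<close>: an
  extension variable with \<open>p = q\<close>, whose set has only two clauses, could be substituted by \<open>p\<close>,
  contradicting minimality. For \<open>m = 0\<close> the result is \<open>\<Gamma>\<close>.\<close>

definition is_I :: "nat \<Rightarrow> 'v literal set set \<Rightarrow> 'v literal set set \<Rightarrow> bool" where
  "is_I m \<Gamma> F \<longleftrightarrow> (\<exists>\<Lambda> \<Pi> es y z.
     min_er_proof \<Gamma> \<Lambda> \<Pi> \<and> ext_sequence \<Gamma> es \<and> \<Lambda> = ext_union es \<and>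
     inj_on y {1..m} \<and> inj_on z {1..m} \<and> y ` {1..m} \<inter> z ` {1..m} = {} \<and>
     (y ` {1..m} \<union> z ` {1..m}) \<inter> vars (\<Gamma> \<union> \<Lambda>) = {} \<and>
     F = \<Gamma> \<union> V_part m es y z \<union> W_part m \<Gamma> y z)"

definition m_of :: "'v literal set set \<Rightarrow> nat" where
  "m_of \<Gamma> = nat \<lceil>log 2 (real (sbc_minus_size \<Gamma>))\<rceil>"

section \<open>The bit pigeonhole principle\<close>

definition bphp_var :: "nat \<Rightarrow> nat \<Rightarrow> nat" where
  "bphp_var x l = prod_encode (x, l)"

text \<open>The literal asserting that bit \<open>l\<close> of pigeon \<open>x\<close> differs from \<open>b\<close>, with \<open>True\<close> for 1.\<close>

definition bit_differs :: "nat \<Rightarrow> nat \<Rightarrow> bool \<Rightarrow> nat literal" where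
  "bit_differs x l b = (if b then Neg (bphp_var x l) else Pos (bphp_var x l))"

definition bphp_pow :: "nat \<Rightarrow> nat literal set set" where
  "bphp_pow k = {(\<lambda>l. bit_differs x l (h l)) ` {1..k} \<union> (\<lambda>l. bit_differs y l (h l)) ` {1..k} | x y h.
     x \<in> {1..2 ^ k + 1} \<and> y \<in> {1..2 ^ k + 1} \<and> x \<noteq> y}"

definition BPHP :: "nat \<Rightarrow> nat literal set set" where
  "BPHP n = bphp_pow (GREATEST k. 2 ^ k \<le> n)"

end

theory Submission
  imports Defs
begin

text \<open>Upper bound: the clauses \<open>V\<close> are blocked on \<open>y j\<close>, so they can be taken out of the formula,
  the extension clauses added as blocked clauses on the now unused variables \<open>x i\<close>, and \<open>V\<close> put
  back. Hence a GER- proof is as short as an ER proof of the bit pigeonhole principle, which is Cook's.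

  Lower bound: fix \<open>y j = z j = b j\<close>. This turns \<open>I m \<Gamma>\<close> into \<open>\<Gamma>\<close>, and turns a set-blocked clause into
  a set-blocked clause unless its set \<open>L\<close> mentions a new variable. In that case either the clause
  contains \<open>y j\<close> and the negation of \<open>z j\<close> for some \<open>j\<close>, or it mentions \<open>y j\<close> or \<open>z j\<close> for every \<open>j\<close>;
  so fewer than \<open>2 ^ m\<close> such clauses are all satisfied by a suitable \<open>b\<close>. It remains to bound SBC- proofs
  of the bit pigeonhole principle. There a set-blocked clause mentions all pigeons, and a short proof has
  a partial matching of a quarter of the holes satisfying all wide clauses. What is left is a narrow
  resolution refutation, which is impossible because a matching of the pigeons of a clause can be extended.\<close>

section \<open>Derivations as reachability\<close>

text \<open>Both proof systems are confined to \<open>vars F\<close>, so what separates them is the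
  order in which clauses are present. \<open>V\<close> brings the extension variables into
  \<open>vars F\<close> and occupies them in both polarities, which blocks set-blocked steps on them
  while \<open>V\<close> is there; only a blocked extension may take \<open>V\<close> away and
  return it later. \<open>W\<close> protects the new variables themselves: an \<open>L\<close>
  containing \<open>Neg (y j)\<close> or \<open>Pos (z j)\<close> would have to be blocked against a
  whole copy of \<open>\<Gamma>\<close>, and that would make \<open>\<Gamma>\<close> satisfiable.

  The obstacle of the lower bound is that set-blockedness refers to the entire current formula. It
  is preserved neither by adding clauses nor by arbitrary restrictions, so the assignment to the new
  variables has to satisfy every set-blocked clause whose \<open>L\<close> it touches. The value of
  \<open>m\<close> is tuned to this: if \<open>s\<close> is the least size for
  \<open>\<Gamma>\<close> and \<open>2 ^ m \<ge> s\<close>, then a proof of \<open>F\<close> longer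
  than \<open>2 ^ m\<close> is long enough anyway, and any other adds fewer than
  \<open>2 ^ m\<close> clauses.\<close>

inductive steps ::
    "('v literal set set \<Rightarrow> 'v literal set \<Rightarrow> bool) \<Rightarrow> nat \<Rightarrow> 'v literal set set \<Rightarrow> 'v literal set set \<Rightarrow> bool"
  for d where
  refl: "steps d 0 \<Gamma> \<Gamma>"
| step: "steps d n \<Gamma> \<Delta> \<Longrightarrow> d \<Delta> C \<Longrightarrow> steps d (Suc n) \<Gamma> (insert C \<Delta>)"

lemma steps_subset: "steps d n \<Gamma> \<Delta> \<Longrightarrow> \<Gamma> \<subseteq> \<Delta>"
  by (induction rule: steps.induct) auto

text \<open>The counting arguments look only at the clauses that a proof adds. There may be fewer of
  them than steps, since a step may repeat a clause.\<close>

lemma steps_card: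
  assumes "steps d n \<Gamma> \<Delta>"
  shows "finite (\<Delta> - \<Gamma>) \<and> card (\<Delta> - \<Gamma>) \<le> n"
  using assms
proof (induction rule: steps.induct)
  case (step n \<Gamma> \<Delta> C)
  have "insert C \<Delta> - \<Gamma> \<subseteq> insert C (\<Delta> - \<Gamma>)" by auto
  with step.IH have "card (insert C \<Delta> - \<Gamma>) \<le> card (insert C (\<Delta> - \<Gamma>))"
    by (intro card_mono) auto
  also have "\<dots> \<le> Suc n" using step.IH by (simp add: card_insert_if)
  finally show ?case using step.IH by (auto simp: insert_Diff_if)
qed simp

lemma steps_trans:
  assumes "steps d m \<Delta> \<Theta>" "steps d n \<Gamma> \<Delta>"
  shows "steps d (n + m) \<Gamma> \<Theta>"
  using assms by (induction rule: steps.induct) (auto intro: steps.intros)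

lemma steps_of_list:
  assumes "\<forall>i. Suc i < length \<Pi> \<longrightarrow> (\<exists>C. d (\<Pi> ! i) C \<and> \<Pi> ! Suc i = \<Pi> ! i \<union> {C})"
    and "i < length \<Pi>"
  shows "steps d i (\<Pi> ! 0) (\<Pi> ! i)"
  using assms(2)
proof (induction i)
  case (Suc i)
  from assms(1) Suc.prems obtain C where "d (\<Pi> ! i) C" "\<Pi> ! Suc i = \<Pi> ! i \<union> {C}" by meson
  with Suc show ?case by (simp add: steps.step)
qed (rule steps.refl)

lemma steps_of_proof:
  assumes "is_proof_by d \<Gamma> \<Pi>"
  obtains n where "length \<Pi> = Suc n" "steps d n \<Gamma> (last \<Pi>)" "{} \<in> last \<Pi>"
proof -
  from assms have ne: "\<Pi> \<noteq> []" and 0: "\<Pi> ! 0 = \<Gamma>" and "{} \<in> last \<Pi>"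
    by (auto simp: is_proof_by_def)
  moreover have "steps d (length \<Pi> - 1) (\<Pi> ! 0) (\<Pi> ! (length \<Pi> - 1))"
    using assms ne by (intro steps_of_list) (auto simp: is_proof_by_def)
  ultimately show ?thesis using that[of "length \<Pi> - 1"] by (simp add: last_conv_nth)
qed

lemma vars_mono: "\<Gamma> \<subseteq> \<Delta> \<Longrightarrow> vars \<Gamma> \<subseteq> vars \<Delta>"
  by (auto simp: vars_def)

lemma vars_Un [simp]: "vars (\<Gamma> \<union> \<Delta>) = vars \<Gamma> \<union> vars \<Delta>"
  by (auto simp: vars_def)

lemma vars_empty [simp]: "vars {} = {}"
  by (simp add: vars_def)

lemma vars_insert [simp]: "vars (insert C \<Gamma>) = lit_var ` C \<union> vars \<Gamma>"
  by (auto simp: vars_def)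

lemma vars_memberI: "C \<in> \<Gamma> \<Longrightarrow> l \<in> C \<Longrightarrow> lit_var l \<in> vars \<Gamma>"
  by (auto simp: vars_def)

text \<open>The formulas along a derivation only grow, so the variables of the last one bound those
  of the whole proof.\<close>

lemma proof_of_steps:
  assumes "steps d n \<Gamma> \<Delta>"
  shows "\<exists>\<Pi>. \<Pi> \<noteq> [] \<and> \<Pi> ! 0 = \<Gamma> \<and> last \<Pi> = \<Delta> \<and> length \<Pi> = Suc n \<and> proof_vars \<Pi> \<subseteq> vars \<Delta> \<and>
     (\<forall>i. Suc i < length \<Pi> \<longrightarrow> (\<exists>C. d (\<Pi> ! i) C \<and> \<Pi> ! Suc i = \<Pi> ! i \<union> {C}))"
  using assms
proof (induction rule: steps.induct)
  case (refl \<Gamma>)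
  show ?case by (rule exI[of _ "[\<Gamma>]"]) (simp add: proof_vars_def)
next
  case (step n \<Gamma> \<Delta> C)
  then obtain \<Pi> where \<Pi>: "\<Pi> \<noteq> []" "\<Pi> ! 0 = \<Gamma>" "last \<Pi> = \<Delta>" "length \<Pi> = Suc n" "proof_vars \<Pi> \<subseteq> vars \<Delta>"
    "\<forall>i. Suc i < length \<Pi> \<longrightarrow> (\<exists>C. d (\<Pi> ! i) C \<and> \<Pi> ! Suc i = \<Pi> ! i \<union> {C})"
    by blast
  have "\<exists>C'. d ((\<Pi> @ [insert C \<Delta>]) ! i) C' \<and> (\<Pi> @ [insert C \<Delta>]) ! Suc i = (\<Pi> @ [insert C \<Delta>]) ! i \<union> {C'}"
    if i: "Suc i < length (\<Pi> @ [insert C \<Delta>])" for i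
  proof (cases "Suc i < length \<Pi>")
    case True
    then show ?thesis using \<Pi>(6) by (simp add: nth_append)
  next
    case False
    then have "i = n" using i \<Pi>(4) by simp
    then have "(\<Pi> @ [insert C \<Delta>]) ! i = \<Delta>" using \<Pi>(1,3,4) by (simp add: nth_append last_conv_nth)
    then show ?thesis using False \<open>i = n\<close> \<Pi>(4) step.hyps by (auto simp: nth_append intro!: exI[of _ C])
  qed
  moreover have "proof_vars (\<Pi> @ [insert C \<Delta>]) \<subseteq> vars (insert C \<Delta>)"
    using \<Pi>(5) by (auto simp: proof_vars_def)
  moreover have "(\<Pi> @ [insert C \<Delta>]) ! 0 = \<Gamma>" using \<Pi>(1,2) by (simp add: nth_append)
  ultimately show ?case using \<Pi> by (intro exI[of _ "\<Pi> @ [insert C \<Delta>]"]) auto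
qed

lemma proof_of_steps_bot:
  assumes "steps d n \<Gamma> \<Delta>" "{} \<in> \<Delta>"
  obtains \<Pi> where "is_proof_by d \<Gamma> \<Pi>" "length \<Pi> = Suc n" "proof_vars \<Pi> \<subseteq> vars \<Delta>"
  using proof_of_steps[OF assms(1)] assms(2) unfolding is_proof_by_def by metis

section \<open>Sized resolution derivations\<close>

lemma negate_negate [simp]: "negate (negate l) = l"
  by (cases l) auto

lemma lit_var_negate [simp]: "lit_var (negate l) = lit_var l"
  by (cases l) auto

lemma negate_neq [simp]: "negate l \<noteq> l" "l \<noteq> negate l"
  by (cases l; simp)+

lemma negate_inject [simp]: "negate l = negate l' \<longleftrightarrow> l = l'"
  by (metis negate_negate)

lemma holds_negate [simp]: "holds \<tau> (negate l) \<longleftrightarrow> \<not> holds \<tau> l"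
  by (cases l) auto

lemma lit_var_eq_iff: "lit_var l = lit_var l' \<longleftrightarrow> l = l' \<or> l = negate l'"
  by (cases l; cases l') auto

lemma holds_cong: "\<tau> (lit_var l) = \<tau>' (lit_var l) \<Longrightarrow> holds \<tau> l = holds \<tau>' l"
  by (cases l) auto

lemma res_derivable_mono: "\<Gamma> \<subseteq> \<Gamma>' \<Longrightarrow> res_derivable \<Gamma> C \<Longrightarrow> res_derivable \<Gamma>' C"
  unfolding res_derivable_def by blast

text \<open>Side clauses never disturb resolution or weakening. This is particular to
  \<open>res_derivable\<close>: an additional clause can destroy set-blockedness.\<close>

lemma steps_res_frame:
  assumes "steps res_derivable n \<Gamma> \<Delta>"
  shows "steps res_derivable n (\<Gamma> \<union> X) (\<Delta> \<union> X)"
  using assms by (induction rule: steps.induct) (auto simp: steps.refl intro!: steps.step elim!: res_derivable_mono[rotated])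

text \<open>The slack in both the number of steps and the final formula makes derivations monotone
  and composable without tracking the exact clause sets. Intermediate clauses may use any
  variables.\<close>

definition der :: "'v literal set set \<Rightarrow> nat \<Rightarrow> 'v literal set set \<Rightarrow> bool" where
  "der \<Gamma> N S \<longleftrightarrow> (\<exists>n\<le>N. \<exists>\<Delta>. steps res_derivable n \<Gamma> \<Delta> \<and> S \<subseteq> \<Delta>)"

lemma der_refl: "S \<subseteq> \<Gamma> \<Longrightarrow> der \<Gamma> N S"
  unfolding der_def by (blast intro: steps.refl)

lemma der_mono:
  assumes "der \<Gamma> N S" "\<Gamma> \<subseteq> \<Gamma>'" "N \<le> N'" "S' \<subseteq> S"
  shows "der \<Gamma>' N' S'"
proof -
  obtain n \<Delta> where "n \<le> N" "steps res_derivable n \<Gamma> \<Delta>" "S \<subseteq> \<Delta>" using assms(1) unfolding der_def by blast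
  moreover have "\<Gamma> \<union> \<Gamma>' = \<Gamma>'" using assms by auto
  ultimately have "n \<le> N'" "steps res_derivable n \<Gamma>' (\<Delta> \<union> \<Gamma>')" "S' \<subseteq> \<Delta> \<union> \<Gamma>'"
    using assms steps_res_frame[of n \<Gamma> \<Delta> \<Gamma>'] by auto
  then show ?thesis unfolding der_def by blast
qed

lemma der_trans:
  assumes "der \<Gamma> N S" "der (\<Gamma> \<union> S) M T"
  shows "der \<Gamma> (N + M) (S \<union> T)"
proof -
  obtain n \<Delta> where 1: "n \<le> N" "steps res_derivable n \<Gamma> \<Delta>" "S \<subseteq> \<Delta>"
    using assms(1) unfolding der_def by blast
  have "der \<Delta> M T"
    using assms(2) by (rule der_mono) (use 1 steps_subset[OF 1(2)] in auto)
  then obtain m \<Theta> where 2: "m \<le> M" "steps res_derivable m \<Delta> \<Theta>" "T \<subseteq> \<Theta>"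
    unfolding der_def by blast
  have "steps res_derivable (n + m) \<Gamma> \<Theta>" by (rule steps_trans) fact+
  moreover have "S \<union> T \<subseteq> \<Theta>" using 1 2 steps_subset[OF 2(2)] by auto
  ultimately show ?thesis unfolding der_def using 1 2 by (meson add_mono)
qed

lemma der_trans': "der \<Gamma> N S \<Longrightarrow> der (\<Gamma> \<union> S) M T \<Longrightarrow> N + M \<le> K \<Longrightarrow> der \<Gamma> K T"
  by (rule der_mono[OF der_trans]) auto

lemma der_UN:
  assumes "finite I" "\<And>i. i \<in> I \<Longrightarrow> der \<Gamma> N (S i)"
  shows "der \<Gamma> (card I * N) (\<Union>i\<in>I. S i)"
  using assms
proof (induction I rule: finite_induct)
  case empty
  show ?case by (simp add: der_refl)
next
  case (insert i I)
  have "der \<Gamma> (N + card I * N) (S i \<union> (\<Union>i\<in>I. S i))"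
  proof (rule der_trans)
    show "der (\<Gamma> \<union> S i) (card I * N) (\<Union> (S ` I))"
      by (rule der_mono[of \<Gamma>]) (use insert in auto)
  qed (use insert in auto)
  then show ?case using insert by simp
qed

lemma der_Un: "der \<Gamma> N S \<Longrightarrow> der \<Gamma> M T \<Longrightarrow> der \<Gamma> (N + M) (S \<union> T)"
  by (rule der_trans) (auto elim: der_mono)

lemma der_derivable: "res_derivable \<Gamma> C \<Longrightarrow> der \<Gamma> 1 {C}"
  unfolding der_def by (rule exI[of _ 1]) (use steps.step[OF steps.refl] in fastforce)

lemma der_weaken: "is_clause C \<Longrightarrow> A \<in> \<Gamma> \<Longrightarrow> A \<subseteq> C \<Longrightarrow> der \<Gamma> 1 {C}"
  by (rule der_derivable) (auto simp: res_derivable_def)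

lemma tautological_mono: "tautological C \<Longrightarrow> C \<subseteq> D \<Longrightarrow> tautological D"
  unfolding tautological_def by blast

lemma is_clause_subset: "is_clause D \<Longrightarrow> C \<subseteq> D \<Longrightarrow> is_clause C"
  unfolding is_clause_def using tautological_mono finite_subset by blast

lemma is_clause_insert:
  "is_clause (insert l C) \<longleftrightarrow> is_clause C \<and> negate l \<notin> C"
proof -
  have "tautological (insert l C) \<longleftrightarrow> tautological C \<or> negate l \<in> C"
    unfolding tautological_def
    by (simp only: insert_iff bex_simps negate_neq simp_thms) (metis negate_negate negate_neq(1))
  then show ?thesis by (auto simp: is_clause_def)
qed

lemma is_clause_empty [simp]: "is_clause {}"
  by (simp add: is_clause_def tautological_def)

lemma der_resolve:
  assumes "is_clause C" "insert l C \<in> \<Gamma>" "insert (negate l) C \<in> \<Gamma>"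
    "l \<notin> C" "negate l \<notin> C"
  shows "der \<Gamma> 1 {C}"
proof (rule der_derivable)
  have *: "resolvent (insert (Pos x) C) (insert (Neg x) C) C" if "Pos x \<notin> C" "Neg x \<notin> C" for x
    unfolding resolvent_def
    by (rule exI[of _ x], rule exI[of _ C], rule exI[of _ C]) (use that assms(1) in \<open>auto simp: is_clause_def\<close>)
  show "res_derivable \<Gamma> C"
    using assms * unfolding res_derivable_def by (cases l) auto
qed

text \<open>The bound solves \<open>f 0 = M\<close> and \<open>f (b + 1) = 2 * f b + 1\<close>: two
  subtrees and one resolution step. A variable that \<open>E\<close> already mentions is not
  queried.\<close>

lemma der_branch_aux:
  assumes "finite B" "is_clause E"
    and "\<And>E'. E \<subseteq> E' \<Longrightarrow> is_clause E' \<Longrightarrow> B \<subseteq> lit_var ` E' \<Longrightarrow> lit_var ` E' \<subseteq> lit_var ` E \<union> B \<Longrightarrow> der \<Gamma> M {E'}"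
  shows "der \<Gamma> (2 ^ card B * Suc M - 1) {E}"
  using assms
proof (induction B arbitrary: E rule: finite_induct)
  case empty
  then show ?case by simp
next
  case (insert b B)
  show ?case
  proof (cases "b \<in> lit_var ` E")
    case True
    have "der \<Gamma> (2 ^ card B * Suc M - 1) {E}"
      using True by (intro insert.IH insert.prems) auto
    moreover have "(2::nat) ^ card B * Suc M - 1 \<le> 2 ^ card (insert b B) * Suc M - 1"
      using insert by (intro diff_le_mono mult_le_mono1) simp
    ultimately show ?thesis by (elim der_mono) auto
  next
    case False
    then have nin: "Pos b \<notin> E" "Neg b \<notin> E" by (auto simp: image_iff dest!: bspec)
    have *: "der \<Gamma> (2 ^ card B * Suc M - 1) {insert l E}" if "lit_var l = b" for l
    proof (rule insert.IH)
      have "negate l \<notin> E" using False that by (metis imageI lit_var_negate)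
      then show "is_clause (insert l E)" using insert.prems by (simp add: is_clause_insert)
      fix E' assume "insert l E \<subseteq> E'" "is_clause E'" "B \<subseteq> lit_var ` E'"
        "lit_var ` E' \<subseteq> lit_var ` insert l E \<union> B"
      then show "der \<Gamma> M {E'}" using that by (intro insert.prems) auto
    qed
    have "der \<Gamma> ((2 ^ card B * Suc M - 1) + (2 ^ card B * Suc M - 1)) ({insert (Pos b) E} \<union> {insert (Neg b) E})"
      by (intro der_Un *) auto
    then have "der \<Gamma> ((2 ^ card B * Suc M - 1) + (2 ^ card B * Suc M - 1) + 1) {E}"
      by (rule der_trans'[OF _ der_resolve[of _ "Pos b"]]) (use insert.prems nin in auto)
    moreover have "(2 ^ card B * Suc M - 1) + (2 ^ card B * Suc M - 1) + 1 = 2 ^ card (insert b B) * Suc M - 1"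
    proof -
      have "1 \<le> 2 ^ card B * Suc M" using mult_le_mono[of 1 "2 ^ card B" 1 "Suc M"] by simp
      moreover have "2 ^ card (insert b B) * Suc M = 2 * (2 ^ card B * Suc M)" using insert by simp
      ultimately show ?thesis by linarith
    qed
    ultimately show ?thesis by simp
  qed
qed

text \<open>Decision trees become resolution derivations: query the variables of \<open>B\<close> and derive \<open>E\<close>
  weakened by each of the resulting assignments.\<close>

lemma der_branch:
  assumes "finite B" "is_clause E"
    and "\<And>E'. E \<subseteq> E' \<Longrightarrow> is_clause E' \<Longrightarrow> B \<subseteq> lit_var ` E' \<Longrightarrow> lit_var ` E' \<subseteq> lit_var ` E \<union> B \<Longrightarrow> der \<Gamma> M {E'}"
  shows "der \<Gamma> (2 ^ card B * Suc M) {E}"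
  by (rule der_mono[OF der_branch_aux[OF assms]]) auto

section \<open>Semantic consequences over few variables\<close>

definition sat :: "('v \<Rightarrow> bool) \<Rightarrow> 'v literal set set \<Rightarrow> bool" where
  "sat \<tau> \<Gamma> \<longleftrightarrow> (\<forall>C\<in>\<Gamma>. \<exists>l\<in>C. holds \<tau> l)"

lemma sat_Un [simp]: "sat \<tau> (\<Gamma> \<union> \<Delta>) \<longleftrightarrow> sat \<tau> \<Gamma> \<and> sat \<tau> \<Delta>"
  unfolding sat_def by blast

lemma sat_insert [simp]: "sat \<tau> (insert C \<Gamma>) \<longleftrightarrow> (\<exists>l\<in>C. holds \<tau> l) \<and> sat \<tau> \<Gamma>"
  unfolding sat_def by blast

lemma sat_empty [simp]: "sat \<tau> {}"
  unfolding sat_def by blast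

lemma unsatisfiable_iff: "unsatisfiable \<Gamma> \<longleftrightarrow> (\<forall>\<tau>. \<not> sat \<tau> \<Gamma>)"
  unfolding unsatisfiable_def sat_def by simp

text \<open>The assignment read off from the negation of a clause; variables outside the clause
  default to false.\<close>

definition falsifier :: "'v literal set \<Rightarrow> 'v \<Rightarrow> bool" where
  "falsifier C v \<longleftrightarrow> Neg v \<in> C"

lemma falsifier:
  assumes "\<not> tautological C" "l \<in> C"
  shows "\<not> holds (falsifier C) l"
  using assms unfolding falsifier_def tautological_def by (cases l) (auto dest: bspec)

text \<open>Completeness by brute force. Once all variables of \<open>\<Delta>\<close> are queried,
  the falsifier of a leaf \<open>E'\<close> violates some clause of \<open>\<Delta>\<close>. All
  variables of that clause are decided by \<open>E'\<close>, so it is a subset of \<open>E'\<close>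
  and one weakening yields the leaf.\<close>

lemma der_sem_finer:
  assumes "\<Delta> \<subseteq> \<Gamma>" "finite B" "vars \<Delta> \<subseteq> B" "is_clause E"
    and sem: "\<And>\<tau>. sat \<tau> \<Delta> \<Longrightarrow> \<exists>l\<in>E. holds \<tau> l"
  shows "der \<Gamma> (2 ^ card B * 2) {E}"
  using der_branch[OF assms(2,4), of \<Gamma> 1]
proof (simp only: numeral_2_eq_2 One_nat_def, elim meta_mp)
  fix E' assume E': "E \<subseteq> E'" "is_clause E'" "B \<subseteq> lit_var ` E'"
  have nt: "\<not> tautological E'" using E' by (simp add: is_clause_def)
  then have "\<not> sat (falsifier E') \<Delta>" using sem falsifier[OF nt] E'(1) by blast
  then obtain D where D: "D \<in> \<Delta>" "\<forall>l\<in>D. \<not> holds (falsifier E') l" unfolding sat_def by blast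
  have "D \<subseteq> E'"
  proof
    fix l assume l: "l \<in> D"
    then have "lit_var l \<in> lit_var ` E'" using assms(3) D(1) E'(3) by (auto simp: vars_def)
    then obtain l' where l': "l' \<in> E'" "lit_var l' = lit_var l" by auto
    then have "l' = l \<or> l' = negate l" by (simp add: lit_var_eq_iff)
    then show "l \<in> E'" using l' D(2) l falsifier[OF nt l'(1)] by auto
  qed
  then show "der \<Gamma> (Suc 0) {E'}" using der_weaken[of E' D \<Gamma>] E' D assms(1) by auto
qed

lemma der_sem:
  assumes "\<Delta> \<subseteq> \<Gamma>" "finite B" "vars \<Delta> \<subseteq> B" "is_clause E" "card B \<le> b"
    and sem: "\<And>\<tau>. sat \<tau> \<Delta> \<Longrightarrow> \<exists>l\<in>E. holds \<tau> l"
  shows "der \<Gamma> (2 ^ b * 2) {E}"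
  by (rule der_mono[OF der_sem_finer[OF assms(1-4) sem]]) (use assms(5) in auto)

text \<open>One literal of \<open>S'\<close> is removed at a time: its side clause is weakened to
  carry the remaining literals and then resolved away, two steps per literal.\<close>

lemma der_hyper_aux:
  assumes "finite S'" "is_clause (B \<union> S')" "S' \<inter> B = {}"
    "\<forall>s\<in>S'. \<exists>D\<in>\<Gamma>. D \<subseteq> insert (negate s) B"
    "B \<union> S' \<in> \<Gamma>"
  shows "der \<Gamma> (2 * card S') {B}"
  using assms
proof (induction S' arbitrary: \<Gamma> rule: finite_induct)
  case empty
  then show ?case by (auto intro: der_refl)
next
  case (insert s S)
  have cl: "is_clause (B \<union> S)" "negate s \<notin> B \<union> S"
    using insert.prems(1) by (auto simp: is_clause_insert)
  have s: "s \<notin> B" "s \<notin> S" using insert by auto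
  obtain D where D: "D \<in> \<Gamma>" "D \<subseteq> insert (negate s) B" using insert.prems by auto
  have c2: "is_clause (insert (negate s) (B \<union> S))"
    using s cl by (simp add: is_clause_insert)
  have "der \<Gamma> 1 {insert (negate s) (B \<union> S)}"
    by (rule der_weaken[OF c2 D(1)]) (use D in auto)
  then have 1: "der \<Gamma> 2 {B \<union> S}"
    by (rule der_trans'[OF _ der_resolve[of _ s]]) (use insert.prems s cl in auto)
  have "der (\<Gamma> \<union> {B \<union> S}) (2 * card S) {B}"
    by (rule insert.IH) (use insert.prems cl in auto)
  then show ?case by (rule der_trans'[OF 1]) (use insert in simp)
qed

lemma is_clause_Un:
  "is_clause (A \<union> B) \<longleftrightarrow> is_clause A \<and> is_clause B \<and> (\<forall>l\<in>A. negate l \<notin> B)"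
proof -
  have "negate l \<in> A" if "negate l \<in> B" "l \<in> A" "\<forall>l\<in>A. negate l \<notin> B" for l using that by blast
  moreover have "tautological (A \<union> B) \<longleftrightarrow> tautological A \<or> tautological B \<or> (\<exists>l\<in>A. negate l \<in> B)"
    unfolding tautological_def by (metis Un_iff negate_negate)
  ultimately show ?thesis by (auto simp: is_clause_def)
qed

text \<open>Hyperresolution. It serves for the rows of the pigeonhole principle, which have too many
  variables for brute force; the cost is linear in the width of \<open>S\<close>. The extra step
  adds \<open>B\<close> to \<open>S\<close>.\<close>

lemma der_hyper:
  assumes "is_clause S" "is_clause B" "S \<in> \<Gamma>" "card S \<le> n"
    and D: "\<And>s. s \<in> S \<Longrightarrow> s \<in> B \<or> (\<exists>D\<in>\<Gamma>. D \<subseteq> insert (negate s) B)"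
  shows "der \<Gamma> (2 * n + 1) {B}"
proof (cases "\<exists>s\<in>S. negate s \<in> B")
  \<comment> \<open>\<open>B \<union> S\<close> is tautological here, but then a side clause already
    lies inside \<open>B\<close>.\<close>
  case True
  then obtain s where s: "s \<in> S" "negate s \<in> B" by blast
  have "s \<notin> B" using s assms(2) by (auto simp: is_clause_def tautological_def)
  then obtain D where "D \<in> \<Gamma>" "D \<subseteq> B" using D[OF s(1)] s(2) by (auto simp: insert_absorb)
  then show ?thesis using assms(2) by (intro der_mono[OF der_weaken[of B D]]) auto
next
  case False
  then have c: "is_clause (B \<union> S)" using assms by (auto simp: is_clause_Un)
  have eq: "B \<union> (S - B) = B \<union> S" by auto
  have 1: "der \<Gamma> 1 {B \<union> S}" by (rule der_weaken[OF c assms(3)]) auto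
  have fin: "finite S" using assms(1) by (simp add: is_clause_def)
  have "der (\<Gamma> \<union> {B \<union> S}) (2 * card (S - B)) {B}"
    by (rule der_hyper_aux) (use c D fin eq in \<open>auto dest!: D\<close>)
  moreover have "card (S - B) \<le> n" using card_mono[OF fin, of "S - B"] assms(4) by auto
  ultimately show ?thesis by (intro der_trans'[OF 1]) auto
qed

section \<open>Polynomial-size ER proofs of the bit pigeonhole principle\<close>

lemma ext_union_append [simp]: "ext_union (es @ fs) = ext_union es \<union> ext_union fs"
  by (auto simp: ext_union_def)

lemma ext_union_Nil [simp]: "ext_union [] = {}"
  by (simp add: ext_union_def)

lemma ext_union_Cons [simp]: "ext_union (e # es) = ext_clauses e \<union> ext_union es"
  by (simp add: ext_union_def)

lemma is_ext_for_antimono: "\<Gamma> \<subseteq> \<Gamma>' \<Longrightarrow> is_ext_for \<Gamma>' e \<Longrightarrow> is_ext_for \<Gamma> e"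
  by (cases e) (auto dest!: vars_mono)

lemma ext_sequence_Nil [simp]: "ext_sequence \<Gamma> []"
  by (simp add: ext_sequence_def)

lemma ext_sequence_Cons [simp]:
  "ext_sequence \<Gamma> (e # es) \<longleftrightarrow> is_ext_for \<Gamma> e \<and> ext_sequence (\<Gamma> \<union> ext_clauses e) es"
  unfolding ext_sequence_def by (simp add: All_less_Suc2 Un_assoc)

lemma ext_sequence_append [simp]:
  "ext_sequence \<Gamma> (es @ fs) \<longleftrightarrow> ext_sequence \<Gamma> es \<and> ext_sequence (\<Gamma> \<union> ext_union es) fs"
  by (induction es arbitrary: \<Gamma>) (auto simp: Un_assoc)

text \<open>Later extensions are chosen fresh for a formula that also contains derived clauses. This
  carries them back to the original formula.\<close>

lemma ext_sequence_antimono: "\<Gamma> \<subseteq> \<Gamma>' \<Longrightarrow> ext_sequence \<Gamma>' es \<Longrightarrow> ext_sequence \<Gamma> es"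
  unfolding ext_sequence_def by (blast intro: is_ext_for_antimono[rotated] Un_mono)

lemma finite_vars_ext_clauses [simp]: "finite (vars (ext_clauses e))"
  by (cases e) simp

lemma finite_vars_ext_union [simp]: "finite (vars (ext_union es))"
  by (induction es) auto

lemma card_ext_clauses: "card (ext_clauses e) \<le> 3"
  by (cases e) (simp add: card_insert_if)

lemma card_ext_union: "card (ext_union es) \<le> 3 * length es"
proof (induction es)
  case (Cons e es)
  have "card (ext_union (e # es)) \<le> card (ext_clauses e) + card (ext_union es)"
    by (simp add: card_Un_le)
  with Cons card_ext_clauses[of e] show ?case by simp
qed simp

lemma sat_ext_clauses [simp]:
  "sat \<tau> (ext_clauses (x, p, q)) \<longleftrightarrow> (\<tau> x \<longleftrightarrow> holds \<tau> p \<and> holds \<tau> q)"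
  by (auto simp: sat_def)

lemma negate_eq_iff [simp]:
  "negate l = Pos x \<longleftrightarrow> l = Neg x" "negate l = Neg x \<longleftrightarrow> l = Pos x"
  "Pos x = negate l \<longleftrightarrow> l = Neg x" "Neg x = negate l \<longleftrightarrow> l = Pos x"
  by (cases l; auto)+

section \<open>Naming Boolean functions by extension literals\<close>

lemma fresh_ext:
  fixes \<Delta> :: "nat literal set set"
  assumes "finite (vars \<Delta>)" "p \<noteq> negate q"
  obtains x where "x \<notin> vars \<Delta>" "is_ext_for \<Delta> (x, p, q)"
proof -
  obtain x where x: "x \<notin> vars \<Delta> \<union> {lit_var p, lit_var q}"
    using assms(1) ex_new_if_finite[OF infinite_UNIV_nat, of "vars \<Delta> \<union> {lit_var p, lit_var q}"] by auto
  have "q \<noteq> negate p" using assms(2) by auto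
  then have "is_formula (ext_clauses (x, p, q))"
    using x assms(2) by (auto simp: is_formula_def is_clause_insert)
  then show ?thesis using x that by auto
qed


text \<open>The bound on the variables of \<open>G\<close> is what makes facts about
  \<open>v\<close> cheap: they follow by brute force over these few variables.\<close>

definition expresses ::
    "nat literal set set \<Rightarrow> nat literal \<Rightarrow> ((nat \<Rightarrow> bool) \<Rightarrow> bool) \<Rightarrow> nat \<Rightarrow> bool" where
  "expresses G v \<phi> c \<longleftrightarrow> finite (vars G) \<and> card (vars G) \<le> c \<and>
     (\<forall>\<tau>. sat \<tau> G \<longrightarrow> (holds \<tau> v \<longleftrightarrow> \<phi> \<tau>))"

text \<open>The literals are conjoined one by one from the end of the list. Freshness of
  \<open>v\<close> is part of the claim because the induction needs it: it ensures that the next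
  literal is not the negation of \<open>Pos v\<close>.\<close>

lemma conj_expressible:
  fixes \<Delta> :: "nat literal set set"
  assumes "ls \<noteq> []" "finite (vars \<Delta>)" "lit_var ` set ls \<subseteq> vars \<Delta>"
    and "\<And>p q. p \<in> set ls \<Longrightarrow> q \<in> set ls \<Longrightarrow> p \<noteq> negate q"
  shows "\<exists>es v. ext_sequence \<Delta> es \<and> length es \<le> length ls \<and> v \<notin> vars \<Delta> \<and>
    expresses (ext_union es) (Pos v) (\<lambda>\<tau>. \<forall>p\<in>set ls. holds \<tau> p) (3 * length ls)"
  using assms(1,3,4)
proof (induction ls rule: list_nonempty_induct)
  case (single p)
  \<comment> \<open>A single literal is named as its conjunction with itself, so that the resulting
    \<open>v\<close> is a new variable in this case too.\<close>
  then obtain x where x: "x \<notin> vars \<Delta>" "is_ext_for \<Delta> (x, p, p)"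
    using fresh_ext[OF assms(2), of p p] by auto
  moreover have "vars (ext_clauses (x, p, p)) = {x, lit_var p}" by auto
  ultimately show ?case
    by (intro exI[of _ "[(x, p, p)]"] exI[of _ x])
      (auto simp: expresses_def card_insert_if simp del: ext_clauses.simps is_ext_for.simps)
next
  case (cons p ls)
  then obtain es v where es: "ext_sequence \<Delta> es" "length es \<le> length ls" "v \<notin> vars \<Delta>"
    "expresses (ext_union es) (Pos v) (\<lambda>\<tau>. \<forall>p\<in>set ls. holds \<tau> p) (3 * length ls)"
    by auto
  have "p \<noteq> negate (Pos v)" using es(3) cons.prems(1) by auto
  then obtain x where x: "x \<notin> vars (\<Delta> \<union> ext_union es)" "is_ext_for (\<Delta> \<union> ext_union es) (x, p, Pos v)"
    using fresh_ext[of "\<Delta> \<union> ext_union es" p "Pos v"] assms(2) by auto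
  let ?es = "es @ [(x, p, Pos v)]"
  have vars: "vars (ext_union ?es) = {x, lit_var p, v} \<union> vars (ext_union es)" by auto
  have "card (vars (ext_union ?es)) \<le> card {x, lit_var p, v} + card (vars (ext_union es))"
    unfolding vars by (rule card_Un_le)
  also have "\<dots> \<le> 3 * length (p # ls)"
    using es(4) by (auto simp: expresses_def card_insert_if)
  finally have "expresses (ext_union ?es) (Pos x) (\<lambda>\<tau>. \<forall>p\<in>set (p # ls). holds \<tau> p) (3 * length (p # ls))"
    using es(4) by (auto simp: expresses_def simp del: ext_clauses.simps)
  moreover have "ext_sequence \<Delta> ?es" using es(1) x(2) by (simp del: is_ext_for.simps)
  ultimately show ?case using es(2) x(1) by (intro exI[of _ ?es] exI[of _ x]) auto
qed

text \<open>The extensions of the members are concatenated, so each has to be available over every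
  enlargement of \<open>\<Gamma>\<close>. Keeping a separate \<open>G\<close> per member prevents
  the number of relevant variables from growing with \<open>I\<close>.\<close>

lemma ext_family:
  fixes \<Gamma> :: "nat literal set set"
  assumes "finite I" "finite (vars \<Gamma>)"
    and "\<And>i \<Delta>. i \<in> I \<Longrightarrow> \<Gamma> \<subseteq> \<Delta> \<Longrightarrow> finite (vars \<Delta>) \<Longrightarrow>
      \<exists>es v. ext_sequence \<Delta> es \<and> length es \<le> c \<and> \<Phi> i (ext_union es) v"
  shows "\<exists>es V. ext_sequence \<Gamma> es \<and> length es \<le> card I * c \<and>
    (\<forall>i\<in>I. \<exists>G\<subseteq>ext_union es. \<Phi> i G (V i))"
  using assms(1,3)
proof (induction I rule: finite_induct)
  case empty
  show ?case by (rule exI[of _ "[]"]) simp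
next
  case (insert i I)
  obtain es V where es: "ext_sequence \<Gamma> es" "length es \<le> card I * c"
    "\<forall>i\<in>I. \<exists>G\<subseteq>ext_union es. \<Phi> i G (V i)"
    using insert.IH[OF insert.prems] by auto
  obtain fs v where fs: "ext_sequence (\<Gamma> \<union> ext_union es) fs" "length fs \<le> c" "\<Phi> i (ext_union fs) v"
    using insert.prems[of i "\<Gamma> \<union> ext_union es"] assms(2) by auto
  have "\<forall>i'\<in>insert i I. \<exists>G\<subseteq>ext_union (es @ fs). \<Phi> i' G ((V(i := v)) i')"
  proof
    fix i' assume "i' \<in> insert i I"
    then consider "i' = i" | "i' \<in> I" "i' \<noteq> i" by auto
    then show "\<exists>G\<subseteq>ext_union (es @ fs). \<Phi> i' G ((V(i := v)) i')"
    proof cases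
      case 1
      then show ?thesis using fs(3) by (intro exI[of _ "ext_union fs"]) auto
    next
      case 2
      then obtain G where "G \<subseteq> ext_union es" "\<Phi> i' G (V i')" using es(3) by blast
      then show ?thesis using 2 by (intro exI[of _ G]) auto
    qed
  qed
  moreover have "ext_sequence \<Gamma> (es @ fs)" using es(1) fs(1) by simp
  moreover have "length (es @ fs) \<le> card (insert i I) * c" using es(2) fs(2) insert.hyps by simp
  ultimately show ?case by (intro exI[of _ "es @ fs"] exI[of _ "V(i := v)"] conjI)
qed

text \<open>In \<open>php P m\<close> the pigeons are \<open>0, \<dots>, m\<close>, the holes are \<open>0, \<dots>, m - 1\<close>, and the
  literal \<open>P i j\<close> says that pigeon \<open>i\<close> sits in hole \<open>j\<close>.\<close>

definition php :: "(nat \<Rightarrow> nat \<Rightarrow> nat literal) \<Rightarrow> nat \<Rightarrow> nat literal set set" where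
  "php P m = {P i ` {..<m} | i. i \<le> m} \<union>
     {{negate (P i j), negate (P i' j)} | i i' j. i \<le> m \<and> i' \<le> m \<and> i \<noteq> i' \<and> j < m}"

text \<open>Keeps rows and pair clauses nontautological. Literals instead of variables are needed
  since Cook's reduction names a disjunction, which is the negation of an extension variable, while
  the initial \<open>P\<close> is positive.\<close>

definition nonclashing :: "(nat \<Rightarrow> nat \<Rightarrow> nat literal) \<Rightarrow> nat \<Rightarrow> bool" where
  "nonclashing P m \<longleftrightarrow> (\<forall>i i' j j'. i \<le> m \<longrightarrow> i' \<le> m \<longrightarrow> j < m \<longrightarrow> j' < m \<longrightarrow> P i j \<noteq> negate (P i' j'))"

lemma is_clause_row: "nonclashing P m \<Longrightarrow> i \<le> m \<Longrightarrow> is_clause (P i ` {..<m})"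
  unfolding nonclashing_def is_clause_def tautological_def by (auto; metis)

text \<open>Cook's reduction: removing pigeon \<open>Suc m\<close> and hole \<open>m\<close>, a pigeon \<open>i\<close> that sat in
  hole \<open>m\<close> moves to the hole of pigeon \<open>Suc m\<close>.\<close>

lemma cook_expressible:
  assumes "finite (vars \<Delta>)" "{lit_var (P i j), lit_var (P i m), lit_var (P (Suc m) j)} \<subseteq> vars \<Delta>"
    and "P i m \<noteq> negate (P (Suc m) j)"
  shows "\<exists>es v. ext_sequence \<Delta> es \<and> length es \<le> 2 \<and> (\<exists>x. v = Neg x \<and> x \<notin> vars \<Delta>) \<and>
    expresses (ext_union es) v (\<lambda>\<tau>. holds \<tau> (P i j) \<or> holds \<tau> (P i m) \<and> holds \<tau> (P (Suc m) j)) 5"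
proof -
  obtain x where x: "x \<notin> vars \<Delta>" "is_ext_for \<Delta> (x, P i m, P (Suc m) j)"
    using fresh_ext[OF assms(1,3)] by auto
  let ?e = "(x, P i m, P (Suc m) j)"
  have "negate (P i j) \<noteq> negate (Neg x)" using x(1) assms(2) by auto
  moreover have "finite (vars (\<Delta> \<union> ext_clauses ?e))" using assms(1) by simp
  ultimately obtain x' where x': "x' \<notin> vars (\<Delta> \<union> ext_clauses ?e)"
    "is_ext_for (\<Delta> \<union> ext_clauses ?e) (x', negate (P i j), Neg x)"
    using fresh_ext by blast
  \<comment> \<open>\<open>x'\<close> stands for the conjunction of the negated disjuncts, so the
    disjunction itself is \<open>Neg x'\<close>.\<close>
  let ?e' = "(x', negate (P i j), Neg x)"
  have "vars (ext_union [?e, ?e']) = {x, x', lit_var (P i j), lit_var (P i m), lit_var (P (Suc m) j)}"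
    by auto
  then have "card (vars (ext_union [?e, ?e'])) \<le> 5" by (simp add: card_insert_if)
  then have "expresses (ext_union [?e, ?e']) (Neg x')
      (\<lambda>\<tau>. holds \<tau> (P i j) \<or> holds \<tau> (P i m) \<and> holds \<tau> (P (Suc m) j)) 5"
    unfolding expresses_def using finite_vars_ext_union[of "[?e, ?e']"]
    by (auto simp del: ext_clauses.simps)
  then show ?thesis using x x'
    by (intro exI[of _ "[?e, ?e']"] exI[of _ "Neg x'"]) (auto simp del: ext_clauses.simps is_ext_for.simps)
qed

text \<open>The short clauses about the new literals follow by brute force over at most 15
  variables. A row is wide; it is derived by two hyperresolutions, according to whether pigeon
  \<open>i\<close> sits in the removed hole \<open>m\<close>.\<close>

lemma cook_step:
  assumes fin: "finite (vars \<Gamma>)" and php: "php P (Suc m) \<subseteq> \<Gamma>" and nc: "nonclashing P (Suc m)"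
  shows "\<exists>es Q. ext_sequence \<Gamma> es \<and> length es \<le> 2 * Suc m ^ 2 \<and> nonclashing Q m \<and>
    der (\<Gamma> \<union> ext_union es) (2 ^ 18 * Suc m ^ 3) (php Q m)"
proof -
  have lv: "lit_var (P i j) \<in> vars \<Gamma>" if "i \<le> Suc m" "j < Suc m" for i j
  proof -
    have "P i ` {..<Suc m} \<in> \<Gamma>" using php that(1) by (auto simp: php_def)
    then show ?thesis by (rule vars_memberI) (use that(2) in auto)
  qed
  have ncP: "P i j \<noteq> negate (P i' j')" if "i \<le> Suc m" "i' \<le> Suc m" "j < Suc m" "j' < Suc m" for i j i' j'
    using nc that unfolding nonclashing_def by blast
  define \<phi> where "\<phi> = (\<lambda>(i, j) \<tau>. holds \<tau> (P i j) \<or> holds \<tau> (P i m) \<and> holds \<tau> (P (Suc m) j))"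
  define I where "I = {..m} \<times> {..<m}"
  have cardI: "finite I" "card I = Suc m * m" by (auto simp: I_def)
  have "\<exists>es V. ext_sequence \<Gamma> es \<and> length es \<le> card I * 2 \<and>
    (\<forall>i\<in>I. \<exists>G\<subseteq>ext_union es. (\<exists>x. V i = Neg x \<and> x \<notin> vars \<Gamma>) \<and> expresses G (V i) (\<phi> i) 5)"
  proof (rule ext_family[OF cardI(1) fin])
    fix i \<Delta> assume i: "i \<in> I" and \<Delta>: "\<Gamma> \<subseteq> \<Delta>" "finite (vars \<Delta>)"
    obtain a b where ab: "i = (a, b)" "a \<le> m" "b < m" using i by (auto simp: I_def)
    have "\<exists>es v. ext_sequence \<Delta> es \<and> length es \<le> 2 \<and> (\<exists>x. v = Neg x \<and> x \<notin> vars \<Delta>) \<and>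
      expresses (ext_union es) v (\<phi> i) 5"
      unfolding \<phi>_def ab(1) prod.case
      using lv[of a b] lv[of a m] lv[of "Suc m" b] vars_mono[OF \<Delta>(1)] ncP[of a "Suc m" m b] ab
      by (intro cook_expressible[OF \<Delta>(2)]) auto
    then show "\<exists>es v. ext_sequence \<Delta> es \<and> length es \<le> 2 \<and> (\<exists>x. v = Neg x \<and> x \<notin> vars \<Gamma>) \<and>
      expresses (ext_union es) v (\<phi> i) 5" using vars_mono[OF \<Delta>(1)] by blast
  qed
  then obtain es V where es: "ext_sequence \<Gamma> es" "length es \<le> card I * 2"
    and V: "\<And>i. i \<in> I \<Longrightarrow> \<exists>G\<subseteq>ext_union es. (\<exists>x. V i = Neg x \<and> x \<notin> vars \<Gamma>) \<and> expresses G (V i) (\<phi> i) 5"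
    by blast
  define Q where "Q = (\<lambda>i j. V (i, j))"
  define \<Gamma>' where "\<Gamma>' = \<Gamma> \<union> ext_union es"
  have Q: "\<exists>G. G \<subseteq> \<Gamma>' \<and> finite (vars G) \<and> card (vars G) \<le> 5 \<and>
    (\<forall>\<tau>. sat \<tau> G \<longrightarrow> holds \<tau> (Q i j) = (holds \<tau> (P i j) \<or> holds \<tau> (P i m) \<and> holds \<tau> (P (Suc m) j)))"
    if "i \<le> m" "j < m" for i j
  proof -
    have "(i, j) \<in> I" using that by (simp add: I_def)
    from V[OF this] obtain G where "G \<subseteq> ext_union es" "expresses G (V (i, j)) (\<phi> (i, j)) 5" by meson
    then show ?thesis unfolding expresses_def \<Gamma>'_def Q_def \<phi>_def by (intro exI[of _ G]) auto
  qed
  have Qneg: "\<exists>x. Q i j = Neg x \<and> x \<notin> vars \<Gamma>" if "i \<le> m" "j < m" for i j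
  proof -
    have "(i, j) \<in> I" using that by (simp add: I_def)
    from V[OF this] show ?thesis unfolding Q_def by meson
  qed
  have ncQ: "nonclashing Q m"
    unfolding nonclashing_def
  proof (intro allI impI)
    fix i i' j j' assume "i \<le> m" "i' \<le> m" "j < m" "j' < m"
    then obtain x x' where "Q i j = Neg x" "Q i' j' = Neg x'" using Qneg by meson
    then show "Q i j \<noteq> negate (Q i' j')" by simp
  qed
  have PQ: "lit_var (Q i j) \<noteq> lit_var (P i' j')" if "i \<le> m" "j < m" "i' \<le> Suc m" "j' < Suc m" for i j i' j'
    using Qneg[OF that(1,2)] lv[OF that(3,4)] by auto
  have PQ': "P i' j' \<noteq> Q i j" "P i' j' \<noteq> negate (Q i j)" "Q i j \<noteq> P i' j'" "negate (Q i j) \<noteq> P i' j'" 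
    "Q i j \<noteq> negate (P i' j')" "negate (P i' j') \<noteq> Q i j"
    if "i \<le> m" "j < m" "i' \<le> Suc m" "j' < Suc m" for i j i' j'
    using PQ[OF that] by (metis lit_var_negate)+
  have hole: "{negate (P i j), negate (P i' j)} \<in> \<Gamma>'" if "i \<le> Suc m" "i' \<le> Suc m" "i \<noteq> i'" "j < Suc m" for i i' j
    using php that unfolding \<Gamma>'_def php_def by blast
  have row: "P i ` {..<Suc m} \<in> \<Gamma>'" if "i \<le> Suc m" for i
    using php that unfolding \<Gamma>'_def php_def by blast
  \<comment> \<open>Five variables suffice here; the exponent 15 is the one that
    \<open>pairs\<close> requires, used throughout.\<close>
  have move1: "der \<Gamma>' (2 ^ 15 * 2) {{negate (P i j), Q i j}}" if ij: "i \<le> m" "j < m" for i j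
  proof -
    obtain G where G: "G \<subseteq> \<Gamma>'" "finite (vars G)" "card (vars G) \<le> 5"
      "\<forall>\<tau>. sat \<tau> G \<longrightarrow> holds \<tau> (Q i j) = (holds \<tau> (P i j) \<or> holds \<tau> (P i m) \<and> holds \<tau> (P (Suc m) j))"
      using Q[OF ij] by blast
    show ?thesis
      by (rule der_sem[OF G(1,2) order_refl]) (use G PQ'[OF ij, of i j] ij in \<open>auto simp: is_clause_insert\<close>)
  qed
  have move2: "der \<Gamma>' (2 ^ 15 * 2) {{negate (P i m), negate (P (Suc m) j), Q i j}}" if ij: "i \<le> m" "j < m" for i j
  proof -
    obtain G where G: "G \<subseteq> \<Gamma>'" "finite (vars G)" "card (vars G) \<le> 5"
      "\<forall>\<tau>. sat \<tau> G \<longrightarrow> holds \<tau> (Q i j) = (holds \<tau> (P i j) \<or> holds \<tau> (P i m) \<and> holds \<tau> (P (Suc m) j))"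
      using Q[OF ij] by blast
    show ?thesis
      by (rule der_sem[OF G(1,2) order_refl])
        (use G PQ'[OF ij, of i m] PQ'[OF ij, of "Suc m" j] ij ncP[of i "Suc m" m j]
         in \<open>auto simp: is_clause_insert\<close>)
  qed
  have pairs: "der \<Gamma>' (2 ^ 15 * 2) {{negate (Q i j), negate (Q i' j)}}"
    if ij: "i \<le> m" "j < m" "i' \<le> m" "i \<noteq> i'" for i j i'
  proof -
    obtain G where G: "G \<subseteq> \<Gamma>'" "finite (vars G)" "card (vars G) \<le> 5"
      "\<forall>\<tau>. sat \<tau> G \<longrightarrow> holds \<tau> (Q i j) = (holds \<tau> (P i j) \<or> holds \<tau> (P i m) \<and> holds \<tau> (P (Suc m) j))"
      using Q[OF ij(1,2)] by blast
    obtain G' where G': "G' \<subseteq> \<Gamma>'" "finite (vars G')" "card (vars G') \<le> 5"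
      "\<forall>\<tau>. sat \<tau> G' \<longrightarrow> holds \<tau> (Q i' j) = (holds \<tau> (P i' j) \<or> holds \<tau> (P i' m) \<and> holds \<tau> (P (Suc m) j))"
      using Q[OF ij(3,2)] by blast
    \<comment> \<open>Each of \<open>i\<close> and \<open>i'\<close> reaches hole \<open>j\<close>
      either directly or by moving out of hole \<open>m\<close>. Each of the four combinations
      violates one of these clauses.\<close>
    let ?H = "{{negate (P i j), negate (P i' j)}, {negate (P i m), negate (P i' m)},
      {negate (P i j), negate (P (Suc m) j)}, {negate (P i' j), negate (P (Suc m) j)}}"
    let ?v = "{lit_var (P i j), lit_var (P i' j), lit_var (P i m), lit_var (P i' m), lit_var (P (Suc m) j)}"
    show ?thesis
    proof (rule der_sem)
      show "G \<union> G' \<union> ?H \<subseteq> \<Gamma>'" using G(1) G'(1) hole ij by auto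
      show "finite (vars G \<union> vars G' \<union> ?v)" using G(2) G'(2) by simp
      show "vars (G \<union> G' \<union> ?H) \<subseteq> vars G \<union> vars G' \<union> ?v" by auto
      have "card ?v \<le> 5" by (simp add: card_insert_if)
      then show "card (vars G \<union> vars G' \<union> ?v) \<le> 15"
        using G(3) G'(3) card_Un_le[of "vars G" "vars G'"] card_Un_le[of "vars G \<union> vars G'" ?v] by linarith
      show "is_clause {negate (Q i j), negate (Q i' j)}"
        using ncQ ij by (auto simp: is_clause_insert nonclashing_def)
      fix \<tau> assume "sat \<tau> (G \<union> G' \<union> ?H)"
      then show "\<exists>l\<in>{negate (Q i j), negate (Q i' j)}. holds \<tau> l"
        using G(4) G'(4) by auto
    qed
  qed
  define X where "X = (\<Union>(i, j)\<in>I. {{negate (P i j), Q i j}} \<union> {{negate (P i m), negate (P (Suc m) j), Q i j}})"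
  have X: "der \<Gamma>' (card I * (2 ^ 15 * 2 + 2 ^ 15 * 2)) X"
    unfolding X_def
  proof (rule der_UN[OF cardI(1)])
    fix i assume "i \<in> I"
    then obtain a b where "i = (a, b)" "a \<le> m" "b < m" by (auto simp: I_def)
    then show "der \<Gamma>' (2 ^ 15 * 2 + 2 ^ 15 * 2)
        (case i of (i, j) \<Rightarrow> {{negate (P i j), Q i j}} \<union> {{negate (P i m), negate (P (Suc m) j), Q i j}})"
      unfolding \<open>i = (a, b)\<close> prod.case by (intro der_Un move1 move2)
  qed
  have rows: "der (\<Gamma>' \<union> X) (4 * m + 7) {Q i ` {..<m}}" if i: "i \<le> m" for i
  proof -
    let ?B = "Q i ` {..<m}"
    have cB: "is_clause ?B" by (rule is_clause_row[OF ncQ i])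
    have "lit_var (P i m) \<notin> lit_var ` ?B" using PQ[of i _ i m] i by fastforce
    then have nP: "P i m \<notin> ?B" "negate (P i m) \<notin> ?B" by (metis imageI lit_var_negate)+
    have c1: "is_clause (insert (P i m) ?B)" "is_clause (insert (negate (P i m)) ?B)"
      using cB nP by (auto simp: is_clause_insert)
    have m1: "{negate (P i j), Q i j} \<in> X" "{negate (P i m), negate (P (Suc m) j), Q i j} \<in> X" if "j < m" for j
      using i that unfolding X_def I_def by auto
    \<comment> \<open>Pigeon \<open>i\<close> not in hole \<open>m\<close>: its own row is
      translated hole by hole.\<close>
    have "der (\<Gamma>' \<union> X) (2 * Suc m + 1) {insert (P i m) ?B}"
    proof (rule der_hyper[OF is_clause_row[OF nc] c1(1)])
      fix s assume "s \<in> P i ` {..<Suc m}"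
      then obtain j where j: "s = P i j" "j < Suc m" by auto
      show "s \<in> insert (P i m) ?B \<or> (\<exists>D\<in>\<Gamma>' \<union> X. D \<subseteq> insert (negate s) (insert (P i m) ?B))"
      proof (cases "j = m")
        case False
        then have "j < m" using j by simp
        then show ?thesis unfolding j(1) by (intro disjI2 bexI[OF _ UnI2[OF m1(1)]]) auto
      qed (use j in auto)
    qed (use i row[of i] card_image_le[of "{..<Suc m}" "P i"] in auto)
    \<comment> \<open>Pigeon \<open>i\<close> in hole \<open>m\<close>: then pigeon
      \<open>Suc m\<close> is elsewhere, and the row of \<open>Suc m\<close> is translated.\<close>
    moreover have "der (\<Gamma>' \<union> X) (2 * Suc m + 1) {insert (negate (P i m)) ?B}"
    proof (rule der_hyper[OF is_clause_row[OF nc, of "Suc m"] c1(2)])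
      fix s assume "s \<in> P (Suc m) ` {..<Suc m}"
      then obtain j where j: "s = P (Suc m) j" "j < Suc m" by auto
      show "s \<in> insert (negate (P i m)) ?B \<or> (\<exists>D\<in>\<Gamma>' \<union> X. D \<subseteq> insert (negate s) (insert (negate (P i m)) ?B))"
      proof (cases "j = m")
        case True
        have "{negate (P i m), negate (P (Suc m) m)} \<in> \<Gamma>'" using hole[of i "Suc m" m] i by simp
        then show ?thesis using True unfolding j(1) by (intro disjI2 bexI[OF _ UnI1]) auto
      next
        case False
        then have "j < m" using j by simp
        then show ?thesis unfolding j(1) by (intro disjI2 bexI[OF _ UnI2[OF m1(2)]]) auto
      qed
    qed (use row[of "Suc m"] card_image_le[of "{..<Suc m}" "P (Suc m)"] in auto)
    ultimately have "der (\<Gamma>' \<union> X) ((2 * Suc m + 1) + (2 * Suc m + 1)) ({insert (P i m) ?B} \<union> {insert (negate (P i m)) ?B})"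
      by (rule der_Un)
    then show ?thesis
      by (rule der_trans'[OF _ der_resolve[of _ "P i m"]]) (use cB nP in auto)
  qed
  define J where "J = {..m} \<times> {..m} \<times> {..<m}"
  define Y where "Y = (\<Union>(i, i', j)\<in>J. if i = i' then {} else {{negate (Q i j), negate (Q i' j)}})"
  have J: "finite J" "card J = Suc m * (Suc m * m)" by (auto simp: J_def card_cartesian_product)
  have "der \<Gamma>' (card J * (2 ^ 15 * 2)) Y"
    unfolding Y_def by (rule der_UN[OF J(1)]) (use pairs in \<open>auto simp: J_def der_refl\<close>)
  moreover have "der (\<Gamma>' \<union> X) (card {..m} * (4 * m + 7)) (\<Union>i\<in>{..m}. {Q i ` {..<m}})"
    by (rule der_UN) (auto simp: rows)
  then have "der \<Gamma>' (card I * (2 ^ 15 * 2 + 2 ^ 15 * 2) + card {..m} * (4 * m + 7)) (\<Union>i\<in>{..m}. {Q i ` {..<m}})"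
    by (rule der_trans'[OF X]) simp
  ultimately have D: "der \<Gamma>' (card J * (2 ^ 15 * 2) + (card I * (2 ^ 15 * 2 + 2 ^ 15 * 2) + card {..m} * (4 * m + 7)))
      (Y \<union> (\<Union>i\<in>{..m}. {Q i ` {..<m}}))"
    by (rule der_Un)
  have "{negate (Q i j), negate (Q i' j)} \<in> Y" if "i \<le> m" "i' \<le> m" "i \<noteq> i'" "j < m" for i i' j
    using that unfolding Y_def J_def by (intro UN_I[of "(i, i', j)"]) auto
  then have "php Q m \<subseteq> Y \<union> (\<Union>i\<in>{..m}. {Q i ` {..<m}})"
    unfolding php_def by blast
  moreover have "card J * (2 ^ 15 * 2) + (card I * (2 ^ 15 * 2 + 2 ^ 15 * 2) + card {..m} * (4 * m + 7))
      \<le> 2 ^ 18 * Suc m ^ 3"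
  proof -
    have "card J \<le> Suc m ^ 3" "card I \<le> Suc m ^ 3" "card {..m} * m \<le> Suc m ^ 3" "card {..m} \<le> Suc m ^ 3"
      unfolding J cardI power3_eq_cube card_atMost mult.assoc
      using order_trans[OF le_SucI[OF order_refl] le_square[of "Suc m"]]
      by (auto intro!: mult_le_mono2 mult_le_mono simp del: mult_Suc mult_Suc_right)
    \<comment> \<open>The coefficients add up to \<open>2 ^ 16 + 2 ^ 17 + 11\<close>, which is below
      \<open>2 ^ 18\<close>.\<close>
    moreover have "a * (2 ^ 15 * 2) + (b * (2 ^ 15 * 2 + 2 ^ 15 * 2) + c * (4 * m + 7)) \<le> 2 ^ 18 * t"
      if "a \<le> t" "b \<le> t" "c * m \<le> t" "c \<le> t" for a b c t :: nat
      using that by (simp add: algebra_simps)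
    ultimately show ?thesis by blast
  qed
  ultimately have "der \<Gamma>' (2 ^ 18 * Suc m ^ 3) (php Q m)" by (intro der_mono[OF D]) auto
  moreover have "length es \<le> 2 * Suc m ^ 2"
    using es(2) unfolding cardI by (simp add: power2_eq_square)
  ultimately show ?thesis using es(1) ncQ unfolding \<Gamma>'_def by blast
qed


text \<open>\<open>M\<close> stays fixed while \<open>m\<close> decreases: every round is charged
  the cost of the largest one, so the totals are plain products.\<close>

lemma php_refutation:
  assumes "finite (vars \<Gamma>)" "php P m \<subseteq> \<Gamma>" "nonclashing P m" "m \<le> M"
  shows "\<exists>es. ext_sequence \<Gamma> es \<and> length es \<le> m * (2 * M ^ 2) \<and>
    der (\<Gamma> \<union> ext_union es) (m * (2 ^ 18 * M ^ 3)) {{}}"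
  using assms
proof (induction m arbitrary: \<Gamma> P)
  case 0
  \<comment> \<open>Pigeon 0 without any hole: its row is the empty clause.\<close>
  then have "{} \<in> \<Gamma>" by (auto simp: php_def)
  then show ?case by (intro exI[of _ "[]"]) (auto intro: der_refl)
next
  case (Suc m)
  obtain es Q where es: "ext_sequence \<Gamma> es" "length es \<le> 2 * Suc m ^ 2" "nonclashing Q m"
    "der (\<Gamma> \<union> ext_union es) (2 ^ 18 * Suc m ^ 3) (php Q m)"
    using cook_step[OF Suc.prems(1-3)] by blast
  have "finite (php Q m)"
    by (rule finite_subset[of _ "Pow (\<Union>i\<le>m. \<Union>j<m. {Q i j, negate (Q i j)})"]) (auto simp: php_def)
  then have "finite (vars (php Q m))" by (auto simp: vars_def php_def)
  then have fin: "finite (vars (\<Gamma> \<union> ext_union es \<union> php Q m))" using Suc.prems(1) by simp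
  obtain fs where fs: "ext_sequence (\<Gamma> \<union> ext_union es \<union> php Q m) fs" "length fs \<le> m * (2 * M ^ 2)"
    "der (\<Gamma> \<union> ext_union es \<union> php Q m \<union> ext_union fs) (m * (2 ^ 18 * M ^ 3)) {{}}"
    using Suc.IH[OF fin _ es(3)] Suc.prems(4) by auto
  have "ext_sequence \<Gamma> (es @ fs)"
    using es(1) ext_sequence_antimono[OF _ fs(1)] by auto
  moreover have pw: "2 * Suc m ^ 2 \<le> 2 * M ^ 2" "2 ^ 18 * Suc m ^ 3 \<le> 2 ^ 18 * M ^ 3"
    using Suc.prems(4) by (auto intro!: mult_le_mono2 power_mono simp del: power_Suc)
  have "length (es @ fs) \<le> Suc m * (2 * M ^ 2)"
    unfolding length_append mult_Suc using add_mono[OF order_trans[OF es(2) pw(1)] fs(2)] .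
  moreover have le: "2 ^ 18 * Suc m ^ 3 + m * (2 ^ 18 * M ^ 3) \<le> Suc m * (2 ^ 18 * M ^ 3)"
    unfolding mult_Suc using pw(2) by (rule add_right_mono)
  have "der (\<Gamma> \<union> ext_union (es @ fs)) (Suc m * (2 ^ 18 * M ^ 3)) {{}}"
  proof (rule der_trans'[OF _ _ le])
    show "der (\<Gamma> \<union> ext_union (es @ fs)) (2 ^ 18 * Suc m ^ 3) (php Q m)"
      by (rule der_mono[OF es(4)]) auto
    show "der (\<Gamma> \<union> ext_union (es @ fs) \<union> php Q m) (m * (2 ^ 18 * M ^ 3)) {{}}"
      by (rule der_mono[OF fs(3)]) auto
  qed
  ultimately show ?case by blast
qed

section \<open>From the bit encoding to the unary encoding\<close>

definition bphp_block :: "nat \<Rightarrow> nat \<Rightarrow> (nat \<Rightarrow> bool) \<Rightarrow> nat literal set" where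
  "bphp_block k x h = (\<lambda>l. bit_differs x l (h l)) ` {1..k}"

lemma bphp_pow_eq:
  "bphp_pow k = {bphp_block k x h \<union> bphp_block k y h | x y h.
     x \<in> {1..2 ^ k + 1} \<and> y \<in> {1..2 ^ k + 1} \<and> x \<noteq> y}"
  by (simp add: bphp_pow_def bphp_block_def)

lemma bphp_powI:
  "x \<in> {1..2 ^ k + 1} \<Longrightarrow> y \<in> {1..2 ^ k + 1} \<Longrightarrow> x \<noteq> y \<Longrightarrow> bphp_block k x h \<union> bphp_block k y h \<in> bphp_pow k"
  unfolding bphp_pow_eq by blast

lemma bphp_var_inject [simp]: "bphp_var x l = bphp_var y l' \<longleftrightarrow> x = y \<and> l = l'"
  by (simp add: bphp_var_def)

lemma holds_bit_differs [simp]: "holds \<tau> (bit_differs x l b) \<longleftrightarrow> \<tau> (bphp_var x l) \<noteq> b"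
  by (auto simp: bit_differs_def)

lemma lit_var_bit_differs [simp]: "lit_var (bit_differs x l b) = bphp_var x l"
  by (auto simp: bit_differs_def)

lemma bit_differs_inject [simp]:
  "bit_differs x l b = bit_differs y l' b' \<longleftrightarrow> x = y \<and> l = l' \<and> b = b'"
  by (auto simp: bit_differs_def)

lemma negate_bit_differs [simp]: "negate (bit_differs x l b) = bit_differs x l (\<not> b)"
  by (auto simp: bit_differs_def)

lemma lit_var_bphp_block: "lit_var ` bphp_block k x h = bphp_var x ` {1..k}"
  by (auto simp: bphp_block_def image_image)

lemma vars_bphp_pow:
  assumes "k \<ge> 1"
  shows "vars (bphp_pow k) = (\<Union>x\<in>{1..2 ^ k + 1}. bphp_var x ` {1..k})" (is "_ = ?V")
proof
  show "vars (bphp_pow k) \<subseteq> ?V"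
    by (auto simp: vars_def bphp_pow_eq bphp_block_def)
  show "?V \<subseteq> vars (bphp_pow k)"
  proof (intro UN_least image_subsetI)
    fix x l :: nat assume xl: "x \<in> {1..2 ^ k + 1}" "l \<in> {1..k}"
    define y :: nat where "y = (if x = 1 then 2 else 1)"
    have y: "y \<in> {1..2 ^ k + 1}" "x \<noteq> y" using assms by (auto simp: y_def)
    have "bit_differs x l False \<in> bphp_block k x (\<lambda>_. False) \<union> bphp_block k y (\<lambda>_. False)"
      using xl(2) by (auto simp: bphp_block_def)
    from vars_memberI[OF bphp_powI[OF xl(1) y] this] show "bphp_var x l \<in> vars (bphp_pow k)" by simp
  qed
qed

lemma bphp_var_mem:
  "k \<ge> 1 \<Longrightarrow> bphp_var x l \<in> vars (bphp_pow k) \<longleftrightarrow> x \<in> {1..2 ^ k + 1} \<and> l \<in> {1..k}"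
  unfolding vars_bphp_pow by (simp add: image_iff)

lemma is_formula_bphp_pow: "is_formula (bphp_pow k)"
proof -
  have "finite (bphp_pow k)"
  proof (rule finite_subset)
    show "bphp_pow k \<subseteq> Pow ((\<lambda>(x, l, b). bit_differs x l b) ` ({1..2 ^ k + 1} \<times> {1..k} \<times> UNIV))"
      unfolding bphp_pow_eq bphp_block_def by force
  qed simp
  moreover have "is_clause (bphp_block k x h \<union> bphp_block k y h)" if "x \<noteq> y" for x y h
    using that by (auto simp: is_clause_def tautological_def bphp_block_def)
  ultimately show ?thesis by (auto simp: is_formula_def bphp_pow_eq)
qed

text \<open>A unary literal depends on \<open>k\<close> bits only, so brute force over a constant
  multiple of \<open>k\<close> variables costs a power of \<open>2 ^ k\<close>. A pair clause
  involves two definitions of \<open>3 * k\<close> variables and \<open>2 * k\<close> bits. A row is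
  derived by querying the \<open>k\<close> bits of its pigeon.\<close>

lemma bphp_php:
  assumes k: "k \<ge> 1"
  shows "\<exists>es P. ext_sequence (bphp_pow k) es \<and> length es \<le> (2 ^ k + 1) * 2 ^ k * k \<and>
    nonclashing P (2 ^ k) \<and> der (bphp_pow k \<union> ext_union es)
      ((2 ^ k + 1) * ((2 ^ k + 1) * 2 ^ k) * (2 ^ (8 * k) * 2) + (2 ^ k + 1) * (2 ^ k * Suc (2 ^ (3 * k) * 2)))
      (php P (2 ^ k))"
proof -
  define \<Gamma> where "\<Gamma> = bphp_pow k"
  define n :: nat where "n = 2 ^ k"
  have "card (Pow {1..k}) = n" by (simp add: card_Pow n_def)
  then obtain g where g: "bij_betw g {0..<n} (Pow {1..k})"
    using ex_bij_betw_nat_finite[of "Pow {1..k}"] by auto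
  \<comment> \<open>Hole \<open>j\<close> is the set \<open>g j\<close> of its bits with value 1.
    Differing from the complementary bit means equality, and \<open>Suc\<close> renames the pigeons
    \<open>0, ..., n\<close> to \<open>1, ..., n + 1\<close>.\<close>
  define ls where "ls = (\<lambda>(i, j). map (\<lambda>l. bit_differs (Suc i) l (l \<notin> g j)) [1..<Suc k])"
  define I where "I = {..n} \<times> {..<n}"
  have cardI: "finite I" "card I = Suc n * n" by (auto simp: I_def)
  have fin: "finite (vars \<Gamma>)" unfolding \<Gamma>_def vars_bphp_pow[OF k] by simp
  have "\<exists>es V. ext_sequence \<Gamma> es \<and> length es \<le> card I * k \<and> (\<forall>i\<in>I. \<exists>G\<subseteq>ext_union es.
      (\<exists>v. V i = Pos v) \<and> expresses G (V i) (\<lambda>\<tau>. \<forall>p\<in>set (ls i). holds \<tau> p) (3 * k))"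
  proof (rule ext_family[OF cardI(1) fin])
    fix i \<Delta> assume i: "i \<in> I" and \<Delta>: "\<Gamma> \<subseteq> \<Delta>" "finite (vars \<Delta>)"
    have len: "length (ls i) = k" by (cases i) (simp add: ls_def)
    then have ne: "ls i \<noteq> []" using k by auto
    have "lit_var ` set (ls i) \<subseteq> vars \<Gamma>"
      using i by (auto simp: \<Gamma>_def bphp_var_mem[OF k] I_def ls_def n_def simp del: upt_Suc)
    then have lv: "lit_var ` set (ls i) \<subseteq> vars \<Delta>" using vars_mono[OF \<Delta>(1)] by auto
    have nc: "p \<noteq> negate q" if "p \<in> set (ls i)" "q \<in> set (ls i)" for p q
      using that by (cases i) (auto simp: ls_def)
    have "\<exists>es v. ext_sequence \<Delta> es \<and> length es \<le> length (ls i) \<and> v \<notin> vars \<Delta> \<and>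
        expresses (ext_union es) (Pos v) (\<lambda>\<tau>. \<forall>p\<in>set (ls i). holds \<tau> p) (3 * length (ls i))"
      using ne \<Delta>(2) lv nc by (rule conj_expressible)
    then obtain es v where "ext_sequence \<Delta> es" "length es \<le> k"
        "expresses (ext_union es) (Pos v) (\<lambda>\<tau>. \<forall>p\<in>set (ls i). holds \<tau> p) (3 * k)"
      unfolding len by (elim exE conjE) (rule that)
    then show "\<exists>es v. ext_sequence \<Delta> es \<and> length es \<le> k \<and> (\<exists>x. v = Pos x) \<and>
        expresses (ext_union es) v (\<lambda>\<tau>. \<forall>p\<in>set (ls i). holds \<tau> p) (3 * k)"
      by blast
  qed
  then obtain es V where es: "ext_sequence \<Gamma> es" "length es \<le> card I * k"
    and V: "\<And>i. i \<in> I \<Longrightarrow> \<exists>G\<subseteq>ext_union es.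
      (\<exists>v. V i = Pos v) \<and> expresses G (V i) (\<lambda>\<tau>. \<forall>p\<in>set (ls i). holds \<tau> p) (3 * k)"
    by meson
  define P where "P = (\<lambda>i j. V (i, j))"
  define \<Gamma>' where "\<Gamma>' = \<Gamma> \<union> ext_union es"
  have P: "\<exists>G. G \<subseteq> \<Gamma>' \<and> finite (vars G) \<and> card (vars G) \<le> 3 * k \<and>
    (\<forall>\<tau>. sat \<tau> G \<longrightarrow> holds \<tau> (P i j) = (\<forall>l\<in>{1..k}. \<tau> (bphp_var (Suc i) l) = (l \<in> g j)))"
    if "i \<le> n" "j < n" for i j
  proof -
    have "(i, j) \<in> I" using that by (simp add: I_def)
    from V[OF this] obtain G where "G \<subseteq> ext_union es"
      "expresses G (V (i, j)) (\<lambda>\<tau>. \<forall>p\<in>set (ls (i, j)). holds \<tau> p) (3 * k)" by meson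
    then show ?thesis unfolding expresses_def \<Gamma>'_def P_def ls_def
      by (intro exI[of _ G]) (auto simp: atLeastLessThanSuc_atLeastAtMost simp del: upt_Suc)
  qed
  have Ppos: "\<exists>v. P i j = Pos v" if "i \<le> n" "j < n" for i j
  proof -
    have "(i, j) \<in> I" using that by (simp add: I_def)
    from V[OF this] show ?thesis unfolding P_def by meson
  qed
  have ncP: "nonclashing P n"
    unfolding nonclashing_def
  proof (intro allI impI)
    fix i i' j j' assume "i \<le> n" "i' \<le> n" "j < n" "j' < n"
    then obtain x x' where "P i j = Pos x" "P i' j' = Pos x'" using Ppos by meson
    then show "P i j \<noteq> negate (P i' j')" by simp
  qed
  have pairs: "der \<Gamma>' (2 ^ (8 * k) * 2) {{negate (P i j), negate (P i' j)}}"
    if ij: "i \<le> n" "j < n" "i' \<le> n" "i \<noteq> i'" for i j i'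
  proof -
    obtain G where G: "G \<subseteq> \<Gamma>'" "finite (vars G)" "card (vars G) \<le> 3 * k"
      "\<forall>\<tau>. sat \<tau> G \<longrightarrow> holds \<tau> (P i j) = (\<forall>l\<in>{1..k}. \<tau> (bphp_var (Suc i) l) = (l \<in> g j))"
      using P[OF ij(1,2)] by (elim exE conjE) (rule that)
    obtain G' where G': "G' \<subseteq> \<Gamma>'" "finite (vars G')" "card (vars G') \<le> 3 * k"
      "\<forall>\<tau>. sat \<tau> G' \<longrightarrow> holds \<tau> (P i' j) = (\<forall>l\<in>{1..k}. \<tau> (bphp_var (Suc i') l) = (l \<in> g j))"
      using P[OF ij(3,2)] by (elim exE conjE) (rule that)
    let ?H = "{bphp_block k (Suc i) (\<lambda>l. l \<in> g j) \<union> bphp_block k (Suc i') (\<lambda>l. l \<in> g j)}"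
    let ?v = "bphp_var (Suc i) ` {1..k} \<union> bphp_var (Suc i') ` {1..k}"
    show ?thesis
    proof (rule der_sem)
      have "?H \<subseteq> \<Gamma>"
        using bphp_powI[of "Suc i" k "Suc i'"] ij by (auto simp: \<Gamma>_def n_def)
      then show "G \<union> G' \<union> ?H \<subseteq> \<Gamma>'" using G(1) G'(1) by (auto simp: \<Gamma>'_def)
      show "finite (vars G \<union> vars G' \<union> ?v)" using G(2) G'(2) by simp
      show "vars (G \<union> G' \<union> ?H) \<subseteq> vars G \<union> vars G' \<union> ?v" 
        by (auto simp: image_Un lit_var_bphp_block)
      have "card ?v \<le> k + k" 
        using card_Un_le[of "bphp_var (Suc i) ` {1..k}" "bphp_var (Suc i') ` {1..k}"]
          card_image_le[of "{1..k}" "bphp_var (Suc i)"] card_image_le[of "{1..k}" "bphp_var (Suc i')"] by simp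
      then show "card (vars G \<union> vars G' \<union> ?v) \<le> 8 * k"
        using G(3) G'(3) card_Un_le[of "vars G" "vars G'"] card_Un_le[of "vars G \<union> vars G'" ?v] by linarith
      show "is_clause {negate (P i j), negate (P i' j)}"
        using ncP ij by (auto simp: is_clause_insert nonclashing_def)
      fix \<tau> assume "sat \<tau> (G \<union> G' \<union> ?H)"
      then show "\<exists>l\<in>{negate (P i j), negate (P i' j)}. holds \<tau> l"
        using G(4) G'(4) by (auto simp: bphp_block_def)
    qed
  qed
  have rows: "der \<Gamma>' (2 ^ k * Suc (2 ^ (3 * k) * 2)) {P i ` {..<n}}" if i: "i \<le> n" for i
  proof -
    have "card (bphp_var (Suc i) ` {1..k}) = k" by (simp add: card_image inj_on_def)
    moreover have "der \<Gamma>' (2 ^ card (bphp_var (Suc i) ` {1..k}) * Suc (2 ^ (3 * k) * 2)) {P i ` {..<n}}"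
    proof (rule der_branch)
      show "is_clause (P i ` {..<n})" by (rule is_clause_row[OF ncP i])
      fix E assume E: "P i ` {..<n} \<subseteq> E" "is_clause E" "bphp_var (Suc i) ` {1..k} \<subseteq> lit_var ` E"
      have nt: "\<not> tautological E" using E(2) by (simp add: is_clause_def)
      \<comment> \<open>The negation of the leaf fixes all bits of the pigeon and hence a hole
        \<open>j\<close>. Since \<open>P i j\<close> occurs in the leaf, its definition alone
        implies the leaf.\<close>
      have "{l \<in> {1..k}. falsifier E (bphp_var (Suc i) l)} \<in> g ` {0..<n}"
        using g by (auto simp: bij_betw_def)
      then obtain j where j: "j < n" "g j = {l \<in> {1..k}. falsifier E (bphp_var (Suc i) l)}" by auto
      obtain G where G: "G \<subseteq> \<Gamma>'" "finite (vars G)" "card (vars G) \<le> 3 * k"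
        "\<forall>\<tau>. sat \<tau> G \<longrightarrow> holds \<tau> (P i j) = (\<forall>l\<in>{1..k}. \<tau> (bphp_var (Suc i) l) = (l \<in> g j))"
        using P[OF i j(1)] by (elim exE conjE) (rule that)
      show "der \<Gamma>' (2 ^ (3 * k) * 2) {E}"
      proof (rule der_sem[OF G(1,2) order_refl E(2) G(3)], rule ccontr)
        fix \<tau> assume \<tau>: "sat \<tau> G" "\<not> (\<exists>l\<in>E. holds \<tau> l)"
        have "\<tau> (bphp_var (Suc i) l) = (l \<in> g j)" if l: "l \<in> {1..k}" for l
        proof -
          obtain e where e: "e \<in> E" "lit_var e = bphp_var (Suc i) l" using E(3) l by (metis image_subset_iff imageE)
          have "\<not> holds (falsifier E) e" "\<not> holds \<tau> e" using falsifier[OF nt e(1)] \<tau>(2) e(1) by auto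
          then have "falsifier E (bphp_var (Suc i) l) = \<tau> (bphp_var (Suc i) l)"
            using e(2) by (cases e) auto
          then show ?thesis using l j(2) by auto
        qed
        then have "holds \<tau> (P i j)" using G(4) \<tau>(1) by blast
        then show False using \<tau>(2) E(1) j(1) by blast
      qed
    qed simp
    ultimately show ?thesis by simp
  qed
  define J where "J = {..n} \<times> {..n} \<times> {..<n}"
  define Y where "Y = (\<Union>(i, i', j)\<in>J. if i = i' then {} else {{negate (P i j), negate (P i' j)}})"
  have J: "finite J" "card J = Suc n * (Suc n * n)" by (auto simp: J_def card_cartesian_product)
  have "der \<Gamma>' (card J * (2 ^ (8 * k) * 2)) Y"
    unfolding Y_def by (rule der_UN[OF J(1)]) (use pairs in \<open>auto simp: J_def der_refl\<close>)
  moreover have "der \<Gamma>' (card {..n} * (2 ^ k * Suc (2 ^ (3 * k) * 2))) (\<Union>i\<in>{..n}. {P i ` {..<n}})"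
    by (rule der_UN) (use rows in auto)
  ultimately have D: "der \<Gamma>' (card J * (2 ^ (8 * k) * 2) + card {..n} * (2 ^ k * Suc (2 ^ (3 * k) * 2)))
      (Y \<union> (\<Union>i\<in>{..n}. {P i ` {..<n}}))"
    by (rule der_Un)
  have "{negate (P i j), negate (P i' j)} \<in> Y" if "i \<le> n" "i' \<le> n" "i \<noteq> i'" "j < n" for i i' j
    using that unfolding Y_def J_def by (intro UN_I[of "(i, i', j)"]) auto
  then have "php P n \<subseteq> Y \<union> (\<Union>i\<in>{..n}. {P i ` {..<n}})"
    unfolding php_def by blast
  then have "der \<Gamma>' (card J * (2 ^ (8 * k) * 2) + card {..n} * (2 ^ k * Suc (2 ^ (3 * k) * 2))) (php P n)"
    by (intro der_mono[OF D]) auto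
  then show ?thesis
    using es ncP unfolding \<Gamma>'_def \<Gamma>_def J cardI by (auto simp: n_def)
qed


text \<open>The exponents are generous. \<open>n \<ge> 2\<close> absorbs constants, so
  \<open>2 ^ 18\<close> becomes \<open>n ^ 18\<close> and each product is at most
  \<open>n ^ 22\<close>; ten such terms fit into \<open>n ^ 30\<close>.\<close>

lemma er_size_arith:
  fixes k :: nat
  assumes "k \<ge> 1"
  defines "n \<equiv> 2 ^ k"
  shows "3 * ((n + 1) * n * k + n * (2 * n ^ 2)) + ((n + 1) * ((n + 1) * n) * (2 ^ (8 * k) * 2) +
      (n + 1) * (n * Suc (2 ^ (3 * k) * 2)) + n * (2 ^ 18 * n ^ 3)) + 1 \<le> n ^ 30"
proof -
  have n2: "n \<ge> 2" using power_increasing[OF assms(1), of "2::nat"] by (simp add: n_def)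
  have pw: "(2::nat) ^ (c * k) = n ^ c" for c by (simp add: n_def mult.commute flip: power_mult)
  have up: "n ^ a \<le> n ^ b" if "a \<le> b" for a b using n2 that by (intro power_increasing) auto
  have two: "2 ^ c \<le> n ^ c" for c using n2 by (intro power_mono) auto
  have "k \<le> n" using less_exp[of k] by (simp add: n_def)
  have n1: "n + 1 \<le> n ^ 2" using mult_le_mono1[OF n2, of n] n2 unfolding power2_eq_square by linarith
  have "(n + 1) * n * k \<le> n ^ 2 * n * n" using n1 \<open>k \<le> n\<close> by (intro mult_le_mono) auto
  also have "\<dots> = n ^ 4" by (simp add: power2_eq_square power4_eq_xxxx)
  finally have 1: "(n + 1) * n * k \<le> n ^ 22" using up[of 4 22] by simp
  have "n * (2 * n ^ 2) \<le> n * (n * n ^ 2)" using n2 by (intro mult_le_mono) auto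
  also have "\<dots> = n ^ 4" by (simp add: power2_eq_square power4_eq_xxxx)
  finally have 2: "n * (2 * n ^ 2) \<le> n ^ 22" using up[of 4 22] by simp
  have "(n + 1) * ((n + 1) * n) * (2 ^ (8 * k) * 2) \<le> n ^ 2 * (n ^ 2 * n) * (n ^ 8 * n)"
    unfolding pw using n1 n2 by (intro mult_le_mono) auto
  also have "\<dots> = n ^ (2 + (2 + 1) + (8 + 1))" unfolding power_add power_one_right ..
  finally have 3: "(n + 1) * ((n + 1) * n) * (2 ^ (8 * k) * 2) \<le> n ^ 22" using up[of 14 22] by simp
  have "Suc (n ^ 3 * 2) \<le> n ^ 3 * 2 + n ^ 3" using n2 by simp
  also have "\<dots> \<le> n ^ 3 * n ^ 2" using mult_le_mono2[of 3 "n ^ 2" "n ^ 3"] power_mono[OF n2, of 2] by simp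
  finally have "(n + 1) * (n * Suc (2 ^ (3 * k) * 2)) \<le> n ^ 2 * (n * (n ^ 3 * n ^ 2))"
    unfolding pw using n1 by (intro mult_le_mono) auto
  also have "\<dots> = n ^ (2 + (1 + (3 + 2)))" unfolding power_add power_one_right ..
  finally have 4: "(n + 1) * (n * Suc (2 ^ (3 * k) * 2)) \<le> n ^ 22" using up[of 8 22] by simp
  have "n * (2 ^ 18 * n ^ 3) \<le> n * (n ^ 18 * n ^ 3)" using two[of 18] by (intro mult_le_mono order_refl)
  also have "\<dots> = n ^ (1 + (18 + 3))" unfolding power_add power_one_right ..
  finally have 5: "n * (2 ^ 18 * n ^ 3) \<le> n ^ 22" by simp
  have 6: "1 \<le> n ^ 22" using n2 by simp
  have "16 * n ^ 22 \<le> n ^ 8 * n ^ 22" using order_trans[OF _ two[of 8], of 16] by (intro mult_le_mono1) simp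
  also have "\<dots> = n ^ 30" by (simp flip: power_add)
  finally have 7: "16 * n ^ 22 \<le> n ^ 30" .
  have "3 * (a + b) + (c + d + e) + 1 \<le> u"
    if "a \<le> t" "b \<le> t" "c \<le> t" "d \<le> t" "e \<le> t" "1 \<le> t" "16 * t \<le> u" for a b c d e t u :: nat
  proof -
    have "3 * (a + b) \<le> 6 * t" "c + d + e \<le> 3 * t" using that(1-5) by auto
    with that(6,7) show ?thesis by linarith
  qed
  from this[OF 1 2 3 4 5 6 7] show ?thesis .
qed

lemma er_proof_bphp:
  assumes "k \<ge> 1"
  shows "\<exists>\<Lambda> \<Pi>. er_proof (bphp_pow k) \<Lambda> \<Pi> \<and> card \<Lambda> + length \<Pi> \<le> (2 ^ k) ^ 30"
proof -
  define n :: nat where "n = 2 ^ k"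
  define d where "d = (n + 1) * ((n + 1) * n) * (2 ^ (8 * k) * 2) + (n + 1) * (n * Suc (2 ^ (3 * k) * 2))"
  let ?\<Gamma> = "bphp_pow k"
  obtain es P where es: "ext_sequence ?\<Gamma> es" "length es \<le> (n + 1) * n * k" "nonclashing P n"
    "der (?\<Gamma> \<union> ext_union es) d (php P n)"
    using bphp_php[OF assms] unfolding n_def d_def by blast
  obtain n' \<Delta> where \<Delta>: "n' \<le> d" "steps res_derivable n' (?\<Gamma> \<union> ext_union es) \<Delta>" "php P n \<subseteq> \<Delta>"
    using es(4) unfolding der_def by blast
  have "vars (php P n) \<subseteq> (\<lambda>(i, j). lit_var (P i j)) ` ({..n} \<times> {..<n})"
    by (auto simp: vars_def php_def)
  from finite_subset[OF this] have "finite (vars (?\<Gamma> \<union> ext_union es \<union> php P n))"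
    by (simp add: vars_bphp_pow[OF assms])
  then obtain fs where fs: "ext_sequence (?\<Gamma> \<union> ext_union es \<union> php P n) fs" "length fs \<le> n * (2 * n ^ 2)"
    "der (?\<Gamma> \<union> ext_union es \<union> php P n \<union> ext_union fs) (n * (2 ^ 18 * n ^ 3)) {{}}"
    using php_refutation[OF _ _ es(3) order_refl] by blast
  have "der (?\<Gamma> \<union> ext_union (es @ fs)) (d + n * (2 ^ 18 * n ^ 3)) {{}}"
  proof (rule der_trans'[OF _ _ order_refl])
    show "der (?\<Gamma> \<union> ext_union (es @ fs)) d (php P n)" by (rule der_mono[OF es(4)]) auto
    show "der (?\<Gamma> \<union> ext_union (es @ fs) \<union> php P n) (n * (2 ^ 18 * n ^ 3)) {{}}"
      by (rule der_mono[OF fs(3)]) auto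
  qed
  then obtain N \<Theta> where "N \<le> d + n * (2 ^ 18 * n ^ 3)" "steps res_derivable N (?\<Gamma> \<union> ext_union (es @ fs)) \<Theta>" "{} \<in> \<Theta>"
    unfolding der_def by auto
  then obtain \<Pi> where \<Pi>: "res_proof (?\<Gamma> \<union> ext_union (es @ fs)) \<Pi>" "length \<Pi> \<le> d + n * (2 ^ 18 * n ^ 3) + 1"
    using proof_of_steps_bot by (metis Suc_eq_plus1 Suc_le_mono)
  have "ext_sequence ?\<Gamma> (es @ fs)" using es(1) ext_sequence_antimono[OF _ fs(1)] by auto
  with \<Pi>(1) have "er_proof ?\<Gamma> (ext_union (es @ fs)) \<Pi>" unfolding er_proof_def by blast
  moreover have "card (ext_union (es @ fs)) \<le> 3 * ((n + 1) * n * k + n * (2 * n ^ 2))"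
    using card_ext_union[of "es @ fs"] es(2) fs(2) by simp
  then have "card (ext_union (es @ fs)) + length \<Pi> \<le> n ^ 30"
    using \<Pi>(2) er_size_arith[OF assms] unfolding d_def n_def by linarith
  ultimately show ?thesis unfolding n_def by blast
qed

section \<open>Restrictions\<close>

text \<open>A partial assignment is represented by a total \<open>\<tau>\<close> and its domain
  \<open>U\<close>. Deleting all literals over \<open>U\<close> is the right operation only for
  clauses that are not \<open>sat_on\<close>, which \<open>restrict\<close> filters out.\<close>

definition restr :: "'v set \<Rightarrow> 'v literal set \<Rightarrow> 'v literal set" where
  "restr U C = {l \<in> C. lit_var l \<notin> U}"

definition sat_on :: "'v set \<Rightarrow> ('v \<Rightarrow> bool) \<Rightarrow> 'v literal set \<Rightarrow> bool" where
  "sat_on U \<tau> C \<longleftrightarrow> (\<exists>l\<in>C. lit_var l \<in> U \<and> holds \<tau> l)"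

definition restrict :: "'v set \<Rightarrow> ('v \<Rightarrow> bool) \<Rightarrow> 'v literal set set \<Rightarrow> 'v literal set set" where
  "restrict U \<tau> \<Gamma> = restr U ` {C \<in> \<Gamma>. \<not> sat_on U \<tau> C}"

lemma restrict_Un: "restrict U \<tau> (\<Gamma> \<union> \<Delta>) = restrict U \<tau> \<Gamma> \<union> restrict U \<tau> \<Delta>"
  by (auto simp: restrict_def)

lemma restrict_insert:
  "restrict U \<tau> (insert C \<Gamma>) = (if sat_on U \<tau> C then restrict U \<tau> \<Gamma> else insert (restr U C) (restrict U \<tau> \<Gamma>))"
  by (auto simp: restrict_def)

lemma restrictI: "C \<in> \<Gamma> \<Longrightarrow> \<not> sat_on U \<tau> C \<Longrightarrow> restr U C \<in> restrict U \<tau> \<Gamma>"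
  by (auto simp: restrict_def)

lemma restr_subset: "restr U C \<subseteq> C"
  by (auto simp: restr_def)

lemma restr_id: "lit_var ` C \<inter> U = {} \<Longrightarrow> restr U C = C"
  by (auto simp: restr_def)

lemma restrict_id:
  assumes "vars \<Gamma> \<inter> U = {}"
  shows "restrict U \<tau> \<Gamma> = \<Gamma>"
proof -
  have "restr U C = C \<and> \<not> sat_on U \<tau> C" if "C \<in> \<Gamma>" for C
    using assms that by (intro conjI restr_id) (auto simp: vars_def sat_on_def)
  then show ?thesis unfolding restrict_def by force
qed

lemma vars_restrict: "vars (restrict U \<tau> \<Gamma>) \<subseteq> vars \<Gamma> - U"
  by (auto simp: vars_def restrict_def restr_def)

lemma restr_empty [simp]: "restr U {} = {}"
  by (simp add: restr_def)

lemma empty_in_restrict: "{} \<in> \<Gamma> \<Longrightarrow> {} \<in> restrict U \<tau> \<Gamma>"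
  using restrictI[of "{}" \<Gamma> U \<tau>] by (simp add: sat_on_def)

lemma res_derivable_finite:
  assumes "res_derivable \<Delta> C" "\<forall>D\<in>\<Delta>. finite D"
  shows "finite C"
  using assms unfolding res_derivable_def resolvent_def is_clause_def by auto

text \<open>Resolution on an assigned variable becomes a weakening of the premise whose pivot
  literal is false. Finiteness is assumed because \<open>resolvent\<close> does not ask for it,
  whereas weakening requires \<open>is_clause\<close>.\<close>

lemma res_derivable_restrict:
  assumes "res_derivable \<Delta> C" "\<not> sat_on U \<tau> C" and fin: "\<forall>D\<in>\<Delta>. finite D"
  shows "res_derivable (restrict U \<tau> \<Delta>) (restr U C)"
proof -
  have weaken: "res_derivable (restrict U \<tau> \<Delta>) (restr U C)"
    if "A \<in> \<Delta>" "\<not> sat_on U \<tau> A" "restr U A \<subseteq> restr U C" "is_clause C" for A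
    using restrictI[OF that(1,2)] that(3) is_clause_subset[OF that(4) restr_subset]
    unfolding res_derivable_def by blast
  from assms(1) consider (res) A B where "A \<in> \<Delta>" "B \<in> \<Delta>" "resolvent A B C"
    | (weak) A where "A \<in> \<Delta>" "is_clause C" "A \<subseteq> C"
    unfolding res_derivable_def by blast
  then show ?thesis
  proof cases
    case weak
    have "restr U A \<subseteq> restr U C" "\<not> sat_on U \<tau> A" using weak assms(2) by (auto simp: restr_def sat_on_def)
    then show ?thesis using weak by (intro weaken) auto
  next
    case res
    then obtain x C1 D1 where r: "A = C1 \<union> {Pos x}" "B = D1 \<union> {Neg x}"
      "Pos x \<notin> C1 \<union> D1" "Neg x \<notin> C1 \<union> D1" "\<not> tautological (C1 \<union> D1)" "C = C1 \<union> D1"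
      unfolding resolvent_def by blast
    have cC: "is_clause C" using r res_derivable_finite[OF assms(1) fin] by (simp add: is_clause_def)
    show ?thesis
    proof (cases "x \<in> U")
      case True
      show ?thesis
      proof (cases "\<tau> x")
        case t: True
        show ?thesis
          by (rule weaken[OF res(2) _ _ cC]) (use assms(2) r True t in \<open>auto simp: restr_def sat_on_def\<close>)
      next
        case f: False
        show ?thesis
          by (rule weaken[OF res(1) _ _ cC]) (use assms(2) r True f in \<open>auto simp: restr_def sat_on_def\<close>)
      qed
    next
      case False
      have "\<not> sat_on U \<tau> A" "\<not> sat_on U \<tau> B" using assms(2) r False by (auto simp: sat_on_def)
      then have AB: "restr U A \<in> restrict U \<tau> \<Delta>" "restr U B \<in> restrict U \<tau> \<Delta>" using res restrictI by metis+
      have "\<not> tautological (restr U C)" using tautological_mono[OF _ restr_subset] cC by (auto simp: is_clause_def)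
      then have "resolvent (restr U A) (restr U B) (restr U C)"
        unfolding resolvent_def using r False
        by (intro exI[of _ x] exI[of _ "restr U C1"] exI[of _ "restr U D1"]) (auto simp: restr_def Collect_disj_eq conj_disj_distribR)
      with AB show ?thesis unfolding res_derivable_def by blast
    qed
  qed
qed

lemma steps_res_restrict:
  assumes "steps res_derivable n \<Gamma> \<Delta>" "\<forall>C\<in>\<Gamma>. finite C"
  shows "(\<forall>C\<in>\<Delta>. finite C) \<and> (\<exists>n'\<le>n. steps res_derivable n' (restrict U \<tau> \<Gamma>) (restrict U \<tau> \<Delta>))"
  using assms
proof (induction rule: steps.induct)
  case (refl \<Gamma>)
  then show ?case by (auto intro: steps.refl)
next
  case (step n \<Gamma> \<Delta> C)
  then obtain n' where n': "n' \<le> n" "steps res_derivable n' (restrict U \<tau> \<Gamma>) (restrict U \<tau> \<Delta>)"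
    and fin: "\<forall>C\<in>\<Delta>. finite C" by blast
  have "\<exists>n'\<le>Suc n. steps res_derivable n' (restrict U \<tau> \<Gamma>) (restrict U \<tau> (insert C \<Delta>))"
  proof (cases "sat_on U \<tau> C")
    case True
    then show ?thesis using n' by (intro exI[of _ n']) (simp add: restrict_insert)
  next
    case False
    then show ?thesis using n' steps.step[OF n'(2) res_derivable_restrict[OF step.hyps(2) False fin]]
      by (intro exI[of _ "Suc n'"]) (simp add: restrict_insert)
  qed
  then show ?case using fin res_derivable_finite[OF step.hyps(2) fin] by blast
qed

section \<open>Blocked extensions\<close>

inductive blocked_steps :: "'v literal set set \<Rightarrow> 'v literal set set \<Rightarrow> bool" for \<Gamma> where
  refl: "blocked_steps \<Gamma> \<Gamma>"
| step: "blocked_steps \<Gamma> \<Delta> \<Longrightarrow> blocked C \<Delta> \<Longrightarrow> blocked_steps \<Gamma> (insert C \<Delta>)"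

lemma blocked_steps_list:
  assumes "blocked_steps \<Gamma> \<Delta>"
  shows "\<Gamma> \<subseteq> \<Delta> \<and> (\<exists>Cs. distinct Cs \<and> set Cs = \<Delta> - \<Gamma> \<and>
    (\<forall>i<length Cs. blocked (Cs ! i) (\<Gamma> \<union> set (take i Cs))))"
  using assms
proof (induction rule: blocked_steps.induct)
  case (step \<Delta> C)
  then obtain Cs where Cs: "distinct Cs" "set Cs = \<Delta> - \<Gamma>"
    "\<forall>i<length Cs. blocked (Cs ! i) (\<Gamma> \<union> set (take i Cs))" and sub: "\<Gamma> \<subseteq> \<Delta>" by blast
  show ?case
  proof (cases "C \<in> \<Delta>")
    case True
    then show ?thesis using Cs sub by (auto simp: insert_absorb)
  next
    case False
    have "\<Gamma> \<union> set Cs = \<Delta>" using Cs(2) sub by auto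
    then have "\<forall>i<length (Cs @ [C]). blocked ((Cs @ [C]) ! i) (\<Gamma> \<union> set (take i (Cs @ [C])))"
      using Cs(3) step.hyps(2) by (auto simp: nth_append less_Suc_eq)
    moreover have "distinct (Cs @ [C])" "set (Cs @ [C]) = insert C \<Delta> - \<Gamma>" using Cs False sub by auto
    ultimately show ?thesis using sub by blast
  qed
qed simp

lemma blocked_steps_restrict:
  assumes "blocked_steps \<Gamma> \<Delta>" "\<not> sat_on U \<tau> C \<Longrightarrow> blocked (restr U C) \<Delta>"
  shows "blocked_steps \<Gamma> (\<Delta> \<union> restrict U \<tau> {C})"
  using assms blocked_steps.step[OF assms(1)] by (simp add: restrict_insert) (simp add: restrict_def)

lemma blocked_steps_Un:
  assumes "finite S" "blocked_steps \<Gamma> \<Delta>" "\<And>C T. C \<in> S \<Longrightarrow> T \<subseteq> S \<Longrightarrow> blocked C (\<Delta> \<union> T)"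
  shows "blocked_steps \<Gamma> (\<Delta> \<union> S)"
proof -
  have "blocked_steps \<Gamma> (\<Delta> \<union> T)" if "finite T" "T \<subseteq> S" for T
    using that
  proof (induction T rule: finite_induct)
    case (insert C T)
    then show ?case using blocked_steps.step[of \<Gamma> "\<Delta> \<union> T" C] assms(3) by auto
  qed (simp add: assms(2))
  then show ?thesis using assms(1) by blast
qed

lemma blocked_absent: "p \<in> C \<Longrightarrow> (\<And>D. D \<in> \<Gamma> \<Longrightarrow> negate p \<notin> D) \<Longrightarrow> blocked C \<Gamma>"
  unfolding blocked_def blocked_for_def by blast

text \<open>The two clauses with \<open>Neg x\<close> come first and are blocked because
  \<open>Pos x\<close> does not occur yet. The third is then blocked on \<open>Pos x\<close>: its
  partners contain \<open>p\<close> or \<open>q\<close>, and it contains the negations.\<close>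

lemma blocked_steps_ext:
  assumes "ext_sequence \<Gamma> es" "fst ` set es \<inter> U = {}" "fst ` set es \<inter> vars \<Theta> = {}"
  shows "blocked_steps \<Theta> (\<Theta> \<union> restrict U \<tau> (ext_union es))"
  using assms
proof (induction es rule: rev_induct)
  case Nil
  then show ?case by (simp add: ext_union_def restrict_def blocked_steps.refl)
next
  case (snoc e es)
  obtain x p q where e: "e = (x, p, q)" by (cases e)
  have seq: "ext_sequence \<Gamma> es" "is_ext_for (\<Gamma> \<union> ext_union es) e"
    using snoc.prems(1) by simp_all
  define \<Delta> where "\<Delta> = \<Theta> \<union> restrict U \<tau> (ext_union es)"
  have \<Delta>: "blocked_steps \<Theta> \<Delta>" unfolding \<Delta>_def using snoc seq by (intro snoc.IH) auto
  have x: "x \<notin> vars \<Delta>" "x \<notin> U" "lit_var p \<noteq> x" "lit_var q \<noteq> x"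
    using seq(2) snoc.prems vars_restrict[of U \<tau> "ext_union es"] by (auto simp: \<Delta>_def e)
  have nx: "Pos x \<notin> D" "Neg x \<notin> D" if "D \<in> \<Delta>" for D
    using x(1) vars_memberI[OF that] by fastforce+
  have rs: "restr U {Neg x, r} = insert (Neg x) (restr U {r})" for r
    using x by (auto simp: restr_def)
  have rp: "restr U {Pos x, r, s} = insert (Pos x) (restr U {r, s})" for r s
    using x by (auto simp: restr_def)
  let ?R = "\<lambda>C. restrict U \<tau> {C}"
  have "blocked_steps \<Theta> (\<Delta> \<union> ?R {Neg x, p})"
    by (rule blocked_steps_restrict[OF \<Delta>]) (auto simp: rs nx intro!: blocked_absent[of "Neg x"])
  then have "blocked_steps \<Theta> (\<Delta> \<union> ?R {Neg x, p} \<union> ?R {Neg x, q})"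
    by (rule blocked_steps_restrict)
      (use x in \<open>auto simp: rs nx restrict_def restr_def intro!: blocked_absent[of "Neg x"] split: if_splits\<close>)
  then have "blocked_steps \<Theta> (\<Delta> \<union> ?R {Neg x, p} \<union> ?R {Neg x, q} \<union> ?R {Pos x, negate p, negate q})"
  proof (rule blocked_steps_restrict)
    let ?C = "{Pos x, negate p, negate q}"
    assume ns: "\<not> sat_on U \<tau> ?C"
    have t: "tautological (restr U ?C - {Pos x} \<union> (restr U {Neg x, r} - {negate (Pos x)}))"
      if r: "r \<in> {p, q}" "\<not> sat_on U \<tau> {Neg x, r}" for r
    proof -
      \<comment> \<open>If \<open>r\<close> were assigned, the true one among \<open>r\<close> and
        its negation would satisfy one of the two clauses, and that clause would be absent.\<close>
      have "lit_var r \<notin> U" using r ns by (auto simp: sat_on_def)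
      then have "r \<in> restr U {Neg x, r} - {negate (Pos x)}" "negate r \<in> restr U ?C - {Pos x}"
        using r x by (auto simp: restr_def)
      then show ?thesis unfolding tautological_def by blast
    qed
    have "blocked_for (Pos x) (restr U ?C) (\<Delta> \<union> ?R {Neg x, p} \<union> ?R {Neg x, q})"
      unfolding blocked_for_def
    proof (intro conjI ballI impI)
      fix D assume D: "D \<in> \<Delta> \<union> ?R {Neg x, p} \<union> ?R {Neg x, q}" "negate (Pos x) \<in> D"
      then have "D \<in> ?R {Neg x, p} \<union> ?R {Neg x, q}" using nx by auto
      then obtain r where "r \<in> {p, q}" "\<not> sat_on U \<tau> {Neg x, r}" "D = restr U {Neg x, r}"
        by (auto simp: restrict_def)
      then show "tautological (restr U ?C - {Pos x} \<union> (D - {negate (Pos x)}))" using t by simp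
    qed (simp add: rp)
    then show "blocked (restr U ?C) (\<Delta> \<union> ?R {Neg x, p} \<union> ?R {Neg x, q})"
      unfolding blocked_def by (auto simp: rp)
  qed
  moreover have "\<Theta> \<union> restrict U \<tau> (ext_union (es @ [e])) =
      \<Delta> \<union> ?R {Neg x, p} \<union> ?R {Neg x, q} \<union> ?R {Pos x, negate p, negate q}"
    unfolding e \<Delta>_def by (auto simp: restrict_def)
  ultimately show ?case by simp
qed

section \<open>Proofs for the construction\<close>

lemma ext_sequence_fresh: "ext_sequence \<Gamma> es \<Longrightarrow> fst ` set es \<inter> vars \<Gamma> = {}"
proof (induction es arbitrary: \<Gamma>)
  case (Cons e es)
  then have "fst ` set es \<inter> vars (\<Gamma> \<union> ext_clauses e) = {}" unfolding ext_sequence_Cons by blast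
  moreover have "fst e \<notin> vars \<Gamma>" using Cons.prems by (cases e) simp
  ultimately show ?case by auto
qed simp

lemma ext_sequence_is_formula: "ext_sequence \<Gamma> es \<Longrightarrow> is_formula (ext_union es)"
proof (induction es arbitrary: \<Gamma>)
  case (Cons e es)
  have "is_formula (ext_clauses e)" using Cons.prems by (cases e) (simp del: ext_clauses.simps)
  then show ?case using Cons by (auto simp: is_formula_def)
qed (simp add: is_formula_def)

lemma ext_vars_in_ext_union: "fst ` set es \<subseteq> vars (ext_union es)"
  by (induction es) auto

lemma ext_union_literal: "C \<in> ext_union es \<Longrightarrow> \<exists>l\<in>C. lit_var l \<in> fst ` set es"
proof (induction es)
  case (Cons e es)
  then show ?case by (cases e) auto
qed simp

lemma V_part_eq:
  "V_part m es y z = (\<Union>x\<in>fst ` set es. \<Union>j\<in>{1..m}.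
     {{Pos x, Pos (y j), Neg (z j)}, {Neg x, Pos (y j), Neg (z j)}})"
  unfolding V_part_def by (simp add: image_image case_prod_unfold)

text \<open>Set-blockedness survives a restriction that does not touch \<open>L\<close>; it may fail for one
  that falsifies part of \<open>L\<close>.\<close>

lemma set_blocked_for_restrict:
  assumes "set_blocked_for L C \<Delta>" "\<not> sat_on U \<tau> C" "lit_var ` L \<inter> U = {}"
  shows "set_blocked_for L (restr U C) (restrict U \<tau> \<Delta>)"
proof -
  have L: "L \<noteq> {}" "L \<subseteq> C"
    and bl: "\<And>D. D \<in> \<Delta> \<Longrightarrow> D \<inter> negate ` L \<noteq> {} \<Longrightarrow> D \<inter> L = {} \<Longrightarrow> tautological ((C - L) \<union> (D - negate ` L))"
    using assms(1) unfolding set_blocked_for_def by blast+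
  have LU: "lit_var l \<notin> U" if "l \<in> L \<or> l \<in> negate ` L" for l using that assms(3) by auto
  have "tautological ((restr U C - L) \<union> (D' - negate ` L))"
    if D': "D' \<in> restrict U \<tau> \<Delta>" "D' \<inter> negate ` L \<noteq> {}" "D' \<inter> L = {}" for D'
  proof -
    obtain D where D: "D \<in> \<Delta>" "\<not> sat_on U \<tau> D" "D' = restr U D" using D'(1) by (auto simp: restrict_def)
    have "D \<inter> negate ` L \<noteq> {}" using D'(2) D(3) restr_subset[of U D] by blast
    moreover have "D \<inter> L = {}" using D'(3) LU unfolding D(3) restr_def by blast
    ultimately obtain l where l: "l \<in> (C - L) \<union> (D - negate ` L)" "negate l \<in> (C - L) \<union> (D - negate ` L)"
      using bl[OF D(1)] unfolding tautological_def by blast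
    have "lit_var l \<notin> U"
    proof
      assume U: "lit_var l \<in> U"
      have "\<not> holds \<tau> l'" if "l' \<in> C \<union> D" "lit_var l' \<in> U" for l'
        using that assms(2) D(2) unfolding sat_on_def by blast
      from this[of l] this[of "negate l"] show False using l U by auto
    qed
    then have "l \<in> (restr U C - L) \<union> (D' - negate ` L)" "negate l \<in> (restr U C - L) \<union> (D' - negate ` L)"
      using l unfolding D(3) restr_def by auto
    then show ?thesis unfolding tautological_def by blast
  qed
  moreover have "L \<subseteq> restr U C" using L(2) LU unfolding restr_def by blast
  ultimately show ?thesis using L(1) unfolding set_blocked_for_def by blast
qed

text \<open>Make \<open>L\<close> true and \<open>C - L\<close> false: a clause that is blocked by neither disjunct is satisfied.\<close>

lemma satisfiable_if_blocked:
  assumes C: "\<not> tautological C" "L \<subseteq> C" and \<Gamma>: "\<And>E. E \<in> \<Gamma> \<Longrightarrow> \<not> tautological E"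
    and bl: "\<And>E. E \<in> \<Gamma> \<Longrightarrow> E \<inter> L = {} \<Longrightarrow> tautological ((C - L) \<union> E)"
  shows "\<not> unsatisfiable \<Gamma>"
proof -
  define \<tau> where "\<tau> = (\<lambda>v. Pos v \<in> L \<or> Neg v \<in> C - L)"
  have nC: "negate l \<notin> C" if "l \<in> C" for l using C(1) that unfolding tautological_def by blast
  have tL: "holds \<tau> l" if "l \<in> L" for l
    using that nC[of l] C(2) by (cases l) (auto simp: \<tau>_def)
  have fC: "\<not> holds \<tau> l" if "l \<in> C - L" for l
    using that nC[of l] C(2) by (cases l) (auto simp: \<tau>_def)
  have "\<exists>l\<in>E. holds \<tau> l" if E: "E \<in> \<Gamma>" for E
  proof (cases "E \<inter> L = {}")
    case False
    then show ?thesis using tL by blast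
  next
    case True
    obtain l where l: "l \<in> (C - L) \<union> E" "negate l \<in> (C - L) \<union> E"
      using bl[OF E True] unfolding tautological_def by blast
    have "\<not> (l \<in> E \<and> negate l \<in> E)" using \<Gamma>[OF E] unfolding tautological_def by blast
    then consider "l \<in> E" "negate l \<in> C - L" | "negate l \<in> E" "l \<in> C - L"
      using l nC[of l] by blast
    then show ?thesis
    proof cases
      case 1
      then show ?thesis using fC[OF 1(2)] by (intro bexI[of _ l]) auto
    next
      case 2
      then show ?thesis using fC[OF 2(2)] by (intro bexI[of _ "negate l"]) auto
    qed
  qed
  then show ?thesis unfolding unsatisfiable_def by blast
qed

section \<open>The upper bound for the construction\<close>

locale construction =
  fixes \<Gamma> :: "'v literal set set" and es :: "'v ext list" and y z :: "nat \<Rightarrow> 'v" and m :: nat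
  assumes formula: "is_formula \<Gamma>" and seq: "ext_sequence \<Gamma> es"
    and inj_y: "inj_on y {1..m}" and inj_z: "inj_on z {1..m}"
    and disj: "y ` {1..m} \<inter> z ` {1..m} = {}"
    and fresh: "(y ` {1..m} \<union> z ` {1..m}) \<inter> vars (\<Gamma> \<union> ext_union es) = {}"
begin

abbreviation "V \<equiv> V_part m es y z"
abbreviation "W \<equiv> W_part m \<Gamma> y z"
abbreviation "F \<equiv> \<Gamma> \<union> V \<union> W"

lemma yz_neq: "i \<in> {1..m} \<Longrightarrow> j \<in> {1..m} \<Longrightarrow> y i \<noteq> z j"
  using disj by blast

lemma fresh_yz:
  assumes "j \<in> {1..m}"
  shows "y j \<notin> vars \<Gamma>" "z j \<notin> vars \<Gamma>" "y j \<notin> vars (ext_union es)" "z j \<notin> vars (ext_union es)"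
  using fresh assms unfolding vars_Un by blast+

lemma ext_var_neq: "x \<in> fst ` set es \<Longrightarrow> j \<in> {1..m} \<Longrightarrow> x \<noteq> y j \<and> x \<noteq> z j"
  using fresh_yz ext_vars_in_ext_union[of es] by blast

lemma V_iff:
  "C \<in> V \<longleftrightarrow> (\<exists>l j. lit_var l \<in> fst ` set es \<and> j \<in> {1..m} \<and> C = {l, Pos (y j), Neg (z j)})"
proof
  assume "C \<in> V"
  then obtain x j where "x \<in> fst ` set es" "j \<in> {1..m}"
    "C = {Pos x, Pos (y j), Neg (z j)} \<or> C = {Neg x, Pos (y j), Neg (z j)}"
    unfolding V_part_eq by blast
  then show "\<exists>l j. lit_var l \<in> fst ` set es \<and> j \<in> {1..m} \<and> C = {l, Pos (y j), Neg (z j)}"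
    by (metis lit_var.simps)
next
  assume "\<exists>l j. lit_var l \<in> fst ` set es \<and> j \<in> {1..m} \<and> C = {l, Pos (y j), Neg (z j)}"
  then obtain l j where lj: "lit_var l \<in> fst ` set es" "j \<in> {1..m}" "C = {l, Pos (y j), Neg (z j)}" by blast
  then show "C \<in> V" unfolding V_part_eq
    by (intro UN_I[of "lit_var l"] UN_I[of j]) (cases l; simp)+
qed

lemma W_cases:
  assumes "C \<in> W"
  obtains j where "j \<in> {1..m}" "C = {Neg (y j), Pos (z j)}"
  | j E where "j \<in> {1..m}" "E \<in> \<Gamma>" "C = insert (Pos (y j)) E"
  | j E where "j \<in> {1..m}" "E \<in> \<Gamma>" "C = insert (Neg (z j)) E"
proof -
  from assms obtain j where j: "j \<in> {1..m}"
    "C = {Neg (y j), Pos (z j)} \<or> C \<in> clause_or {Pos (y j)} \<Gamma> \<or> C \<in> clause_or {Neg (z j)} \<Gamma>"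
    unfolding W_part_def by blast
  from j(2) that j(1) show ?thesis unfolding clause_or_def by auto
qed

lemma W_I:
  assumes "j \<in> {1..m}"
  shows "{Neg (y j), Pos (z j)} \<in> W" "E \<in> \<Gamma> \<Longrightarrow> insert (Pos (y j)) E \<in> W" "E \<in> \<Gamma> \<Longrightarrow> insert (Neg (z j)) E \<in> W"
proof -
  show "{Neg (y j), Pos (z j)} \<in> W" using assms unfolding W_part_def by blast
  have *: "insert l E \<in> clause_or {l} \<Gamma>" if "E \<in> \<Gamma>" "lit_var l \<notin> vars \<Gamma>" for l E
  proof -
    have "negate l \<notin> E" using vars_memberI[OF that(1), of "negate l"] that(2) by auto
    then have "is_clause (insert l E)" using formula that(1) by (auto simp: is_formula_def is_clause_insert)
    then show ?thesis using that(1) unfolding clause_or_def is_clause_def by auto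
  qed
  show "insert (Pos (y j)) E \<in> W" "insert (Neg (z j)) E \<in> W" if "E \<in> \<Gamma>"
    using *[OF that, of "Pos (y j)"] *[OF that, of "Neg (z j)"] fresh_yz[OF assms] assms
    unfolding W_part_def by auto
qed

lemma vars_W: "vars W \<subseteq> vars \<Gamma> \<union> y ` {1..m} \<union> z ` {1..m}"
proof
  fix v assume "v \<in> vars W"
  then obtain C l where C: "C \<in> W" "l \<in> C" "v = lit_var l" by (auto simp: vars_def)
  from C(1) show "v \<in> vars \<Gamma> \<union> y ` {1..m} \<union> z ` {1..m}"
    by (cases rule: W_cases) (use C vars_memberI in auto)
qed

lemma vars_V: "vars V \<subseteq> fst ` set es \<union> y ` {1..m} \<union> z ` {1..m}"
proof
  fix v assume "v \<in> vars V"
  then obtain C l where C: "C \<in> V" "l \<in> C" "v = lit_var l" by (auto simp: vars_def)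
  from C(1) obtain l' j where "lit_var l' \<in> fst ` set es" "j \<in> {1..m}" "C = {l', Pos (y j), Neg (z j)}"
    unfolding V_iff by blast
  then show "v \<in> fst ` set es \<union> y ` {1..m} \<union> z ` {1..m}" using C by auto
qed

lemma ext_vars_in_F: "m \<ge> 1 \<Longrightarrow> fst ` set es \<subseteq> vars F"
proof
  fix x assume "m \<ge> 1" "x \<in> fst ` set es"
  then have "{Pos x, Pos (y 1), Neg (z 1)} \<in> V" unfolding V_iff by (intro exI[of _ "Pos x"] exI[of _ 1]) simp
  then have "{Pos x, Pos (y 1), Neg (z 1)} \<in> F" by blast
  from vars_memberI[OF this, of "Pos x"] show "x \<in> vars F" by simp
qed

lemma ext_vars_disjoint: "fst ` set es \<inter> vars (\<Gamma> \<union> W) = {}"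
proof -
  have "x \<notin> vars (\<Gamma> \<union> W)" if "x \<in> fst ` set es" for x
    using ext_sequence_fresh[OF seq] ext_var_neq[OF that] vars_W that unfolding vars_Un by blast
  then show ?thesis by auto
qed

lemma finite_V: "finite V"
  unfolding V_part_eq by simp

text \<open>\<open>Neg (y j)\<close> occurs only in \<open>{Neg (y j), Pos (z j)}\<close>, which
  clashes with \<open>Neg (z j)\<close>. Clauses of \<open>V\<close> contain \<open>y j\<close> only
  positively, so they can be added in any order.\<close>

lemma blocked_V:
  assumes "C \<in> V" "T \<subseteq> V" "vars \<Lambda> \<subseteq> vars (ext_union es)"
  shows "blocked C (\<Gamma> \<union> W \<union> \<Lambda> \<union> T)"
proof -
  obtain l j where C: "lit_var l \<in> fst ` set es" "j \<in> {1..m}" "C = {l, Pos (y j), Neg (z j)}"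
    using assms(1) unfolding V_iff by blast
  have l: "lit_var l \<noteq> y j" "lit_var l \<noteq> z j" using ext_var_neq[OF C(1,2)] by auto
  have "tautological (C - {Pos (y j)} \<union> (D - {negate (Pos (y j))}))"
    if D: "D \<in> \<Gamma> \<union> W \<union> \<Lambda> \<union> T" "negate (Pos (y j)) \<in> D" for D
  proof -
    have "D \<notin> \<Gamma>" "D \<notin> \<Lambda>"
      using vars_memberI[OF _ D(2)] fresh_yz[OF C(2)] assms(3) by auto
    moreover have "D \<notin> V"
    proof
      assume "D \<in> V"
      then obtain l' j' where D': "lit_var l' \<in> fst ` set es" "j' \<in> {1..m}" "D = {l', Pos (y j'), Neg (z j')}"
        unfolding V_iff by blast
      then show False using D(2) yz_neq[OF C(2) D'(2)] ext_var_neq[OF D'(1) C(2)] by auto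
    qed
    ultimately have "D \<in> W" using D(1) assms(2) by auto
    then have "D = {Neg (y j), Pos (z j)}"
    proof (cases rule: W_cases)
      case (1 j')
      then show ?thesis using D(2) inj_onD[OF inj_y _ C(2), of j'] by auto
    next
      case (2 j' E)
      then show ?thesis using D(2) vars_memberI[OF 2(2), of "Neg (y j)"] fresh_yz[OF C(2)] by auto
    next
      case (3 j' E)
      then show ?thesis using D(2) vars_memberI[OF 3(2), of "Neg (y j)"] fresh_yz[OF C(2)] yz_neq[OF C(2) 3(1)] by auto
    qed
    then have "Neg (z j) \<in> C - {Pos (y j)}" "Pos (z j) \<in> D - {negate (Pos (y j))}" using C by auto
    then show ?thesis unfolding tautological_def by force
  qed
  then have "blocked_for (Pos (y j)) C (\<Gamma> \<union> W \<union> \<Lambda> \<union> T)" unfolding blocked_for_def using C by auto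
  then show ?thesis unfolding blocked_def using C by blast
qed

text \<open>Since \<open>p\<close> and \<open>q\<close> of an extension \<open>(x, p, q)\<close> may be variables foreign to \<open>F\<close>, the
  given ER proof is first restricted to the variables of \<open>F\<close>.\<close>

lemma ger_minus_proof:
  assumes m: "m \<ge> 1" and \<Pi>: "res_proof (\<Gamma> \<union> ext_union es) \<Pi>"
  shows "\<exists>\<Lambda> \<Pi>'. ger_minus_proof F \<Lambda> \<Pi>' \<and> card \<Lambda> + length \<Pi>' \<le> card (ext_union es) + length \<Pi>"
proof -
  \<comment> \<open>All variables outside \<open>F\<close> are assigned, with an arbitrary constant
    value. The extension variables survive since \<open>V\<close> mentions them when
    \<open>m \<ge> 1\<close>.\<close>
  define U where "U = - vars F"
  define \<tau> where "\<tau> = (\<lambda>_::'v. True)"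
  define \<Lambda> where "\<Lambda> = restrict U \<tau> (ext_union es)"
  have form: "is_formula (ext_union es)" by (rule ext_sequence_is_formula[OF seq])
  have finE: "finite (ext_union es)" using form by (simp add: is_formula_def)
  have \<Lambda>: "is_formula \<Lambda>" "card \<Lambda> \<le> card (ext_union es)" "vars \<Lambda> \<subseteq> vars F" "vars \<Lambda> \<subseteq> vars (ext_union es)"
  proof -
    show "is_formula \<Lambda>"
      using form is_clause_subset[OF _ restr_subset] by (auto simp: \<Lambda>_def restrict_def is_formula_def)
    have "card \<Lambda> \<le> card {C \<in> ext_union es. \<not> sat_on U \<tau> C}"
      unfolding \<Lambda>_def restrict_def using finE by (intro card_image_le) simp
    also have "\<dots> \<le> card (ext_union es)" using finE by (intro card_mono) auto
    finally show "card \<Lambda> \<le> card (ext_union es)" .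
    show "vars \<Lambda> \<subseteq> vars F" "vars \<Lambda> \<subseteq> vars (ext_union es)"
      using vars_restrict[of U \<tau> "ext_union es"] by (auto simp: \<Lambda>_def U_def)
  qed
  have xU: "fst ` set es \<inter> U = {}" using ext_vars_in_F[OF m] by (auto simp: U_def)
  \<comment> \<open>A blocked extension has to list all of \<open>\<Lambda>\<close>, while the list
    obtained below omits whatever already lies in \<open>\<Gamma> \<union> W\<close>.\<close>
  have disj: "\<Lambda> \<inter> (\<Gamma> \<union> W) = {}"
  proof -
    have "D \<notin> \<Gamma> \<union> W" if "D \<in> \<Lambda>" for D
    proof
      assume D: "D \<in> \<Gamma> \<union> W"
      from that obtain C where C: "C \<in> ext_union es" "D = restr U C" by (auto simp: \<Lambda>_def restrict_def)
      then obtain l where l: "l \<in> C" "lit_var l \<in> fst ` set es" using ext_union_literal by blast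
      then have "l \<in> D" using C xU by (auto simp: restr_def)
      then show False using vars_memberI[OF D] l(2) ext_vars_disjoint by auto
    qed
    then show ?thesis by blast
  qed
  have "blocked_steps (\<Gamma> \<union> W) (\<Gamma> \<union> W \<union> \<Lambda>)"
    unfolding \<Lambda>_def using ext_vars_disjoint by (intro blocked_steps_ext[OF seq xU])
  then have "blocked_steps (\<Gamma> \<union> W) (\<Gamma> \<union> W \<union> \<Lambda> \<union> V)"
    by (rule blocked_steps_Un[OF finite_V]) (rule blocked_V[OF _ _ \<Lambda>(4)])
  then obtain Cs where Cs: "distinct Cs" "set Cs = (\<Gamma> \<union> W \<union> \<Lambda> \<union> V) - (\<Gamma> \<union> W)"
    "\<forall>i<length Cs. blocked (Cs ! i) (\<Gamma> \<union> W \<union> set (take i Cs))"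
    using blocked_steps_list by blast
  have "set Cs = \<Lambda> \<union> (F - (\<Gamma> \<union> W))" using Cs(2) disj by auto
  then have ext: "blocked_extension F \<Lambda>"
    unfolding blocked_extension_def using Cs(1,3) \<Lambda>(1)
    by (intro conjI exI[of _ "\<Gamma> \<union> W"] exI[of _ Cs]) auto
  obtain n \<Delta> where \<Delta>: "length \<Pi> = Suc n" "steps res_derivable n (\<Gamma> \<union> ext_union es) \<Delta>" "{} \<in> \<Delta>"
    using steps_of_proof[OF \<Pi>] by metis
  have "\<forall>C\<in>\<Gamma> \<union> ext_union es. finite C" using formula form by (auto simp: is_formula_def is_clause_def)
  then obtain n' where n': "n' \<le> n" "steps res_derivable n' (restrict U \<tau> (\<Gamma> \<union> ext_union es)) (restrict U \<tau> \<Delta>)"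
    using steps_res_restrict[OF \<Delta>(2)] by blast
  have "restrict U \<tau> \<Gamma> = \<Gamma>" by (rule restrict_id) (auto simp: U_def)
  then have "steps res_derivable n' (\<Gamma> \<union> \<Lambda> \<union> F) (restrict U \<tau> \<Delta> \<union> F)"
    using steps_res_frame[OF n'(2), of F] by (simp add: restrict_Un \<Lambda>_def)
  moreover have "\<Gamma> \<union> \<Lambda> \<union> F = F \<union> \<Lambda>" by auto
  ultimately have "steps res_derivable n' (F \<union> \<Lambda>) (restrict U \<tau> \<Delta> \<union> F)" by simp
  moreover have "{} \<in> restrict U \<tau> \<Delta> \<union> F" using empty_in_restrict[OF \<Delta>(3)] by blast
  ultimately obtain \<Pi>' where \<Pi>': "res_proof (F \<union> \<Lambda>) \<Pi>'" "length \<Pi>' = Suc n'"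
    "proof_vars \<Pi>' \<subseteq> vars (restrict U \<tau> \<Delta> \<union> F)"
    using proof_of_steps_bot by metis
  have "vars (restrict U \<tau> \<Delta>) \<subseteq> vars F" using vars_restrict[of U \<tau> \<Delta>] by (auto simp: U_def)
  then have "proof_vars \<Pi>' \<subseteq> vars F" using \<Pi>'(3) by auto
  with ext \<Pi>'(1) \<Lambda>(3) have "ger_minus_proof F \<Lambda> \<Pi>'" unfolding ger_minus_proof_def by blast
  moreover have "card \<Lambda> + length \<Pi>' \<le> card (ext_union es) + length \<Pi>" using \<Lambda>(2) \<Pi>'(2) n'(1) \<Delta>(1) by simp
  ultimately show ?thesis by blast
qed

section \<open>Set-blocked clauses on the new variables, and their removal\<close>

lemma formula_nontaut: "E \<in> \<Gamma> \<Longrightarrow> \<not> tautological E"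
  using formula by (auto simp: is_formula_def is_clause_def)

text \<open>If \<open>L\<close> contained \<open>Pos (z j)\<close> or \<open>Neg (y j)\<close>, the
  copy of \<open>\<Gamma>\<close> guarded by the negated literal would make \<open>\<Gamma>\<close>
  satisfiable by \<open>satisfiable_if_blocked\<close>. So \<open>L\<close> contains
  \<open>Pos (y j)\<close> or \<open>Neg (z j)\<close>, and the clash with
  \<open>{Neg (y j), Pos (z j)}\<close> forces the other one into \<open>C\<close>.\<close>

lemma set_blocked_guard:
  assumes bl: "set_blocked_for L C \<Delta>" and sub: "F \<subseteq> \<Delta>" and C: "is_clause C"
    and unsat: "unsatisfiable \<Gamma>" and j: "j \<in> {1..m}" and touch: "l \<in> L" "lit_var l \<in> {y j, z j}"
  shows "Pos (y j) \<in> C \<and> Neg (z j) \<in> C"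
proof -
  have nC: "negate l \<notin> C" if "l \<in> C" for l using C that unfolding is_clause_def tautological_def by blast
  have LC: "L \<subseteq> C" and bl: "\<And>D. D \<in> \<Delta> \<Longrightarrow> D \<inter> negate ` L \<noteq> {} \<Longrightarrow> D \<inter> L = {} \<Longrightarrow> tautological ((C - L) \<union> (D - negate ` L))"
    using bl unfolding set_blocked_for_def by blast+
  have no: "p \<notin> L" if W: "\<And>E. E \<in> \<Gamma> \<Longrightarrow> insert (negate p) E \<in> \<Delta>" for p
  proof
    assume p: "p \<in> L"
    have "tautological ((C - L) \<union> E)" if "E \<in> \<Gamma>" "E \<inter> L = {}" for E
    proof -
      have "negate p \<notin> L" using p LC nC[of p] by blast
      then have "insert (negate p) E \<inter> L = {}" using that by auto
      moreover have "negate p \<in> insert (negate p) E \<inter> negate ` L" using p by blast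
      ultimately have "tautological ((C - L) \<union> (insert (negate p) E - negate ` L))"
        using bl[OF W[OF that(1)]] by blast
      then show ?thesis by (rule tautological_mono) (use p in auto)
    qed
    then have "\<not> unsatisfiable \<Gamma>"
      using C LC formula_nontaut by (intro satisfiable_if_blocked) (auto simp: is_clause_def)
    then show False using unsat by blast
  qed
  have z: "Pos (z j) \<notin> L" using no[of "Pos (z j)"] W_I(3)[OF j] sub by auto
  have y: "Neg (y j) \<notin> L" using no[of "Neg (y j)"] W_I(2)[OF j] sub by auto
  let ?D = "{Neg (y j), Pos (z j)}"
  have D: "?D \<in> \<Delta>" "?D \<inter> L = {}" using W_I(1)[OF j] sub y z by auto
  have "l = Pos (y j) \<or> l = Neg (z j)" using touch y z by (cases l) auto
  then show ?thesis
  proof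
    assume l: "l = Pos (y j)"
    have "Neg (y j) \<in> ?D \<inter> negate ` L" using touch l by force
    then have t: "tautological ((C - L) \<union> (?D - negate ` L))" using bl[OF D(1) _ D(2)] by blast
    have "Neg (y j) \<in> negate ` L" using touch l by force
    then have "tautological (C \<union> {Pos (z j)})" using t by (elim tautological_mono) auto
    then have "\<not> is_clause (insert (Pos (z j)) C)" by (simp add: is_clause_def)
    then show ?thesis using touch l LC C by (auto simp: is_clause_insert)
  next
    assume l: "l = Neg (z j)"
    have "Pos (z j) \<in> ?D \<inter> negate ` L" using touch l by force
    then have t: "tautological ((C - L) \<union> (?D - negate ` L))" using bl[OF D(1) _ D(2)] by blast
    have "Pos (z j) \<in> negate ` L" using touch l by force
    then have "tautological (C \<union> {Neg (y j)})" using t by (elim tautological_mono) auto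
    then have "\<not> is_clause (insert (Neg (y j)) C)" by (simp add: is_clause_def)
    then show ?thesis using touch l LC C by (auto simp: is_clause_insert)
  qed
qed

text \<open>For each \<open>j\<close>, \<open>V\<close> has a clause with \<open>negate l\<close>
  whose other literals are on \<open>y j\<close> and \<open>z j\<close>. If \<open>C\<close>
  mentioned neither, nothing could clash. Both polarities in \<open>V\<close> are there to cover
  either sign of \<open>l\<close>.\<close>

lemma set_blocked_ext:
  assumes bl: "set_blocked_for L C \<Delta>" and sub: "F \<subseteq> \<Delta>" and C: "is_clause C"
    and j: "j \<in> {1..m}" and touch: "l \<in> L" "lit_var l \<in> fst ` set es"
  shows "\<exists>l\<in>C. lit_var l \<in> {y j, z j}"
proof (rule ccontr)
  assume no: "\<not> ?thesis"
  have LC: "L \<subseteq> C" and bl: "\<And>D. D \<in> \<Delta> \<Longrightarrow> D \<inter> negate ` L \<noteq> {} \<Longrightarrow> D \<inter> L = {} \<Longrightarrow> tautological ((C - L) \<union> (D - negate ` L))"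
    using bl unfolding set_blocked_for_def by blast+
  let ?D = "{negate l, Pos (y j), Neg (z j)}"
  have "negate l \<notin> C" using C touch(1) LC unfolding is_clause_def tautological_def by blast
  then have "?D \<inter> L = {}" using no LC by force
  moreover have "?D \<in> \<Delta>" using sub touch(2) j unfolding subset_iff Un_iff V_iff by (metis lit_var_negate)
  moreover have "negate l \<in> ?D \<inter> negate ` L" using touch by blast
  ultimately have "tautological ((C - L) \<union> (?D - negate ` L))" using bl by blast
  moreover have "negate l \<in> negate ` L" using touch by blast
  ultimately have "tautological (insert (Pos (y j)) (insert (Neg (z j)) C))"
    by (elim tautological_mono) auto
  moreover have "Pos (y j) \<notin> C" "Neg (y j) \<notin> C" "Pos (z j) \<notin> C" "Neg (z j) \<notin> C" using no by force+
  ultimately have "\<not> is_clause (insert (Pos (y j)) (insert (Neg (z j)) C))" by (simp add: is_clause_def)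
  with C \<open>Neg (y j) \<notin> C\<close> \<open>Pos (z j) \<notin> C\<close> yz_neq[OF j j] show False by (auto simp: is_clause_insert)
qed

text \<open>All remaining variables are false. This includes the extension variables, which are
  assigned as well when the domain is \<open>- vars \<Gamma>\<close>.\<close>

definition choice :: "nat set \<Rightarrow> 'v \<Rightarrow> bool" where
  "choice b v \<longleftrightarrow> (\<exists>j\<in>b. v = y j \<or> v = z j)"

lemma choice:
  assumes "b \<subseteq> {1..m}" "j \<in> {1..m}" "v \<in> {y j, z j}"
  shows "choice b v \<longleftrightarrow> j \<in> b"
proof
  assume "choice b v"
  then obtain i where i: "i \<in> b" "v = y i \<or> v = z i" by (auto simp: choice_def)
  then have "i \<in> {1..m}" using assms(1) by auto
  then have "i = j" using i(2) assms yz_neq inj_onD[OF inj_y] inj_onD[OF inj_z] by (metis insert_iff empty_iff)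
  then show "j \<in> b" using i by simp
qed (use assms in \<open>auto simp: choice_def\<close>)

text \<open>With \<open>y j = z j\<close>, the clauses of \<open>V\<close> and
  \<open>{Neg (y j), Pos (z j)}\<close> hold, and a guarded clause is either true or shrinks to its
  member of \<open>\<Gamma>\<close>.\<close>

lemma restrict_F:
  assumes "b \<subseteq> {1..m}"
  shows "restrict (- vars \<Gamma>) (choice b) F = \<Gamma>"
proof -
  let ?U = "- vars \<Gamma>"
  have \<Gamma>: "restrict ?U (choice b) \<Gamma> = \<Gamma>" by (rule restrict_id) auto
  have guard: "sat_on ?U (choice b) C" if "j \<in> {1..m}" "(l, l') = (Pos (y j), Neg (z j)) \<or> (l, l') = (Neg (y j), Pos (z j))"
    "l \<in> C" "l' \<in> C" for C j l l'
    using choice[OF assms that(1), of "y j"] choice[OF assms that(1), of "z j"] fresh_yz[OF that(1)] that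
    unfolding sat_on_def by (cases "j \<in> b") (auto intro: bexI[of _ l] bexI[of _ l'])
  have "restrict ?U (choice b) V = {}"
  proof -
    have "sat_on ?U (choice b) C" if C: "C \<in> V" for C
    proof -
      obtain l j where "j \<in> {1..m}" "C = {l, Pos (y j), Neg (z j)}" using C unfolding V_iff by blast
      then show ?thesis using guard[of j "Pos (y j)" "Neg (z j)" C] by simp
    qed
    then show ?thesis by (auto simp: restrict_def)
  qed
  moreover have "restrict ?U (choice b) W \<subseteq> \<Gamma>"
  proof
    fix D assume "D \<in> restrict ?U (choice b) W"
    then obtain C where C: "C \<in> W" "\<not> sat_on ?U (choice b) C" "D = restr ?U C" by (auto simp: restrict_def)
    have E: "restr ?U (insert l E) = E" if "E \<in> \<Gamma>" "lit_var l \<notin> vars \<Gamma>" for l E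
      using vars_memberI[OF that(1)] that(2) by (auto simp: restr_def)
    from C(1) show "D \<in> \<Gamma>"
    proof (cases rule: W_cases)
      case (1 j)
      then show ?thesis using guard[OF 1(1), of "Neg (y j)" "Pos (z j)" C] C(2) by auto
    next
      case (2 j E)
      then show ?thesis using E[OF 2(2), of "Pos (y j)"] fresh_yz[OF 2(1)] C(3) by simp
    next
      case (3 j E)
      then show ?thesis using E[OF 3(2), of "Neg (z j)"] fresh_yz[OF 3(1)] C(3) by simp
    qed
  qed
  ultimately show ?thesis using \<Gamma> by (auto simp: restrict_Un)
qed

text \<open>A clause that mentions \<open>y j\<close> or \<open>z j\<close> for all \<open>j\<close> fails for at most one of the
  \<open>2 ^ m\<close> choices, so a short proof leaves a choice that satisfies all such clauses.\<close>

lemma good_choice: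
  assumes "finite S" "card S < 2 ^ m"
    and wide: "\<And>C j. C \<in> S \<Longrightarrow> j \<in> {1..m} \<Longrightarrow> \<exists>l\<in>C. lit_var l \<in> {y j, z j}"
  obtains b where "b \<subseteq> {1..m}" "\<And>C. C \<in> S \<Longrightarrow> sat_on (- vars \<Gamma>) (choice b) C"
proof -
  let ?U = "- vars \<Gamma>"
  define bad where "bad = {b \<in> Pow {1..m}. \<exists>C\<in>S. \<not> sat_on ?U (choice b) C}"
  define f where "f b = (SOME C. C \<in> S \<and> \<not> sat_on ?U (choice b) C)" for b
  have f: "f b \<in> S \<and> \<not> sat_on ?U (choice b) (f b)" if "b \<in> bad" for b
  proof -
    have "\<exists>C. C \<in> S \<and> \<not> sat_on ?U (choice b) C" using that unfolding bad_def by blast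
    then show ?thesis unfolding f_def by (rule someI_ex)
  qed
  have "inj_on f bad"
  proof (rule inj_onI)
    fix b b' assume b: "b \<in> bad" "b' \<in> bad" "f b = f b'"
    have sub: "b \<subseteq> {1..m}" "b' \<subseteq> {1..m}" using b by (auto simp: bad_def)
    have "(j \<in> b) = (j \<in> b')" if j: "j \<in> {1..m}" for j
    proof -
      obtain l where l: "l \<in> f b" "lit_var l \<in> {y j, z j}" using wide[OF _ j] f[OF b(1)] by blast
      have "lit_var l \<in> ?U" using l(2) fresh_yz[OF j] by auto
      then have "\<not> holds (choice b) l" "\<not> holds (choice b') l"
        using f[OF b(1)] f[OF b(2)] l(1) b(3) unfolding sat_on_def by auto
      then have "choice b (lit_var l) = choice b' (lit_var l)" by (cases l) auto
      then show ?thesis using choice[OF sub(1) j l(2)] choice[OF sub(2) j l(2)] by simp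
    qed
    then show "b = b'" using sub by blast
  qed
  moreover have "f ` bad \<subseteq> S" using f by blast
  ultimately have "card bad \<le> card S" using card_inj_on_le assms(1) by blast
  then have "card bad < card (Pow {1..m})" using assms(2) by (simp add: card_Pow)
  moreover have "bad \<subseteq> Pow {1..m}" by (auto simp: bad_def)
  ultimately obtain b where "b \<in> Pow {1..m}" "b \<notin> bad" by (metis psubsetI nless_le subsetI subset_antisym)
  then show ?thesis using that[of b] unfolding bad_def by blast
qed

lemma sbc_minus_restrict:
  assumes unsat: "unsatisfiable \<Gamma>" and \<Pi>: "sbc_minus_proof F \<Pi>" and short: "length \<Pi> \<le> 2 ^ m"
  shows "\<exists>\<Pi>'. sbc_minus_proof \<Gamma> \<Pi>' \<and> length \<Pi>' \<le> length \<Pi>"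
proof -
  obtain n where n: "length \<Pi> = Suc n" "steps sbc_derivable n F (last \<Pi>)" "{} \<in> last \<Pi>"
    using \<Pi> steps_of_proof unfolding sbc_minus_proof_def by metis
  have "\<Pi> \<noteq> []" using n(1) by auto
  then have lv: "vars (last \<Pi>) \<subseteq> vars F"
    using \<Pi> unfolding sbc_minus_proof_def proof_vars_def by (auto intro: last_in_set)
  \<comment> \<open>The at most \<open>length \<Pi> - 1\<close> added clauses leave
    \<open>card S\<close> strictly below \<open>2 ^ m\<close>.\<close>
  define S where "S = {C \<in> last \<Pi> - F. \<forall>j\<in>{1..m}. \<exists>l\<in>C. lit_var l \<in> {y j, z j}}"
  have "S \<subseteq> last \<Pi> - F" by (auto simp: S_def)
  then have "finite S" "card S \<le> n"
    using steps_card[OF n(2)] by (auto intro: finite_subset le_trans[OF card_mono])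
  then obtain b where b: "b \<subseteq> {1..m}" "\<And>C. C \<in> S \<Longrightarrow> sat_on (- vars \<Gamma>) (choice b) C"
    using good_choice[of S] short n(1) unfolding S_def by auto
  let ?R = "restrict (- vars \<Gamma>) (choice b)"
  have "(\<forall>C\<in>\<Delta>. finite C) \<and> (\<exists>n'\<le>i. steps sbc_derivable n' \<Gamma> (?R \<Delta>))"
    if "steps sbc_derivable i F \<Delta>" "\<Delta> \<subseteq> last \<Pi>" for i \<Delta>
    using that
  proof (induction i F \<Delta> rule: steps.induct)
    case refl
    have "\<forall>C\<in>F. finite C"
      using formula by (auto simp: is_formula_def is_clause_def V_iff elim!: W_cases)
    then show ?case using restrict_F[OF b(1)] by (auto intro: steps.refl)
  next
    case (step i \<Delta> C)
    then obtain n' where n': "n' \<le> i" "steps sbc_derivable n' \<Gamma> (?R \<Delta>)" and fin: "\<forall>C\<in>\<Delta>. finite C" by auto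
    have FD: "F \<subseteq> \<Delta>" by (rule steps_subset[OF step.hyps(1)])
    have finC: "finite C"
      using step.hyps(3) res_derivable_finite[OF _ fin] unfolding sbc_derivable_def is_clause_def by blast
    have "\<exists>n'\<le>Suc i. steps sbc_derivable n' \<Gamma> (?R (insert C \<Delta>))"
    \<comment> \<open>A repeated clause is set aside because it could belong to \<open>F\<close>,
      which \<open>S\<close> leaves out.\<close>
    proof (cases "sat_on (- vars \<Gamma>) (choice b) C \<or> C \<in> \<Delta>")
      case True
      then have "?R (insert C \<Delta>) = ?R \<Delta>" by (auto simp: restrict_insert insert_absorb restrictI)
      then show ?thesis using n' by (intro exI[of _ n']) auto
    next
      case False
      then have ns: "\<not> sat_on (- vars \<Gamma>) (choice b) C" and new: "C \<in> last \<Pi> - F"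
        using FD step.prems by auto
      have "sbc_derivable (?R \<Delta>) (restr (- vars \<Gamma>) C)"
      proof (cases "res_derivable \<Delta> C")
        case True
        then show ?thesis using res_derivable_restrict[OF True ns fin] unfolding sbc_derivable_def by blast
      next
        case False
        then obtain L where C: "is_clause C" and L: "set_blocked_for L C \<Delta>"
          using step.hyps(3) unfolding sbc_derivable_def by blast
        \<comment> \<open>The condition under which blockedness survives: \<open>L\<close> avoids
          the assigned variables, as otherwise \<open>C\<close> would be satisfied.\<close>
        have "lit_var l \<in> vars \<Gamma>" if l: "l \<in> L" for l
        proof (rule ccontr)
          assume nl: "lit_var l \<notin> vars \<Gamma>"
          have "l \<in> C" using L l unfolding set_blocked_for_def by blast
          then have "lit_var l \<in> vars F" using vars_memberI[of C "last \<Pi>"] new lv by blast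
          then have "lit_var l \<in> fst ` set es \<union> y ` {1..m} \<union> z ` {1..m}"
            using nl vars_V vars_W unfolding vars_Un by blast
          then consider j where "j \<in> {1..m}" "lit_var l \<in> {y j, z j}" | "lit_var l \<in> fst ` set es"
            by blast
          then show False
          proof cases
            case (1 j)
            have "Pos (y j) \<in> C" "Neg (z j) \<in> C"
              using set_blocked_guard[OF L FD C unsat 1(1) l 1(2)] by auto
            then show False
              using ns choice[OF b(1) 1(1), of "y j"] choice[OF b(1) 1(1), of "z j"] fresh_yz[OF 1(1)]
              unfolding sat_on_def by force
          next
            case 2
            then have "C \<in> S" using set_blocked_ext[OF L FD C _ l 2] new unfolding S_def by blast
            then show False using b(2) ns by blast
          qed
        qed
        then have "set_blocked_for L (restr (- vars \<Gamma>) C) (?R \<Delta>)"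
          by (intro set_blocked_for_restrict[OF L ns]) auto
        then show ?thesis using is_clause_subset[OF C restr_subset] unfolding sbc_derivable_def by blast
      qed
      then have "steps sbc_derivable (Suc n') \<Gamma> (?R (insert C \<Delta>))"
        using steps.step[OF n'(2)] ns by (simp add: restrict_insert)
      then show ?thesis using n'(1) by (intro exI[of _ "Suc n'"]) simp
    qed
    then show ?case using fin finC by blast
  qed
  from this[OF n(2) order_refl] obtain n' where n': "n' \<le> n" "steps sbc_derivable n' \<Gamma> (?R (last \<Pi>))"
    by blast
  obtain \<Pi>' where \<Pi>': "sbc_proof \<Gamma> \<Pi>'" "length \<Pi>' = Suc n'" "proof_vars \<Pi>' \<subseteq> vars (?R (last \<Pi>))"
    using proof_of_steps_bot[OF n'(2) empty_in_restrict[OF n(3)]] by metis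
  have "proof_vars \<Pi>' \<subseteq> vars \<Gamma>" using \<Pi>'(3) vars_restrict[of "- vars \<Gamma>" "choice b" "last \<Pi>"] by auto
  then show ?thesis using \<Pi>'(1,2) n' n(1) unfolding sbc_minus_proof_def by (intro exI[of _ \<Pi>']) auto
qed

end

section \<open>The lower bound for the bit pigeonhole principle\<close>

definition pigeon :: "nat literal \<Rightarrow> nat" where
  "pigeon l = fst (prod_decode (lit_var l))"

text \<open>A hole is the set of its bits with value 1. \<open>\<mu>\<close> is total, but only its
  values at the pigeons under consideration matter.\<close>

definition matching_assignment :: "(nat \<Rightarrow> nat set) \<Rightarrow> nat \<Rightarrow> bool" where
  "matching_assignment \<mu> v \<longleftrightarrow> snd (prod_decode v) \<in> \<mu> (fst (prod_decode v))"

lemma matching_assignment_bphp_var [simp]: "matching_assignment \<mu> (bphp_var x l) \<longleftrightarrow> l \<in> \<mu> x"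
  by (simp add: matching_assignment_def bphp_var_def)

lemma pigeon_simps [simp]: "pigeon (negate l) = pigeon l" "pigeon (bit_differs x i b) = x"
  "pigeon (Pos (bphp_var x i)) = x" "pigeon (Neg (bphp_var x i)) = x"
  by (simp_all add: pigeon_def) (simp_all add: bphp_var_def)

lemma holds_matching_cong:
  "\<mu> (pigeon l) = \<mu>' (pigeon l) \<Longrightarrow> holds (matching_assignment \<mu>) l = holds (matching_assignment \<mu>') l"
  by (rule holds_cong) (simp add: matching_assignment_def pigeon_def)

lemma literal_bphp:
  assumes "k \<ge> 1" "lit_var l \<in> vars (bphp_pow k)"
  obtains i where "i \<in> {1..k}" "lit_var l = bphp_var (pigeon l) i" "pigeon l \<in> {1..2 ^ k + 1}"
proof -
  obtain x i where xi: "x \<in> {1..2 ^ k + 1}" "i \<in> {1..k}" "lit_var l = bphp_var x i"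
    using assms(2) unfolding vars_bphp_pow[OF assms(1)] by blast
  then have "pigeon l = x" by (simp add: pigeon_def bphp_var_def)
  then show ?thesis using that xi by blast
qed

lemma set_blocked_pigeons:
  assumes k: "k \<ge> 1" and sub: "bphp_pow k \<subseteq> \<Delta>" and C: "is_clause C" "lit_var ` C \<subseteq> vars (bphp_pow k)"
    and bl: "set_blocked_for L C \<Delta>"
  shows "pigeon ` C = {1..2 ^ k + 1}"
proof
  show "pigeon ` C \<subseteq> {1..2 ^ k + 1}"
  proof
    fix x assume "x \<in> pigeon ` C"
    then obtain l where "l \<in> C" "x = pigeon l" by blast
    then show "x \<in> {1..2 ^ k + 1}" using literal_bphp[OF k, of l] C(2) by blast
  qed
  show "{1..2 ^ k + 1} \<subseteq> pigeon ` C"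
  proof (rule subsetI, rule ccontr)
    fix y assume y: "y \<in> {1..2 ^ k + 1}" "y \<notin> pigeon ` C"
    have nC: "negate l \<notin> C" if "l \<in> C" for l using C that unfolding is_clause_def tautological_def by blast
    have L: "L \<noteq> {}" "L \<subseteq> C"
      and bl: "\<And>D. D \<in> \<Delta> \<Longrightarrow> D \<inter> negate ` L \<noteq> {} \<Longrightarrow> D \<inter> L = {} \<Longrightarrow> tautological ((C - L) \<union> (D - negate ` L))"
      using bl unfolding set_blocked_for_def by blast+
    obtain l0 where l0: "l0 \<in> L" using L by blast
    define x where "x = pigeon l0"
    have "lit_var l0 \<in> vars (bphp_pow k)" using l0 L C by blast
    then obtain i where i: "i \<in> {1..k}" "lit_var l0 = bphp_var x i" "x \<in> {1..2 ^ k + 1}"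
      unfolding x_def by (rule literal_bphp[OF k])
    have "x \<noteq> y" using y(2) l0 L unfolding x_def by blast
    \<comment> \<open>The hole of \<open>x\<close> that makes \<open>L\<close> true and
      \<open>C - L\<close> false, with undetermined bits 0; the literals \<open>d l\<close> are
      those false at this hole.\<close>
    define h where "h = (\<lambda>l. Pos (bphp_var x l) \<in> L \<or> Neg (bphp_var x l) \<in> C - L)"
    define d where "d = (\<lambda>l. bit_differs x l (h l))"
    have nP: "Neg v \<notin> C" if "Pos v \<in> C" for v using nC[OF that] by simp
    have dL: "d l \<notin> L" for l
      using nP[of "bphp_var x l"] L(2) unfolding d_def bit_differs_def h_def by auto
    have dC: "negate (d l) \<notin> C - L" for l
      using nP[of "bphp_var x l"] L(2) unfolding d_def bit_differs_def h_def by auto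
    have d0: "d i = negate l0"
      using nP[of "bphp_var x i"] L(2) l0 i(2) unfolding d_def bit_differs_def h_def by (cases l0) auto
    let ?D = "bphp_block k x h \<union> bphp_block k y h"
    have D\<Delta>: "?D \<in> bphp_pow k" using bphp_powI[OF i(3) y(1) \<open>x \<noteq> y\<close>] .
    have Dx: "bphp_block k x h = d ` {1..k}" by (simp add: bphp_block_def d_def)
    have Dy: "e \<notin> C" "negate e \<notin> C" if "e \<in> bphp_block k y h" for e
    proof -
      have "pigeon e = y" "pigeon (negate e) = y" using that by (auto simp: bphp_block_def)
      then show "e \<notin> C" "negate e \<notin> C"
        using y(2) imageI[of e C pigeon] imageI[of "negate e" C pigeon] by auto
    qed
    have "d i \<in> ?D" using i(1) unfolding Dx by blast
    moreover have "d i \<in> negate ` L" using d0 l0 by blast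
    ultimately have "d i \<in> ?D \<inter> negate ` L" by blast
    moreover have "?D \<inter> L = {}" using dL Dy L(2) unfolding Dx by blast
    ultimately have "tautological ((C - L) \<union> (?D - negate ` L))" using bl[of ?D] D\<Delta> sub by blast
    then obtain l where l: "l \<in> (C - L) \<union> ?D" "negate l \<in> (C - L) \<union> ?D"
      unfolding tautological_def by blast
    have "\<not> (l \<in> ?D \<and> negate l \<in> ?D)"
      using is_formula_bphp_pow[of k] D\<Delta> unfolding is_formula_def is_clause_def tautological_def by blast
    moreover have no: "negate e \<notin> C - L" if "e \<in> ?D" for e using that dC Dy unfolding Dx by blast
    ultimately show False using l nC[of l] no[of l] no[of "negate l"] by auto
  qed
qed

definition matched :: "nat set \<Rightarrow> (nat \<Rightarrow> nat set) \<Rightarrow> nat literal set \<Rightarrow> bool" where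
  "matched R \<rho> C \<longleftrightarrow> (\<exists>l\<in>C. pigeon l \<in> R \<and> holds (matching_assignment \<rho>) l)"

text \<open>A wide clause is satisfied already by the partial matching \<open>\<rho>\<close>; for the remaining clauses
  there is a hole left for the pigeon that the resolution step queries.\<close>

lemma matching_invariant:
  assumes k: "k \<ge> 1" and steps: "steps sbc_derivable n (bphp_pow k) \<Delta>" and sub: "\<Delta> \<subseteq> \<Theta>"
    and vars: "vars \<Theta> \<subseteq> vars (bphp_pow k)" and R: "finite R"
    and wide: "\<forall>C\<in>\<Theta> - bphp_pow k. 2 ^ k \<le> card (pigeon ` C) + card R \<longrightarrow> matched R \<rho> C"
  shows "\<forall>C\<in>\<Delta>. finite C \<and> (\<forall>\<mu>. inj_on \<mu> (R \<union> pigeon ` C) \<longrightarrow> \<mu> ` (R \<union> pigeon ` C) \<subseteq> Pow {1..k} \<longrightarrow>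
    (\<forall>x\<in>R. \<mu> x = \<rho> x) \<longrightarrow> (\<exists>l\<in>C. holds (matching_assignment \<mu>) l))"
proof -
  \<comment> \<open>\<open>\<mu>\<close> extends \<open>\<rho>\<close> and is injective only on
    \<open>R\<close> and the pigeons of \<open>C\<close>. It is unconstrained elsewhere, which
    leaves room to reassign a queried pigeon.\<close>
  define good where "good C \<mu> \<longleftrightarrow> inj_on \<mu> (R \<union> pigeon ` C) \<and> \<mu> ` (R \<union> pigeon ` C) \<subseteq> Pow {1..k} \<and>
    (\<forall>x\<in>R. \<mu> x = \<rho> x)" for C :: "nat literal set" and \<mu>
  define ok where "ok C \<longleftrightarrow> finite C \<and> (\<forall>\<mu>. good C \<mu> \<longrightarrow> (\<exists>l\<in>C. holds (matching_assignment \<mu>) l))" for C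
  have good_mono: "good A \<mu>" if "good C \<mu>" "pigeon ` A \<subseteq> R \<union> pigeon ` C" for A C \<mu>
    using that unfolding good_def by (auto intro: inj_on_subset)
  have init: "ok C" if "C \<in> bphp_pow k" for C
  proof -
    obtain x y h where C: "C = bphp_block k x h \<union> bphp_block k y h" "x \<noteq> y"
      using \<open>C \<in> bphp_pow k\<close> unfolding bphp_pow_eq by blast
    have pig: "x \<in> pigeon ` C" "y \<in> pigeon ` C"
      using C k by (auto simp: bphp_block_def image_Un image_image)
    have "\<exists>l\<in>C. holds (matching_assignment \<mu>) l" if g: "good C \<mu>" for \<mu>
    proof (rule ccontr)
      assume "\<not> ?thesis"
      then have no: "\<And>l. l \<in> C \<Longrightarrow> \<not> holds (matching_assignment \<mu>) l" by blast
      have "l \<in> \<mu> x \<longleftrightarrow> l \<in> \<mu> y" if "l \<in> {1..k}" for l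
      proof -
        have "bit_differs x l (h l) \<in> C" "bit_differs y l (h l) \<in> C"
          using that unfolding C bphp_block_def by blast+
        from no[OF this(1)] no[OF this(2)] show ?thesis by simp
      qed
      moreover have "\<mu> x \<subseteq> {1..k}" "\<mu> y \<subseteq> {1..k}" using g pig unfolding good_def by blast+
      ultimately have "\<mu> x = \<mu> y" by blast
      moreover have "inj_on \<mu> (R \<union> pigeon ` C)" using g unfolding good_def by (elim conjE)
      ultimately show False using pig C(2) by (auto dest: inj_onD)
    qed
    moreover have "finite C" using C by (simp add: bphp_block_def)
    ultimately show ?thesis unfolding ok_def by blast
  qed
  have "\<forall>C\<in>\<Delta>. ok C"
    using steps sub
  proof (induction "bphp_pow k" \<Delta> rule: steps.induct)
    case refl
    then show ?case using init by blast
  next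
    case (step n \<Delta> C)
    have IH: "\<And>A. A \<in> \<Delta> \<Longrightarrow> ok A" using step by blast
    have der: "sbc_derivable \<Delta> C" and C\<Theta>: "C \<in> \<Theta>" using step by auto
    have sub\<Delta>: "bphp_pow k \<subseteq> \<Delta>" using steps_subset step by blast
    have fin: "finite C"
      using der res_derivable_finite[of \<Delta> C] IH unfolding sbc_derivable_def is_clause_def ok_def by blast
    have lv: "lit_var ` C \<subseteq> vars (bphp_pow k)" using C\<Theta> vars by (auto simp: vars_def)
    have "ok C"
    proof (cases "C \<in> bphp_pow k \<or> 2 ^ k > card (pigeon ` C) + card R")
      case False
      then obtain l where l: "l \<in> C" "pigeon l \<in> R" "holds (matching_assignment \<rho>) l"
        using bspec[OF wide, of C] C\<Theta> unfolding matched_def by auto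
      have "holds (matching_assignment \<mu>) l" if "good C \<mu>" for \<mu>
        using l holds_matching_cong[of \<mu> l \<rho>] that unfolding good_def by blast
      then show ?thesis using fin l(1) unfolding ok_def by blast
    next
      case True
      show ?thesis
      proof (cases "C \<in> bphp_pow k")
        case True
        then show ?thesis by (rule init)
      next
        case new: False
        then have narrow: "card (pigeon ` C) + card R < 2 ^ k" using True by blast
        \<comment> \<open>A set-blocked clause mentions all \<open>2 ^ k + 1\<close> pigeons, hence
          is not narrow.\<close>
        have "\<not> (is_clause C \<and> (\<exists>L. set_blocked_for L C \<Delta>))"
          using set_blocked_pigeons[OF k sub\<Delta> _ lv] narrow by fastforce
        then have res: "res_derivable \<Delta> C" using der unfolding sbc_derivable_def by blast
        have "\<exists>l\<in>C. holds (matching_assignment \<mu>) l" if g: "good C \<mu>" for \<mu>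
        proof -
          from res consider (res) A B where "A \<in> \<Delta>" "B \<in> \<Delta>" "resolvent A B C"
            | (weak) A where "A \<in> \<Delta>" "A \<subseteq> C"
            unfolding res_derivable_def by blast
          then show ?thesis
          proof cases
            case weak
            have "good A \<mu>" using weak(2) by (intro good_mono[OF g]) auto
            then show ?thesis using IH[OF weak(1)] weak(2) unfolding ok_def by blast
          next
            case res
            then obtain v C1 D1 where r: "A = C1 \<union> {Pos v}" "B = D1 \<union> {Neg v}" "C = C1 \<union> D1"
              unfolding resolvent_def by blast
            define x where "x = pigeon (Pos v)"
            have xB: "pigeon (Neg v) = x" by (simp add: x_def pigeon_def)
            \<comment> \<open>If \<open>x\<close> is in \<open>R\<close> or in \<open>C\<close>,
              \<open>\<mu>\<close> serves both premises as it is. Otherwise changing it at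
              \<open>x\<close> leaves all literals of \<open>C\<close> untouched.\<close>
            obtain \<mu>' where \<mu>': "good A \<mu>'" "good B \<mu>'" "\<And>l. l \<in> C \<Longrightarrow> \<mu>' (pigeon l) = \<mu> (pigeon l)"
            proof (cases "x \<in> R \<union> pigeon ` C")
              case True
              have "good A \<mu>" "good B \<mu>"
                by (rule good_mono[OF g]; use True r xB in \<open>auto simp: x_def\<close>)+
              then show ?thesis using that by blast
            next
              case False
              have fin': "finite (R \<union> pigeon ` C)" using R fin by simp
              have "card (\<mu> ` (R \<union> pigeon ` C)) \<le> card (R \<union> pigeon ` C)" by (rule card_image_le[OF fin'])
              also have "\<dots> \<le> card R + card (pigeon ` C)" by (rule card_Un_le)
              also have "\<dots> < card (Pow {1..k})" using narrow by (simp add: card_Pow)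
              finally have "\<mu> ` (R \<union> pigeon ` C) \<noteq> Pow {1..k}" by auto
              moreover have "\<mu> ` (R \<union> pigeon ` C) \<subseteq> Pow {1..k}" using g unfolding good_def by (elim conjE)
              ultimately have "\<mu> ` (R \<union> pigeon ` C) \<subset> Pow {1..k}" by (rule psubsetI[rotated])
              from psubset_imp_ex_mem[OF this]
              obtain h where h: "h \<in> Pow {1..k}" "h \<notin> \<mu> ` (R \<union> pigeon ` C)" by (elim exE DiffE)
              have inj: "inj_on (\<mu>(x := h)) (insert x (R \<union> pigeon ` C))"
                using g h(2) False unfolding good_def by (auto simp: inj_on_def)
              have "(\<mu>(x := h)) ` (R \<union> pigeon ` C) = \<mu> ` (R \<union> pigeon ` C)"
                using False by (intro image_cong refl) auto
              then have img: "(\<mu>(x := h)) ` insert x (R \<union> pigeon ` C) \<subseteq> Pow {1..k}"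
                using g h(1) unfolding good_def by (simp only: image_insert fun_upd_same insert_subset simp_thms)
              have "good E (\<mu>(x := h))" if E: "pigeon ` E \<subseteq> insert x (pigeon ` C)" for E
              proof -
                have "R \<union> pigeon ` E \<subseteq> insert x (R \<union> pigeon ` C)" using E by blast
                from inj_on_subset[OF inj this] order_trans[OF image_mono[OF this] img]
                show ?thesis using g False unfolding good_def by auto
              qed
              moreover have "pigeon ` A \<subseteq> insert x (pigeon ` C)" "pigeon ` B \<subseteq> insert x (pigeon ` C)"
                using r xB x_def by auto
              ultimately have "good A (\<mu>(x := h))" "good B (\<mu>(x := h))" by blast+
              moreover have "(\<mu>(x := h)) (pigeon l) = \<mu> (pigeon l)" if "l \<in> C" for l
                using that False by auto
              ultimately show ?thesis using that by blast
            qed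
            obtain a b where "a \<in> A" "holds (matching_assignment \<mu>') a" "b \<in> B" "holds (matching_assignment \<mu>') b"
              using IH[OF res(1)] IH[OF res(2)] \<mu>'(1,2) unfolding ok_def by blast
            then obtain l where l: "l \<in> C" "holds (matching_assignment \<mu>') l" using r by auto
            then show ?thesis using holds_matching_cong[of \<mu>' l \<mu>] \<mu>'(3)[OF l(1)] by blast
          qed
        qed
        then show ?thesis using fin unfolding ok_def by blast
      qed
    qed
    then show ?case using IH by blast
  qed
  then show ?thesis unfolding ok_def good_def by blast
qed

section \<open>Greedy choice of the partial matching\<close>

lemma card_half_holes:
  assumes "i \<in> {1..k}"
  shows "2 * card {h \<in> Pow {1..k}. (i \<in> h) = b} = 2 ^ k"
proof -
  have "{h \<in> Pow {1..k}. i \<notin> h} = Pow ({1..k} - {i})" by auto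
  moreover have "k = Suc (k - 1)" using assms by simp
  then have "(2::nat) ^ k = 2 * 2 ^ (k - 1)" by (metis power_Suc)
  ultimately have out: "2 * card {h \<in> Pow {1..k}. i \<notin> h} = 2 ^ k"
    using assms by (simp add: card_Pow)
  have "card (Pow {1..k}) = card {h \<in> Pow {1..k}. i \<in> h} + card {h \<in> Pow {1..k}. i \<notin> h}"
    by (subst card_Un_disjoint[symmetric]) (auto intro: arg_cong[where f = card])
  then show ?thesis using out by (cases b) (simp_all add: card_Pow)
qed

text \<open>\<open>C\<close> has at least \<open>3 * r\<close> pigeons, and \<open>2 * r\<close> of
  the holes satisfy a given literal. With fewer than \<open>r\<close> pigeons and fewer than
  \<open>r\<close> holes used up, at least \<open>2 * r\<close> pigeons remain with \<open>r\<close>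
  holes each.\<close>

lemma card_hitting_pairs:
  assumes r: "2 ^ k = 4 * r" "r \<ge> 1" and k: "k \<ge> 1"
    and C: "lit_var ` C \<subseteq> vars (bphp_pow k)" "2 ^ k \<le> card (pigeon ` C) + r" "finite C"
    and R: "finite R" "card R < r" "finite Q" "card Q < r"
  shows "2 * r * r \<le> card {(x, h). x \<in> {1..2 ^ k + 1} - R \<and> h \<in> Pow {1..k} - Q \<and> matched {x} (\<lambda>_. h) C}"
proof -
  let ?H = "\<lambda>x. {h \<in> Pow {1..k} - Q. matched {x} (\<lambda>_. h) C}"
  have "r \<le> card (?H x)" if x: "x \<in> pigeon ` C" for x
  proof -
    obtain l where l: "l \<in> C" "x = pigeon l" using x by blast
    then have "lit_var l \<in> vars (bphp_pow k)" using C by blast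
    then obtain i where i: "i \<in> {1..k}" "lit_var l = bphp_var x i" unfolding l(2) by (rule literal_bphp[OF k])
    define b where "b = (l = Pos (bphp_var x i))"
    have "holds (matching_assignment (\<lambda>_. h)) l \<longleftrightarrow> (i \<in> h) = b" for h
      using i(2) by (cases l) (auto simp: b_def)
    then have "{h \<in> Pow {1..k}. (i \<in> h) = b} - Q \<subseteq> ?H x"
      using l unfolding matched_def by blast
    then have "card ({h \<in> Pow {1..k}. (i \<in> h) = b} - Q) \<le> card (?H x)" by (intro card_mono) auto
    moreover have "card {h \<in> Pow {1..k}. (i \<in> h) = b} - card Q \<le> card ({h \<in> Pow {1..k}. (i \<in> h) = b} - Q)"
      by (rule diff_card_le_card_Diff[OF R(3)])
    ultimately show ?thesis using card_half_holes[OF i(1), of b] r R(4) by linarith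
  qed
  then have "(\<Sum>x\<in>pigeon ` C - R. r) \<le> (\<Sum>x\<in>pigeon ` C - R. card (?H x))" by (intro sum_mono) auto
  also have "\<dots> = card (SIGMA x:pigeon ` C - R. ?H x)" using C(3) by (subst card_SigmaI) auto
  also have "\<dots> \<le> card {(x, h). x \<in> {1..2 ^ k + 1} - R \<and> h \<in> Pow {1..k} - Q \<and> matched {x} (\<lambda>_. h) C}" (is "_ \<le> card ?A")
  proof (rule card_mono)
    show "finite ?A" by (rule finite_subset[of _ "{1..2 ^ k + 1} \<times> Pow {1..k}"]) auto
    have "pigeon ` C \<subseteq> {1..2 ^ k + 1}" using C(1) literal_bphp[OF k] by blast
    then show "(SIGMA x:pigeon ` C - R. ?H x) \<subseteq> ?A" by blast
  qed
  finally have "card (pigeon ` C - R) * r \<le> card ?A" by simp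
  moreover have "card (pigeon ` C) - card R \<le> card (pigeon ` C - R)" by (rule diff_card_le_card_Diff[OF R(1)])
  then have "2 * r \<le> card (pigeon ` C - R)" using C(2) r R(2) by linarith
  then have "2 * r * r \<le> card (pigeon ` C - R) * r" by (rule mult_le_mono1)
  ultimately show ?thesis by linarith
qed

text \<open>The matching is built greedily: by averaging, some pair of a free pigeon and a free hole
  satisfies a tenth of the wide clauses that are left.\<close>

lemma greedy_matching:
  assumes r: "2 ^ k = 4 * r" "r \<ge> 1" and k: "k \<ge> 1" and S: "finite S"
    and C: "\<And>C. C \<in> S \<Longrightarrow> lit_var ` C \<subseteq> vars (bphp_pow k) \<and> 2 ^ k \<le> card (pigeon ` C) + r \<and> finite C"
    and t: "t \<le> r"
  shows "\<exists>R \<rho>. finite R \<and> card R = t \<and> inj_on \<rho> R \<and> \<rho> ` R \<subseteq> Pow {1..k} \<and>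
    10 ^ t * card {C \<in> S. \<not> matched R \<rho> C} \<le> 9 ^ t * card S"
  using t
proof (induction t)
  case 0
  have "{C \<in> S. \<not> matched {} \<rho> C} = S" for \<rho> by (auto simp: matched_def)
  then show ?case by (intro exI[of _ "{}"]) auto
next
  case (Suc t)
  then obtain R \<rho> where R: "finite R" "card R = t" "inj_on \<rho> R" "\<rho> ` R \<subseteq> Pow {1..k}"
    and IH: "10 ^ t * card {C \<in> S. \<not> matched R \<rho> C} \<le> 9 ^ t * card S" by auto
  define U where "U = {C \<in> S. \<not> matched R \<rho> C}"
  define A where "A = ({1..2 ^ k + 1} - R) \<times> (Pow {1..k} - \<rho> ` R)"
  have fin: "finite U" "finite A" using S by (auto simp: U_def A_def)
  have cR: "card (\<rho> ` R) < r" "card R < r" using Suc.prems R(2) card_image_le[OF R(1), of \<rho>] by auto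
  have "card A \<le> card ({1..2 ^ k + (1::nat)} \<times> Pow {1..k})" unfolding A_def by (intro card_mono) auto
  also have "\<dots> = (4 * r + 1) * (4 * r)" using r(1) by (simp add: card_cartesian_product card_Pow)
  also have "\<dots> \<le> (4 * r + r) * (4 * r)" using r(2) by (intro mult_le_mono1) simp
  finally have cA: "card A \<le> 20 * r * r" by simp
  have neA: "A \<noteq> {}"
  proof -
    have "card R < card {1..2 ^ k + (1::nat)}" using cR(2) r(1) by simp
    then have "\<not> {1..2 ^ k + 1} \<subseteq> R" using card_mono[OF R(1)] by (meson leD)
    moreover have "card (\<rho> ` R) < card (Pow {1..k})" using cR(1) r by (simp add: card_Pow)
    then have "\<not> Pow {1..k} \<subseteq> \<rho> ` R" using card_mono[of "\<rho> ` R"] R(1) by (meson finite_imageI leD)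
    ultimately show ?thesis unfolding A_def by auto
  qed
  have dc: "(\<Sum>C\<in>U. card {a \<in> A. matched {fst a} (\<lambda>_. snd a) C}) = (\<Sum>a\<in>A. card {C \<in> U. matched {fst a} (\<lambda>_. snd a) C})"
    by (rule sum_multicount_gen[symmetric, OF fin(2,1)]) simp
  have "\<exists>a\<in>A. card U \<le> 10 * card {C \<in> U. matched {fst a} (\<lambda>_. snd a) C}"
  proof (rule ccontr)
    assume "\<not> ?thesis"
    then have "(\<Sum>a\<in>A. 10 * card {C \<in> U. matched {fst a} (\<lambda>_. snd a) C}) < (\<Sum>a\<in>A. card U)"
      using fin(2) neA by (intro sum_strict_mono) auto
    also have "\<dots> = card A * card U" by simp
    also have "\<dots> \<le> 20 * r * r * card U" by (rule mult_le_mono1[OF cA])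
    also have "\<dots> = 10 * (\<Sum>C\<in>U. 2 * r * r)" by simp
    also have "\<dots> \<le> 10 * (\<Sum>C\<in>U. card {a \<in> A. matched {fst a} (\<lambda>_. snd a) C})"
    proof (intro mult_le_mono2 sum_mono)
      fix D assume "D \<in> U"
      then have "D \<in> S" by (simp add: U_def)
      then have "2 * r * r \<le> card {(x, h). x \<in> {1..2 ^ k + 1} - R \<and> h \<in> Pow {1..k} - \<rho> ` R \<and> matched {x} (\<lambda>_. h) D}"
        using C[of D] R(1) cR by (intro card_hitting_pairs[OF r k]) auto
      also have "{(x, h). x \<in> {1..2 ^ k + 1} - R \<and> h \<in> Pow {1..k} - \<rho> ` R \<and> matched {x} (\<lambda>_. h) D}
          = {a \<in> A. matched {fst a} (\<lambda>_. snd a) D}"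
        unfolding A_def by auto
      finally show "2 * r * r \<le> card {a \<in> A. matched {fst a} (\<lambda>_. snd a) D}" .
    qed
    also have "\<dots> = (\<Sum>a\<in>A. 10 * card {C \<in> U. matched {fst a} (\<lambda>_. snd a) C})"
      unfolding dc by (simp add: sum_distrib_left)
    finally show False by simp
  qed
  then obtain x h where xh: "x \<in> {1..2 ^ k + 1} - R" "h \<in> Pow {1..k} - \<rho> ` R"
    and hit: "card U \<le> 10 * card {C \<in> U. matched {x} (\<lambda>_. h) C}" unfolding A_def by auto
  let ?R = "insert x R" and ?\<rho> = "\<rho>(x := h)"
  have "{C \<in> S. \<not> matched ?R ?\<rho> C} \<subseteq> U - {C \<in> U. matched {x} (\<lambda>_. h) C}"
  proof -
    have "matched ?R ?\<rho> D" if "matched R \<rho> D \<or> matched {x} (\<lambda>_. h) D" for D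
    proof -
      from that obtain l where "l \<in> D"
        "pigeon l \<in> R \<and> holds (matching_assignment \<rho>) l \<or> pigeon l = x \<and> holds (matching_assignment (\<lambda>_. h)) l"
        unfolding matched_def by blast
      then show ?thesis
        using xh(1) holds_matching_cong[of ?\<rho> l \<rho>] holds_matching_cong[of ?\<rho> l "\<lambda>_. h"]
        unfolding matched_def by (intro bexI[of _ l]; cases "pigeon l = x") auto
    qed
    then show ?thesis unfolding U_def by blast
  qed
  then have "card {C \<in> S. \<not> matched ?R ?\<rho> C} \<le> card (U - {C \<in> U. matched {x} (\<lambda>_. h) C})"
    using fin(1) by (intro card_mono) auto
  also have "\<dots> = card U - card {C \<in> U. matched {x} (\<lambda>_. h) C}" using fin(1) by (intro card_Diff_subset) auto
  finally have le: "10 * card {C \<in> S. \<not> matched ?R ?\<rho> C} \<le> 9 * card U" using hit by linarith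
  have "10 ^ Suc t * card {C \<in> S. \<not> matched ?R ?\<rho> C} \<le> 9 * (10 ^ t * card U)"
    using mult_le_mono2[OF le, of "10 ^ t"] by (simp add: mult.left_commute mult.assoc)
  also have "\<dots> \<le> 9 ^ Suc t * card S" using IH unfolding U_def by simp
  finally have "10 ^ Suc t * card {C \<in> S. \<not> matched ?R ?\<rho> C} \<le> 9 ^ Suc t * card S" .
  moreover have "card ?R = Suc t" "finite ?R" using R xh by auto
  moreover have "inj_on ?\<rho> ?R" "?\<rho> ` ?R \<subseteq> Pow {1..k}" using R(3,4) xh by (auto simp: inj_on_def)
  ultimately show ?case by (intro exI[of _ ?R] exI[of _ ?\<rho>]) blast
qed

text \<open>After \<open>r\<close> greedy rounds at most \<open>(9 / 10) ^ r\<close> of the wide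
  clauses are left, which is less than one clause if the proof is shorter than
  \<open>(10 / 9) ^ r\<close>.\<close>

lemma sbc_minus_bphp_lower_bound:
  assumes r: "2 ^ k = 4 * r" "r \<ge> 1" and k: "k \<ge> 1" and \<Pi>: "sbc_minus_proof (bphp_pow k) \<Pi>"
  shows "10 ^ r \<le> 9 ^ r * length \<Pi>"
proof (rule ccontr)
  assume short: "\<not> ?thesis"
  obtain n where n: "length \<Pi> = Suc n" "steps sbc_derivable n (bphp_pow k) (last \<Pi>)" "{} \<in> last \<Pi>"
    using \<Pi> steps_of_proof unfolding sbc_minus_proof_def by metis
  have "\<Pi> \<noteq> []" using n(1) by auto
  then have vars: "vars (last \<Pi>) \<subseteq> vars (bphp_pow k)"
    using \<Pi> unfolding sbc_minus_proof_def proof_vars_def by (auto intro: last_in_set)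
  have lits: "lit_var ` C \<subseteq> vars (bphp_pow k)" if "C \<in> last \<Pi>" for C
    using vars_memberI[OF that] vars by blast
  have fin: "finite C" if "C \<in> last \<Pi>" for C
  proof (rule finite_subset)
    show "C \<subseteq> Pos ` vars (bphp_pow k) \<union> Neg ` vars (bphp_pow k)"
    proof
      fix l assume "l \<in> C"
      then have "lit_var l \<in> vars (bphp_pow k)" using lits[OF that] by blast
      then show "l \<in> Pos ` vars (bphp_pow k) \<union> Neg ` vars (bphp_pow k)" by (cases l) auto
    qed
  qed (simp add: vars_bphp_pow[OF k])
  define S where "S = {C \<in> last \<Pi> - bphp_pow k. 2 ^ k \<le> card (pigeon ` C) + r}"
  have "S \<subseteq> last \<Pi> - bphp_pow k" by (auto simp: S_def)
  then have S: "finite S" "card S \<le> n"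
    using steps_card[OF n(2)] by (auto intro: finite_subset le_trans[OF card_mono])
  have SC: "lit_var ` C \<subseteq> vars (bphp_pow k) \<and> 2 ^ k \<le> card (pigeon ` C) + r \<and> finite C" if "C \<in> S" for C
    using that lits[of C] fin[of C] by (auto simp: S_def)
  obtain R \<rho> where R: "finite R" "card R = r" "inj_on \<rho> R" "\<rho> ` R \<subseteq> Pow {1..k}"
    and le: "10 ^ r * card {C \<in> S. \<not> matched R \<rho> C} \<le> 9 ^ r * card S"
    using greedy_matching[OF r k S(1) SC order_refl] by blast
  have "9 ^ r * card S \<le> 9 ^ r * length \<Pi>" using S(2) n(1) by (intro mult_le_mono2) simp
  then have "10 ^ r * card {C \<in> S. \<not> matched R \<rho> C} < 10 ^ r * 1" using le short by linarith
  then have "card {C \<in> S. \<not> matched R \<rho> C} = 0" by (simp only: mult_less_cancel1) simp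
  then have all: "matched R \<rho> C" if "C \<in> S" for C using S(1) that by auto
  then have "\<forall>C\<in>last \<Pi> - bphp_pow k. 2 ^ k \<le> card (pigeon ` C) + card R \<longrightarrow> matched R \<rho> C"
    using R(2) unfolding S_def by blast
  \<comment> \<open>For the empty clause the invariant applies to \<open>\<rho>\<close> itself and
    demands a true literal in it.\<close>
  from bspec[OF matching_invariant[OF k n(2) order_refl vars R(1) this] n(3)] R(3,4) show False
    by (auto dest: spec[of _ \<rho>])
qed

section \<open>Existence of proofs\<close>

lemma bphp_unsatisfiable:
  assumes "k \<ge> 1"
  shows "unsatisfiable (bphp_pow k)"
  unfolding unsatisfiable_iff
proof (intro allI notI)
  fix \<tau> assume sat: "sat \<tau> (bphp_pow k)"
  define \<mu> where "\<mu> x = {l \<in> {1..k}. \<tau> (bphp_var x l)}" for x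
  have "card (\<mu> ` {1..2 ^ k + 1}) \<le> card (Pow {1..k})" by (intro card_mono) (auto simp: \<mu>_def)
  then have "card (\<mu> ` {1..2 ^ k + 1}) < card {1..2 ^ k + (1::nat)}" by (simp add: card_Pow)
  then have "\<not> inj_on \<mu> {1..2 ^ k + 1}" by (rule pigeonhole)
  then obtain x y where xy: "x \<in> {1..2 ^ k + 1}" "y \<in> {1..2 ^ k + 1}" "x \<noteq> y" "\<mu> x = \<mu> y"
    unfolding inj_on_def by blast
  let ?h = "\<lambda>l. l \<in> \<mu> x"
  obtain l where "l \<in> bphp_block k x ?h \<union> bphp_block k y ?h" "holds \<tau> l"
    using sat bphp_powI[OF xy(1-3)] unfolding sat_def by meson
  moreover have "\<tau> (bphp_var z i) \<longleftrightarrow> i \<in> \<mu> x" if "i \<in> {1..k}" "\<mu> z = \<mu> x" for z i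
  proof -
    have "\<tau> (bphp_var z i) \<longleftrightarrow> i \<in> \<mu> z" using that(1) by (simp add: \<mu>_def)
    then show ?thesis using that(2) by simp
  qed
  ultimately show False using xy(4) by (auto simp: bphp_block_def)
qed

lemma empty_notin_bphp: "k \<ge> 1 \<Longrightarrow> {} \<notin> bphp_pow k"
  unfolding bphp_pow_eq bphp_block_def by auto

text \<open>Gives meaning to the \<open>LEAST\<close> in \<open>sbc_minus_size\<close>. As
  \<open>der\<close> does not control variables, the brute-force refutation is restricted to
  \<open>vars \<Gamma>\<close> afterwards.\<close>

lemma sbc_minus_proof_exists:
  assumes "is_formula \<Gamma>" "unsatisfiable \<Gamma>"
  shows "\<exists>\<Pi>. sbc_minus_proof \<Gamma> \<Pi>"
proof -
  have fin: "\<forall>C\<in>\<Gamma>. finite C" using assms(1) by (auto simp: is_formula_def is_clause_def)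
  then have "finite (vars \<Gamma>)" using assms(1) by (auto simp: vars_def is_formula_def)
  then have "der \<Gamma> (2 ^ card (vars \<Gamma>) * 2) {{}}"
    using assms(2) by (intro der_sem_finer[of \<Gamma>]) (auto simp: unsatisfiable_iff)
  then obtain n \<Delta> where \<Delta>: "steps res_derivable n \<Gamma> \<Delta>" "{} \<in> \<Delta>" unfolding der_def by auto
  let ?R = "restrict (- vars \<Gamma>) (\<lambda>_. True)"
  obtain n' where "steps res_derivable n' (?R \<Gamma>) (?R \<Delta>)"
    using steps_res_restrict[OF \<Delta>(1) fin] by blast
  moreover have "?R \<Gamma> = \<Gamma>" by (rule restrict_id) auto
  ultimately have "steps res_derivable n' \<Gamma> (?R \<Delta>)" by simp
  then have "steps sbc_derivable n' \<Gamma> (?R \<Delta>)"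
    by (induction rule: steps.induct) (auto simp: sbc_derivable_def intro: steps.refl steps.step)
  then obtain \<Pi> where "sbc_proof \<Gamma> \<Pi>" "proof_vars \<Pi> \<subseteq> vars (?R \<Delta>)"
    using proof_of_steps_bot[OF _ empty_in_restrict[OF \<Delta>(2)]] by metis
  moreover have "vars (?R \<Delta>) \<subseteq> vars \<Gamma>" using vars_restrict[of "- vars \<Gamma>" _ \<Delta>] by auto
  ultimately show ?thesis unfolding sbc_minus_proof_def by blast
qed

lemma sbc_minus_size:
  assumes "is_formula \<Gamma>" "unsatisfiable \<Gamma>"
  shows "\<exists>\<Pi>. sbc_minus_proof \<Gamma> \<Pi> \<and> length \<Pi> = sbc_minus_size \<Gamma>"
    and "sbc_minus_proof \<Gamma> \<Pi>' \<Longrightarrow> sbc_minus_size \<Gamma> \<le> length \<Pi>'"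
proof -
  show "\<exists>\<Pi>. sbc_minus_proof \<Gamma> \<Pi> \<and> length \<Pi> = sbc_minus_size \<Gamma>"
    unfolding sbc_minus_size_def by (rule LeastI_ex) (use sbc_minus_proof_exists[OF assms] in blast)
  show "sbc_minus_proof \<Gamma> \<Pi>' \<Longrightarrow> sbc_minus_size \<Gamma> \<le> length \<Pi>'"
    unfolding sbc_minus_size_def by (rule Least_le) blast
qed

section \<open>The separation\<close>

lemma constructionI:
  assumes "is_formula \<Gamma>" "is_I m \<Gamma> F"
  obtains es \<Pi> y z where "construction \<Gamma> es y z m" "F = \<Gamma> \<union> V_part m es y z \<union> W_part m \<Gamma> y z"
    "min_er_proof \<Gamma> (ext_union es) \<Pi>"
  using assms unfolding is_I_def construction_def by blast

text \<open>Here the value of \<open>m_of\<close> enters: \<open>2 ^ m_of \<Gamma>\<close> is at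
  least the least size for \<open>\<Gamma>\<close>, so only proofs of length at most
  \<open>2 ^ m_of \<Gamma>\<close> have to be restricted.\<close>

lemma sbc_minus_lower_transfer:
  assumes \<Gamma>: "is_formula \<Gamma>" "unsatisfiable \<Gamma>" and F: "is_I (m_of \<Gamma>) \<Gamma> F" and \<Pi>: "sbc_minus_proof F \<Pi>"
  shows "sbc_minus_size \<Gamma> \<le> length \<Pi>"
proof (cases "length \<Pi> \<le> 2 ^ m_of \<Gamma>")
  case True
  obtain es \<Pi>0 y z where c: "construction \<Gamma> es y z (m_of \<Gamma>)"
    "F = \<Gamma> \<union> V_part (m_of \<Gamma>) es y z \<union> W_part (m_of \<Gamma>) \<Gamma> y z"
    using constructionI[OF \<Gamma>(1) F] by metis
  obtain \<Pi>' where "sbc_minus_proof \<Gamma> \<Pi>'" "length \<Pi>' \<le> length \<Pi>"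
    using construction.sbc_minus_restrict[OF c(1) \<Gamma>(2) _ True] \<Pi> c(2) by blast
  then show ?thesis using sbc_minus_size(2)[OF \<Gamma>] by (meson order_trans)
next
  case False
  have "sbc_minus_size \<Gamma> > 0"
    using sbc_minus_size(1)[OF \<Gamma>] unfolding sbc_minus_proof_def is_proof_by_def by (metis length_greater_0_conv)
  then have "real (sbc_minus_size \<Gamma>) = 2 powr log 2 (real (sbc_minus_size \<Gamma>))" by simp
  also have "\<dots> \<le> 2 powr real (m_of \<Gamma>)"
    unfolding m_of_def by (intro powr_mono real_nat_ceiling_ge) simp
  also have "\<dots> = 2 ^ m_of \<Gamma>" by (simp add: powr_realpow)
  also have "\<dots> \<le> real (length \<Pi>)" using False by simp
  finally show ?thesis by simp
qed

lemma bphp_exponent: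
  assumes "n \<ge> 2"
  obtains k where "BPHP n = bphp_pow k" "k \<ge> 1" "2 ^ k \<le> n" "n < 2 * 2 ^ k"
proof -
  let ?P = "\<lambda>k. 2 ^ k \<le> n"
  have bound: "k \<le> n" if "?P k" for k using that less_exp[of k] by linarith
  define k where "k = (GREATEST k. ?P k)"
  have "?P k" unfolding k_def by (rule GreatestI_nat[of ?P 0 n, OF _ bound]) (use assms in auto)
  moreover have "1 \<le> k" unfolding k_def by (rule Greatest_le_nat[of ?P 1 n, OF _ bound]) (use assms in auto)
  moreover have "\<not> ?P (Suc k)"
  proof
    assume "?P (Suc k)"
    from Greatest_le_nat[of ?P "Suc k" n, OF this bound] have "Suc k \<le> k" unfolding k_def .
    then show False by simp
  qed
  ultimately show ?thesis using that[of k] by (simp add: BPHP_def k_def)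
qed

text \<open>For \<open>2 ^ k = 4 * r\<close>, the bound \<open>(10 / 9) ^ r\<close> is stated in
  terms of \<open>2 * 2 ^ k = 8 * r\<close>, the strict upper bound on the \<open>n\<close> with
  \<open>BPHP n = bphp_pow k\<close>; hence the division by 8.\<close>

lemma sbc_minus_size_bphp:
  assumes k: "k \<ge> 1"
  shows "2 \<le> sbc_minus_size (bphp_pow k)"
    and "2 powr (log 2 (10 / 9) / 8 * (2 * 2 ^ k)) \<le> real (sbc_minus_size (bphp_pow k))"
proof -
  let ?\<Gamma> = "bphp_pow k" and ?L = "log 2 (10 / 9 :: real)"
  obtain \<Pi> where \<Pi>: "sbc_minus_proof ?\<Gamma> \<Pi>" "length \<Pi> = sbc_minus_size ?\<Gamma>"
    using sbc_minus_size(1)[OF is_formula_bphp_pow bphp_unsatisfiable[OF k]] by blast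
  obtain n where n: "length \<Pi> = Suc n" "steps sbc_derivable n ?\<Gamma> (last \<Pi>)" "{} \<in> last \<Pi>"
    using \<Pi>(1) steps_of_proof unfolding sbc_minus_proof_def by metis
  have "n \<noteq> 0"
  proof
    assume "n = 0"
    then have "last \<Pi> = ?\<Gamma>" using n(2) by (auto elim: steps.cases)
    then show False using n(3) empty_notin_bphp[OF k] by simp
  qed
  then show two: "2 \<le> sbc_minus_size ?\<Gamma>" using n(1) \<Pi>(2) by simp
  show "2 powr (?L / 8 * (2 * 2 ^ k)) \<le> real (sbc_minus_size ?\<Gamma>)"
  \<comment> \<open>Two holes cannot be quartered; for \<open>k = 1\<close> the trivial bound 2
    suffices.\<close>
  proof (cases "k = 1")
    case True
    have "?L \<le> log 2 2" by (subst log_le_cancel_iff) auto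
    then have "?L \<le> 1" by simp
    then have "?L / 8 * (2 * 2 ^ k) \<le> 1" unfolding True power_one_right by linarith
    then have "2 powr (?L / 8 * (2 * 2 ^ k)) \<le> 2 powr 1" by (rule powr_mono) simp
    then show ?thesis using two by simp
  next
    case False
    then obtain k' where k': "k = Suc (Suc k')" using k by (metis One_nat_def not0_implies_Suc not_one_le_zero)
    define r :: nat where "r = 2 ^ k'"
    have r: "2 ^ k = 4 * r" "r \<ge> 1" by (auto simp: r_def k')
    have "real (10 ^ r) \<le> real (9 ^ r * length \<Pi>)"
      using sbc_minus_bphp_lower_bound[OF r k \<Pi>(1)] by (rule of_nat_mono)
    then have "(10 / 9) ^ r \<le> real (sbc_minus_size ?\<Gamma>)" using \<Pi>(2) by (simp add: power_divide field_simps)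
    moreover have "(10 / 9 :: real) ^ r = 2 powr (?L * real r)"
      by (subst powr_powr[symmetric]) (simp add: powr_realpow)
    moreover have "?L / 8 * (2 * 2 ^ k) = ?L * real r"
    proof -
      have "(2::real) ^ k = 4 * real r" using r(1) by (metis of_nat_mult of_nat_numeral of_nat_power)
      then show ?thesis by simp
    qed
    ultimately show ?thesis by (simp only:)
  qed
qed

text \<open>\<open>K\<close> is an arbitrary selection among the possible results of the
  construction, so every choice of minimal ER proof, presentation and fresh variables is covered.
  The exponent and the rate found do not depend on \<open>K\<close>.\<close>

theorem theorem27:
  fixes K :: "nat literal set set \<Rightarrow> nat literal set set"
  assumes "\<And>\<Gamma>. is_formula \<Gamma> \<Longrightarrow> unsatisfiable \<Gamma> \<Longrightarrow> is_I (m_of \<Gamma>) \<Gamma> (K \<Gamma>)"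
  shows "(\<exists>c::nat. \<forall>n\<ge>2. \<exists>\<Lambda> \<Pi>. ger_minus_proof (K (BPHP n)) \<Lambda> \<Pi> \<and> card \<Lambda> + length \<Pi> \<le> n ^ c)
    \<and> (\<exists>\<epsilon>::real. \<epsilon> > 0 \<and> (\<forall>n\<ge>2. \<forall>\<Pi>. sbc_minus_proof (K (BPHP n)) \<Pi> \<longrightarrow>
          2 powr (\<epsilon> * real n) \<le> real (length \<Pi>)))"
proof (rule conjI; rule exI)
  show "\<forall>n\<ge>2. \<exists>\<Lambda> \<Pi>. ger_minus_proof (K (BPHP n)) \<Lambda> \<Pi> \<and> card \<Lambda> + length \<Pi> \<le> n ^ 30"
  proof (intro allI impI)
    fix n :: nat assume "n \<ge> 2"
    then obtain k where k: "BPHP n = bphp_pow k" "k \<ge> 1" "2 ^ k \<le> n" by (rule bphp_exponent)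
    let ?\<Gamma> = "bphp_pow k"
    have I: "is_I (m_of ?\<Gamma>) ?\<Gamma> (K ?\<Gamma>)" by (rule assms[OF is_formula_bphp_pow bphp_unsatisfiable[OF k(2)]])
    obtain es \<Pi> y z where c: "construction ?\<Gamma> es y z (m_of ?\<Gamma>)"
      "K ?\<Gamma> = ?\<Gamma> \<union> V_part (m_of ?\<Gamma>) es y z \<union> W_part (m_of ?\<Gamma>) ?\<Gamma> y z"
      and min: "min_er_proof ?\<Gamma> (ext_union es) \<Pi>"
      by (rule constructionI[OF is_formula_bphp_pow I])
    \<comment> \<open>A least size of at least 2 gives \<open>m \<ge> 1\<close>, so that
      \<open>V\<close> mentions the extension variables.\<close>
    have "log 2 2 \<le> log 2 (real (sbc_minus_size ?\<Gamma>))"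
      using sbc_minus_size_bphp(1)[OF k(2)] by (subst log_le_cancel_iff) auto
    then have m: "m_of ?\<Gamma> \<ge> 1" unfolding m_of_def by (simp add: le_nat_iff le_ceiling_iff)
    have "res_proof (?\<Gamma> \<union> ext_union es) \<Pi>" using min unfolding min_er_proof_def er_proof_def by blast
    then obtain \<Lambda> \<Pi>' where G: "ger_minus_proof (K ?\<Gamma>) \<Lambda> \<Pi>'"
      "card \<Lambda> + length \<Pi>' \<le> card (ext_union es) + length \<Pi>"
      using construction.ger_minus_proof[OF c(1) m] c(2) by metis
    obtain \<Lambda>0 \<Pi>0 where E: "er_proof ?\<Gamma> \<Lambda>0 \<Pi>0" "card \<Lambda>0 + length \<Pi>0 \<le> (2 ^ k) ^ 30"
      using er_proof_bphp[OF k(2)] by blast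
    have "card (ext_union es) + length \<Pi> \<le> card \<Lambda>0 + length \<Pi>0"
      using min E(1) unfolding min_er_proof_def by blast
    also have "\<dots> \<le> n ^ 30" using E(2) power_mono[OF k(3), of 30] by linarith
    finally have "card \<Lambda> + length \<Pi>' \<le> n ^ 30" using G(2) by linarith
    with G(1) show "\<exists>\<Lambda> \<Pi>. ger_minus_proof (K (BPHP n)) \<Lambda> \<Pi> \<and> card \<Lambda> + length \<Pi> \<le> n ^ 30"
      unfolding k(1) by blast
  qed
  show "log 2 (10 / 9 :: real) / 8 > 0 \<and> (\<forall>n\<ge>2. \<forall>\<Pi>. sbc_minus_proof (K (BPHP n)) \<Pi> \<longrightarrow>
      2 powr (log 2 (10 / 9 :: real) / 8 * real n) \<le> real (length \<Pi>))"
  proof (intro conjI allI impI)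
    show "0 < log 2 (10 / 9 :: real) / 8" by simp
    fix n \<Pi> assume "n \<ge> (2::nat)" and \<Pi>: "sbc_minus_proof (K (BPHP n)) \<Pi>"
    then obtain k where k: "BPHP n = bphp_pow k" "k \<ge> 1" "n < 2 * 2 ^ k" using bphp_exponent by metis
    let ?\<Gamma> = "bphp_pow k"
    have "sbc_minus_size ?\<Gamma> \<le> length \<Pi>"
      using sbc_minus_lower_transfer[OF is_formula_bphp_pow bphp_unsatisfiable[OF k(2)]
        assms[OF is_formula_bphp_pow bphp_unsatisfiable[OF k(2)]]] \<Pi> unfolding k(1) by blast
    moreover have "real n \<le> real (2 * 2 ^ k)" using k(3) by (intro of_nat_mono) simp
    then have "log 2 (10 / 9) / 8 * real n \<le> log 2 (10 / 9) / 8 * (2 * 2 ^ k)"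
      by (intro mult_left_mono) auto
    then have "2 powr (log 2 (10 / 9) / 8 * real n) \<le> 2 powr (log 2 (10 / 9) / 8 * (2 * 2 ^ k))"
      by (intro powr_mono) auto
    ultimately show "2 powr (log 2 (10 / 9) / 8 * real n) \<le> real (length \<Pi>)"
      using sbc_minus_size_bphp(2)[OF k(2)] by (meson of_nat_mono order_trans)
  qed
qed

end
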